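(* Let $L\in(0,1)$. For $a\in[-\infty,\sqrt2\,\operatorname{erf}^{-1}(1-2L)]$ let $b(a)\in(-\infty,+\infty]$ be the number with $a<b(a)$ and $\gamma_1(a,b(a))=L$. Then $$\min_a \mu_1(a,b(a))=\mu_1\big(-\infty,\sqrt2\,\operatorname{erf}^{-1}(2L-1)\big)=\mu_1\big(\sqrt2\,\operatorname{erf}^{-1}(1-2L),+\infty\big)$$ and $$\max_a \mu_1(a,b(a))=\mu_1\big(-\sqrt2\,\operatorname{erf}^{-1}(L),\sqrt2\,\operatorname{erf}^{-1}(L)\big),$$ where the minimum and maximum are over $a\in[-\infty,\sqrt2\,\operatorname{erf}^{-1}(1-2L)]$. Furthermore, the function $f(a)=\mu_1(a,b(a))$ is (strictly) increasing in the interval $[-\infty,-\sqrt2\,\operatorname{erf}^{-1}(L)]$.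
   Context: $\gamma_1$ is the normalized Gaussian measure on $\mathbb{R}$, $d\gamma_1=(2\pi)^{-1/2}e^{-x^2/2}dx$, and $\gamma_1(a,b)$ is the measure of the interval $(a,b)$, $-\infty\le a<b\le+\infty$. The error function is $\operatorname{erf}(x)=\frac{2}{\sqrt\pi}\int_0^x e^{-t^2}dt$, with the conventions $\operatorname{erf}(\pm\infty)=\pm1$, $\operatorname{erf}^{-1}(\pm1)=\pm\infty$. Explicitly, $b(a)=\sqrt2\,\operatorname{erf}^{-1}\big[2L+\operatorname{erf}(a/\sqrt2)\big]$. For an interval $(a,b)$ with $\gamma_1(a,b)<1$, $\mu_1(a,b)$ denotes the first nontrivial eigenvalue of $$-u''+xu'=\mu u\ \text{ in }(a,b),\qquad u'(a)=u'(b)=0,$$ given by $$\mu_1(a,b)=\min\left\{\frac{\int_a^b (u')^2\,d\gamma_1}{\int_a^b u^2\,d\gamma_1}: u\in H^1((a,b),\gamma_1),\ u\neq0,\ \int_a^b u\,d\gamma_1=0\right\},$$ where $H^1((a,b),\gamma_1)=\{u\in W^{1,1}_{\mathrm{loc}}(a,b): u,u'\in L^2((a,b),\gamma_1)\}$ (this is also the meaning when an endpoint is infinite). *)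

theory Defs
  imports "HOL-Probability.Probability"
begin

definition gauss :: "real measure" where
  "gauss = density lborel (\<lambda>x. ennreal (std_normal_density x))"

definition gamma1 :: "ereal \<Rightarrow> ereal \<Rightarrow> real" where
  "gamma1 a b = measure gauss (einterval a b)"

fun erf :: "ereal \<Rightarrow> real" where
  "erf (ereal x) = 2 / sqrt pi * (LBINT t=0..x. exp (- t\<^sup>2))"
| "erf PInfty = 1"
| "erf MInfty = - 1"

text \<open>\<^const>\<open>erf\<close> is a bijection from the extended reals onto \<open>[-1, 1]\<close>; \<open>erf_inv y\<close> is only
  meaningful for \<open>y\<close> in that interval.\<close>

definition erf_inv :: "real \<Rightarrow> ereal" where
  "erf_inv = inv erf"

definition locally_integrable_on :: "(real \<Rightarrow> real) \<Rightarrow> real set \<Rightarrow> bool" where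
  "locally_integrable_on u S \<longleftrightarrow> (\<forall>K. compact K \<and> K \<subseteq> S \<longrightarrow> set_integrable lborel K u)"

text \<open>Membership of \<open>u\<close> in the local Sobolev space of order \<open>(1,1)\<close> on an open set \<open>S\<close>, with weak
  derivative \<open>u'\<close>. The test functions \<open>\<phi>\<close> are continuously differentiable with compact support in
  \<open>S\<close>, as in Brezis, Functional Analysis, Sobolev Spaces and Partial Differential Equations,
  Section 8.2; \<open>\<phi>'\<close> is the derivative of \<open>\<phi>\<close>. The function \<open>u'\<close> is determined by \<open>u\<close> almost everywhere
  on \<open>S\<close>.\<close>

definition W11_loc :: "real set \<Rightarrow> (real \<Rightarrow> real) \<Rightarrow> (real \<Rightarrow> real) \<Rightarrow> bool" where
  "W11_loc S u u' \<longleftrightarrow> locally_integrable_on u S \<and> locally_integrable_on u' S \<and>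
     (\<forall>\<phi> \<phi>'. (\<forall>x. (\<phi> has_real_derivative \<phi>' x) (at x)) \<and> continuous_on UNIV \<phi>' \<and>
        (\<exists>K. compact K \<and> K \<subseteq> S \<and> (\<forall>x. x \<notin> K \<longrightarrow> \<phi> x = 0)) \<longrightarrow>
        (LINT x:S|lborel. u x * \<phi>' x) = - (LINT x:S|lborel. u' x * \<phi> x))"

definition H1_gauss :: "ereal \<Rightarrow> ereal \<Rightarrow> (real \<Rightarrow> real) \<Rightarrow> (real \<Rightarrow> real) \<Rightarrow> bool" where
  "H1_gauss a b u u' \<longleftrightarrow> W11_loc (einterval a b) u u' \<and>
     set_integrable gauss (einterval a b) (\<lambda>x. (u x)\<^sup>2) \<and>
     set_integrable gauss (einterval a b) (\<lambda>x. (u' x)\<^sup>2)"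

text \<open>The minimum of the Rayleigh quotients. Elements of the Sobolev space are classes modulo
  almost everywhere equality, so \<open>u \<noteq> 0\<close> means that \<open>u\<close> does not vanish almost everywhere.
  \<^const>\<open>Least\<close> on the reals carries information only when the minimum is attained.\<close>

definition mu1 :: "ereal \<Rightarrow> ereal \<Rightarrow> real" where
  "mu1 a b = (LEAST q. \<exists>u u'. H1_gauss a b u u' \<and>
     \<not> (AE x\<in>einterval a b in lborel. u x = 0) \<and>
     (LINT x:einterval a b|gauss. u x) = 0 \<and>
     q = (LINT x:einterval a b|gauss. (u' x)\<^sup>2) / (LINT x:einterval a b|gauss. (u x)\<^sup>2))"

definition right_end :: "real \<Rightarrow> ereal \<Rightarrow> ereal" where
  "right_end L a = (THE b. a < b \<and> gamma1 a b = L)"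

end

theory Submission
  imports Defs "HOL-Complex_Analysis.Great_Picard" "HOL-Real_Asymp.Real_Asymp"
begin

text \<open>
  Put \<open>t = \<Phi>(x) - s\<close>, where \<open>\<Phi>\<close> is the Gaussian distribution function and \<open>s = \<Phi>(a)\<close>; the interval
  \<open>(a, b(a))\<close> becomes \<open>(0, L)\<close> with Lebesgue measure for every \<open>a\<close>. With
  \<open>p(t) = 1 / \<gamma>(\<Phi>\<^sup>-\<^sup>1(t))\<^sup>2\<close>, duality (an operator and its adjoint have the same norm) gives
  \<open>1 / \<mu>\<^sub>1 = M(s)\<close>, the maximum of \<open>\<integral> p(s + t) W(t)\<^sup>2 dt / \<integral> W'(t)\<^sup>2 dt\<close> over \<open>W\<close> with
  \<open>W(0) = W(L) = 0\<close>. Now \<open>s\<close> occurs only in the weight \<open>p\<close>, which is strictly convex and symmetric about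
  \<open>1/2\<close>. Hence \<open>M\<close>, a maximum of functions that are convex in \<open>s\<close>, is strictly convex and symmetric
  about \<open>(1 - L)/2\<close>, so it decreases strictly up to the midpoint.

  The maximum is attained also on half-lines, where the weight is singular: the singularity is weaker
  than the critical one of Hardy's inequality, i.e. \<open>t\<^sup>2 p(t) \<rightarrow> 0\<close> at 0.
\<close>

section \<open>Mean-zero square-integrable functions and their primitives\<close>

text \<open>Passing to the dual problem is what makes convexity visible. In the primal quotient
  \<open>s\<close> sits in the weight \<open>profile (s + t)^2\<close>, whose second derivative in
  terms of \<open>x = Phi_inv (s + t)\<close> is \<open>2 * x^2 - 2\<close>; it changes sign, so no
  convexity argument applies directly. The dual weight has second derivative
  \<open>(2 + 6 * x^2) / profile^4 > 0\<close>. The operator behind the duality sends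
  \<open>W'\<close> to \<open>sqrt p * W\<close>; by the weak formulation the transformed
  \<open>u\<close> is, up to sign, its adjoint applied to the transformed \<open>u'\<close>.
  Attainment of \<open>M(s)\<close> matters twice. The eigenvalue is a \<open>LEAST\<close>, hence
  meaningful only if the minimum is attained; and strict convexity needs an actual maximizer at the
  intermediate point as common test function, since a mere supremum would inherit only weak
  convexity. The maximizer is a pointwise limit of primitives: the bound on \<open>W'\<close> gives
  equicontinuity, Hardy's inequality keeps the energy from escaping into the endpoints, and the
  Euler-Lagrange equation survives the limit in integrated form, from which regularity is
  recovered.\<close>

lemma discriminant_nonpos:
  fixes a b c :: real
  assumes "\<And>x. 0 \<le> a + 2 * b * x + c * x\<^sup>2"
  shows "b\<^sup>2 \<le> a * c"
proof (cases "c = 0")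
  case True
  have "b = 0"
  proof (rule ccontr)
    assume "b \<noteq> 0"
    \<comment> \<open>Without the quadratic term the expression is affine in \<open>x\<close> and
      equals -1 at this point.\<close>
    with True assms[of "(- a - 1) / (2 * b)"] show False by simp
  qed
  with True show ?thesis by simp
next
  case False
  have c: "c > 0"
  proof (rule ccontr)
    assume "\<not> c > 0"
    with False have c: "c < 0" by simp
    \<comment> \<open>Chosen so that \<open>2 * b + c * ?x\<close> is at most
      \<open>- \<bar>a\<bar> - 1\<close> and \<open>?x\<close> is at least 1; their product then
      outweighs \<open>a\<close>.\<close>
    let ?x = "(\<bar>a\<bar> + 2 * \<bar>b\<bar> + 1) / (- c) + 1"
    have x: "?x \<ge> 1" using c by (simp add: field_simps)
    have cx: "c * ?x = - (\<bar>a\<bar> + 2 * \<bar>b\<bar> + 1) + c" using c by (simp add: field_simps)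
    have "a + 2 * b * y + c * y\<^sup>2 = a + y * (2 * b + c * y)" for y
      by (simp add: power2_eq_square distrib_left mult_ac)
    also have "a + ?x * (2 * b + c * ?x) \<le> a + ?x * (- \<bar>a\<bar> - 1)"
      unfolding cx using x c by (intro add_left_mono mult_left_mono) auto
    also have "\<dots> \<le> a + 1 * (- \<bar>a\<bar> - 1)"
      by (intro add_left_mono mult_right_mono_neg) (use x in auto)
    also have "\<dots> < 0" by simp
    finally show False using assms[of ?x] by simp
  qed
  have "0 \<le> a + 2 * b * (- b / c) + c * (- b / c)\<^sup>2" by (rule assms)
  also have "\<dots> = a - b\<^sup>2 / c" using c by (simp add: power2_eq_square field_simps)
  finally show ?thesis using c by (simp add: field_simps)
qed

lemma integrable_mult_of_square:
  fixes f g :: "'a \<Rightarrow> real"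
  assumes [measurable]: "f \<in> borel_measurable M" "g \<in> borel_measurable M"
    and "integrable M (\<lambda>x. (f x)\<^sup>2)" "integrable M (\<lambda>x. (g x)\<^sup>2)"
  shows "integrable M (\<lambda>x. f x * g x)"
proof (rule Bochner_Integration.integrable_bound)
  show "integrable M (\<lambda>x. (f x)\<^sup>2 + (g x)\<^sup>2)" using assms by simp
  show "AE x in M. norm (f x * g x) \<le> norm ((f x)\<^sup>2 + (g x)\<^sup>2)"
  proof (intro AE_I2)
    fix x
    have "0 \<le> (\<bar>f x\<bar> - \<bar>g x\<bar>)\<^sup>2" by simp
    then have "2 * (\<bar>f x\<bar> * \<bar>g x\<bar>) \<le> (f x)\<^sup>2 + (g x)\<^sup>2" by (simp add: power2_diff)
    moreover have "0 \<le> \<bar>f x\<bar> * \<bar>g x\<bar>" by simp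
    ultimately show "norm (f x * g x) \<le> norm ((f x)\<^sup>2 + (g x)\<^sup>2)"
      unfolding real_norm_def abs_mult by linarith
  qed
qed measurable

lemma integrable_add_square:
  fixes f g :: "'a \<Rightarrow> real"
  assumes [measurable]: "f \<in> borel_measurable M" "g \<in> borel_measurable M"
    and "integrable M (\<lambda>x. (f x)\<^sup>2)" "integrable M (\<lambda>x. (g x)\<^sup>2)"
  shows "integrable M (\<lambda>x. (f x + c * g x)\<^sup>2)"
    and "(LINT x|M. (f x + c * g x)\<^sup>2) =
      (LINT x|M. (f x)\<^sup>2) + 2 * (LINT x|M. f x * g x) * c + (LINT x|M. (g x)\<^sup>2) * c\<^sup>2"
proof -
  have eq: "(\<lambda>x. (f x + c * g x)\<^sup>2) = (\<lambda>x. (f x)\<^sup>2 + 2 * c * (f x * g x) + c\<^sup>2 * (g x)\<^sup>2)"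
    by (auto simp: power2_sum power_mult_distrib algebra_simps)
  note i = integrable_mult_of_square[OF assms]
  show "integrable M (\<lambda>x. (f x + c * g x)\<^sup>2)" unfolding eq using i assms by simp
  show "(LINT x|M. (f x + c * g x)\<^sup>2) =
      (LINT x|M. (f x)\<^sup>2) + 2 * (LINT x|M. f x * g x) * c + (LINT x|M. (g x)\<^sup>2) * c\<^sup>2"
    unfolding eq using i assms by simp
qed

lemma Cauchy_Schwarz_integral:
  fixes f g :: "'a \<Rightarrow> real"
  assumes "f \<in> borel_measurable M" "g \<in> borel_measurable M"
    and "integrable M (\<lambda>x. (f x)\<^sup>2)" "integrable M (\<lambda>x. (g x)\<^sup>2)"
  shows "(LINT x|M. f x * g x)\<^sup>2 \<le> (LINT x|M. (f x)\<^sup>2) * (LINT x|M. (g x)\<^sup>2)"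
  by (rule discriminant_nonpos, subst integrable_add_square(2)[OF assms, symmetric]) simp

text \<open>These are the derivatives \<open>W'\<close> of the competitors \<open>W\<close> that
  vanish at 0 and \<open>L\<close>: the mean-zero condition encodes \<open>W(L) = 0\<close>.
  Extension by zero to the whole line lets all integrals run over \<open>lborel\<close>.\<close>

definition L20 :: "real \<Rightarrow> (real \<Rightarrow> real) \<Rightarrow> bool" where
  "L20 L w \<longleftrightarrow> w \<in> borel_measurable borel \<and> integrable lborel (\<lambda>x. (w x)\<^sup>2) \<and>
     (\<forall>x. x \<notin> {0<..<L} \<longrightarrow> w x = 0) \<and> (LINT x|lborel. w x) = 0"

text \<open>Integrating from minus infinity makes one notion serve for the competitors, where it
  amounts to the integral from 0, and for the Gaussian distribution function.\<close>

definition prim :: "(real \<Rightarrow> real) \<Rightarrow> real \<Rightarrow> real" where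
  "prim w t = (LINT r|lborel. indicator {..t} r * w r)"

lemma L20_measurable: "L20 L w \<Longrightarrow> w \<in> borel_measurable borel"
  and L20_square: "L20 L w \<Longrightarrow> integrable lborel (\<lambda>x. (w x)\<^sup>2)"
  and L20_outside: "L20 L w \<Longrightarrow> x \<notin> {0<..<L} \<Longrightarrow> w x = 0"
  and L20_mean: "L20 L w \<Longrightarrow> (LINT x|lborel. w x) = 0"
  by (auto simp: L20_def)

lemma integrable_indicator_Ioo [simp]: "integrable lborel (indicator {a<..<b::real} :: real \<Rightarrow> real)"
  by (cases "a \<le> b") (auto intro!: integrable_real_indicator)

lemma indicator_square: "(indicator A x :: real)\<^sup>2 = indicator A x"
  by (auto simp: indicator_def)

lemma integrable_of_square_on_Ioo:
  fixes w :: "real \<Rightarrow> real"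
  assumes [measurable]: "w \<in> borel_measurable borel" and "integrable lborel (\<lambda>x. (w x)\<^sup>2)"
    and "\<And>x. x \<notin> {a<..<b} \<Longrightarrow> w x = 0"
  shows "integrable lborel w"
proof -
  have "integrable lborel (\<lambda>x. w x * indicator {a<..<b} x)"
    by (rule integrable_mult_of_square)
       (use assms in \<open>auto simp: indicator_square intro!: integrable_real_indicator emeasure_bounded_finite\<close>)
  also have "(\<lambda>x. w x * indicator {a<..<b} x) = w"
    using assms(3) by (auto simp: indicator_def fun_eq_iff)
  finally show ?thesis .
qed

lemma L20_integrable: "L20 L w \<Longrightarrow> integrable lborel w"
  by (rule integrable_of_square_on_Ioo[of _ 0 L]) (auto simp: L20_def)

lemma prim_integrable:
  fixes w :: "real \<Rightarrow> real"
  assumes "integrable lborel w" shows "integrable lborel (\<lambda>r. indicator {..t} r * w r :: real)"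
  using integrable_mult_indicator[of "{..t}" lborel w] assms by simp

lemma prim_diff:
  assumes "integrable lborel w" "s \<le> t"
  shows "prim w t - prim w s = (LINT r|lborel. indicator {s<..t} r * w r)"
proof -
  have "(\<lambda>r. indicator {..t} r * w r - indicator {..s} r * w r) = (\<lambda>r. indicator {s<..t} r * w r)"
    using assms(2) by (auto simp: indicator_def)
  then show ?thesis
    unfolding prim_def using prim_integrable[OF assms(1)]
    by (subst Bochner_Integration.integral_diff[symmetric]) auto
qed

text \<open>Cauchy-Schwarz against the indicator of \<open>{s<..t}\<close>. The exponent 1/2 has two
  uses: with one point at 0 or \<open>L\<close> it bounds the primitive near the ends, and for
  general points it gives the equicontinuity of a normalized sequence.\<close>

lemma prim_Holder:
  assumes w: "w \<in> borel_measurable borel" "integrable lborel (\<lambda>x. (w x)\<^sup>2)" "integrable lborel w"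
    and st: "s \<le> t"
  shows "(prim w t - prim w s)\<^sup>2 \<le> (t - s) * (LINT x|lborel. (w x)\<^sup>2)"
proof -
  have "(LINT r|lborel. indicator {s<..t} r * w r)\<^sup>2
      \<le> (LINT r|lborel. (indicator {s<..t} r)\<^sup>2) * (LINT x|lborel. (w x)\<^sup>2)"
    by (rule Cauchy_Schwarz_integral)
       (use w st in \<open>auto simp: indicator_square intro!: integrable_real_indicator\<close>)
  with st show ?thesis by (simp add: prim_diff[OF w(3) st] indicator_square)
qed

lemma prim_le_0: "L20 L w \<Longrightarrow> t \<le> 0 \<Longrightarrow> prim w t = 0"
  unfolding prim_def by (rule integral_eq_zero_AE) (auto simp: indicator_def L20_outside)

lemma prim_ge: 
  assumes "L20 L w" "L \<le> t" shows "prim w t = 0"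
proof -
  have "(\<lambda>r. indicator {..t} r * w r) = w"
    using assms L20_outside[OF assms(1)] by (force simp: indicator_def fun_eq_iff)
  then show ?thesis using L20_mean[OF assms(1)] by (simp add: prim_def)
qed

lemma prim_outside: "L20 L w \<Longrightarrow> t \<notin> {0<..<L} \<Longrightarrow> prim w t = 0"
  using prim_le_0[of L w t] prim_ge[of L w t] by force

lemma L20_prim_Holder:
  assumes "L20 L w"
  shows "(prim w t - prim w s)\<^sup>2 \<le> \<bar>t - s\<bar> * (LINT x|lborel. (w x)\<^sup>2)"
  using prim_Holder[OF L20_measurable L20_square L20_integrable, OF assms assms assms, of s t]
    prim_Holder[OF L20_measurable L20_square L20_integrable, OF assms assms assms, of t s]
  by (cases "s \<le> t") (auto simp: power2_commute)

lemma L20_prim_continuous: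
  assumes "L20 L w" shows "continuous_on UNIV (prim w)"
proof -
  let ?N = "LINT x|lborel. (w x)\<^sup>2"
  have "isCont (prim w) t" for t
  proof -
    have "((\<lambda>x. prim w x - prim w t) \<longlongrightarrow> 0) (at t)"
    proof (rule Lim_null_comparison)
      show "eventually (\<lambda>x. norm (prim w x - prim w t) \<le> sqrt (\<bar>x - t\<bar> * ?N)) (at t)"
        using L20_prim_Holder[OF assms] by (auto intro!: always_eventually real_le_rsqrt)
      show "((\<lambda>x. sqrt (\<bar>x - t\<bar> * ?N)) \<longlongrightarrow> 0) (at t)"
        by (auto intro!: tendsto_eq_intros)
    qed
    then show ?thesis by (simp add: isCont_def LIM_zero_iff)
  qed
  then show ?thesis by (simp add: continuous_at_imp_continuous_on)
qed

lemma L20_prim_measurable: "L20 L w \<Longrightarrow> prim w \<in> borel_measurable borel"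
  by (intro borel_measurable_continuous_onI L20_prim_continuous)

lemma L20_prim_bound:
  assumes "L20 L w" "0 < t" "t < L"
  shows "(prim w t)\<^sup>2 \<le> t * (LINT x|lborel. (w x)\<^sup>2)"
    and "(prim w t)\<^sup>2 \<le> (L - t) * (LINT x|lborel. (w x)\<^sup>2)"
  using L20_prim_Holder[OF assms(1), of t 0] L20_prim_Holder[OF assms(1), of t L]
    prim_le_0[OF assms(1), of 0] prim_ge[OF assms(1), of L] assms(2,3) by auto

lemma L20_add:
  assumes "L20 L f" "L20 L g"
  shows "L20 L (\<lambda>x. f x + c * g x)"
    and "prim (\<lambda>x. f x + c * g x) = (\<lambda>t. prim f t + c * prim g t)"
proof -
  note L20_measurable[OF assms(1), measurable] L20_measurable[OF assms(2), measurable]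
  have "integrable lborel (\<lambda>x. (f x + c * g x)\<^sup>2)"
    by (rule integrable_add_square) (use assms in \<open>auto simp: L20_def\<close>)
  then show "L20 L (\<lambda>x. f x + c * g x)"
    using assms L20_integrable[OF assms(1)] L20_integrable[OF assms(2)]
    by (auto simp: L20_def)
  show "prim (\<lambda>x. f x + c * g x) = (\<lambda>t. prim f t + c * prim g t)"
  proof
    fix t
    have "prim (\<lambda>x. f x + c * g x) t
      = (LINT r|lborel. indicator {..t} r * f r + c * (indicator {..t} r * g r))"
      unfolding prim_def by (rule Bochner_Integration.integral_cong) (auto simp: algebra_simps)
    also have "\<dots> = prim f t + c * prim g t"
      unfolding prim_def
      using prim_integrable[OF L20_integrable[OF assms(1)], of t]
        prim_integrable[OF L20_integrable[OF assms(2)], of t]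
      by simp
    finally show "prim (\<lambda>x. f x + c * g x) t = prim f t + c * prim g t" .
  qed
qed

lemma L20_scale:
  assumes "L20 L f"
  shows "L20 L (\<lambda>x. c * f x)" "prim (\<lambda>x. c * f x) = (\<lambda>t. c * prim f t)"
proof -
  have "L20 L (\<lambda>x. 0 * f x)" using assms by (simp add: L20_def)
  from L20_add[OF this assms, of c] show "L20 L (\<lambda>x. c * f x)" "prim (\<lambda>x. c * f x) = (\<lambda>t. c * prim f t)"
    by (auto simp: prim_def)
qed

text \<open>The reflected competitor \<open>W(L - t)\<close> has derivative
  \<open>- w (L - t)\<close>, which explains the sign. It transfers Hardy's inequality to the right
  end and gives the symmetry of \<open>M\<close> in \<open>s\<close>.\<close>

lemma L20_reflect:
  assumes "L20 L w"
  shows "L20 L (\<lambda>x. - w (L - x))"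
    and "prim (\<lambda>x. - w (L - x)) t = prim w (L - t)"
    and "(LINT x|lborel. (- w (L - x))\<^sup>2) = (LINT x|lborel. (w x)\<^sup>2)"
proof -
  note [measurable] = L20_measurable[OF assms]
  have eq: "(LINT x|lborel. h (L - x)) = (LINT x|lborel. h x)" for h :: "real \<Rightarrow> real"
    using lborel_integral_real_affine[of "-1" h L] by simp
  have int: "integrable lborel (\<lambda>x. h (L - x)) \<longleftrightarrow> integrable lborel h" for h :: "real \<Rightarrow> real"
    using lborel_integrable_real_affine_iff[of "-1" h L] by simp
  show "(LINT x|lborel. (- w (L - x))\<^sup>2) = (LINT x|lborel. (w x)\<^sup>2)"
    using eq[of "\<lambda>x. (w x)\<^sup>2"] by simp
  show "L20 L (\<lambda>x. - w (L - x))"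
    using assms int[of "\<lambda>x. (w x)\<^sup>2"] eq[of w] by (auto simp: L20_def)
  have iw: "integrable lborel w" by (rule L20_integrable[OF assms])
  have "prim (\<lambda>x. - w (L - x)) t = - (LINT r|lborel. indicator {..t} r * w (L - r))"
    by (simp add: prim_def)
  also have "(LINT r|lborel. indicator {..t} r * w (L - r)) = (LINT r|lborel. indicator {L - t..} r * w r)"
    by (subst eq[symmetric]) (auto intro!: Bochner_Integration.integral_cong simp: indicator_def)
  also have "\<dots> = (LINT r|lborel. w r - indicator {..L-t} r * w r)"
    by (rule integral_cong_AE)
       (measurable, use AE_lborel_singleton[of "L - t"] in \<open>eventually_elim, auto simp: indicator_def\<close>)
  also have "\<dots> = - prim w (L - t)"
    unfolding prim_def using iw prim_integrable[OF iw] L20_mean[OF assms] by simp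
  finally show "prim (\<lambda>x. - w (L - x)) t = prim w (L - t)" by simp
qed

section \<open>Hardy's inequality\<close>

text \<open>This is the second factor in the weighted Cauchy-Schwarz inequality below, and it also
  gives the integrability of the majorant \<open>dom\<close>.\<close>

lemma has_bochner_integral_inverse_sqrt:
  assumes "0 < t"
  shows "has_bochner_integral lborel (\<lambda>r. indicator {0<..<t} r * r powr (-1/2)) (2 * sqrt t)"
proof -
  have *: "0 < ereal t" using assms by simp
  have D: "((\<lambda>r. 2 * sqrt r) has_real_derivative x powr (-1/2)) (at x)" if "0 < ereal x" for x
    using that by (auto intro!: derivative_eq_intros simp: powr_minus powr_half_sqrt field_simps)
  have c: "isCont (\<lambda>r. r powr (-1/2)) x" if "0 < ereal x" for x :: real
    using that by (intro continuous_intros) auto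
  have l: "(((\<lambda>r. 2 * sqrt r) \<circ> real_of_ereal) \<longlongrightarrow> 0) (at_right 0)"
    unfolding zero_ereal_def ereal_tendsto_simps by (auto intro!: tendsto_eq_intros)
  have r: "(((\<lambda>r. 2 * sqrt r) \<circ> real_of_ereal) \<longlongrightarrow> 2 * sqrt t) (at_left (ereal t))"
    unfolding ereal_tendsto_simps by (auto intro!: tendsto_eq_intros)
  note I = interval_integral_FTC_nonneg[OF * D c _ l r]
  have "set_integrable lborel (einterval 0 t) (\<lambda>r. r powr (-1/2))"
    by (rule I(1)) auto
  moreover have "(LBINT x=0..ereal t. x powr (-1/2)) = 2 * sqrt t - 0"
    by (rule I(2)) auto
  moreover have "einterval 0 (ereal t) = {0<..<t}" by (auto simp: einterval_def)
  ultimately show ?thesis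
    using assms by (auto simp: has_bochner_integral_iff set_integrable_def interval_lebesgue_integral_def
        set_lebesgue_integral_def)
qed

lemma nn_integral_powr_tail:
  assumes "0 < r"
  shows "(\<integral>\<^sup>+t. ennreal (t powr (-3/2)) * indicator {r..} t \<partial>lborel) = ennreal (2 * r powr (-1/2))"
proof -
  have D: "((\<lambda>t. - 2 * t powr (-1/2)) has_real_derivative x powr (-3/2)) (at x)" if "r \<le> x" for x
    using that assms by (auto intro!: derivative_eq_intros)
  have "((\<lambda>t::real. - 2 * t powr (-1/2)) \<longlongrightarrow> 0) at_top"
    by (rule tendsto_mult_right_zero, rule tendsto_neg_powr[OF _ filterlim_ident]) simp
  from nn_integral_FTC_atLeast[OF _ D _ this] show ?thesis by simp
qed

text \<open>Cauchy-Schwarz for \<open>w = (w * r powr (1/4)) * r powr (-1/4)\<close>. The power is a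
  compromise: \<open>r powr (-1/2)\<close> must be integrable at 0, while after division by the
  square of \<open>t\<close> the remaining \<open>t powr (-3/2)\<close> must be integrable at
  infinity.\<close>

lemma prim_square_weighted:
  assumes w: "L20 L w" and t: "0 < t"
  shows "(prim w t)\<^sup>2 \<le> 2 * sqrt t * (LINT r|lborel. indicator {0<..<t} r * ((w r)\<^sup>2 * sqrt r))"
    and "integrable lborel (\<lambda>r. indicator {0<..<t} r * ((w r)\<^sup>2 * sqrt r))"
proof -
  note [measurable] = L20_measurable[OF w]
  define f where "f r = indicator {0<..<t} r * (w r * r powr (1/4))" for r
  define g where "g r = indicator {0<..<t} r * r powr (-1/4)" for r :: real
  have [measurable]: "f \<in> borel_measurable borel" "g \<in> borel_measurable borel"
    unfolding f_def g_def by measurable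
  have f2: "(\<lambda>r. (f r)\<^sup>2) = (\<lambda>r. indicator {0<..<t} r * ((w r)\<^sup>2 * sqrt r))"
  proof
    fix r show "(f r)\<^sup>2 = indicator {0<..<t} r * ((w r)\<^sup>2 * sqrt r)"
      by (cases "r \<in> {0<..<t}")
         (auto simp: f_def power_mult_distrib powr_half_sqrt[symmetric] powr_power)
  qed
  have g2: "(\<lambda>r. (g r)\<^sup>2) = (\<lambda>r. indicator {0<..<t} r * r powr (-1/2))"
  proof
    fix r show "(g r)\<^sup>2 = indicator {0<..<t} r * r powr (-1/2)"
      by (cases "r \<in> {0<..<t}") (auto simp: g_def power_mult_distrib powr_power)
  qed
  have fg: "f r * g r = indicator {..<t} r * w r" for r
  proof (cases "r \<in> {0<..<t}")
    case True
    then have "f r * g r = w r * (r powr (1/4) * r powr (-1/4))" by (simp add: f_def g_def)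
    also have "r powr (1/4) * r powr (-1/4) = 1" using True by (simp flip: powr_add)
    finally show ?thesis using True by simp
  next
    case False
    then have "r < t \<Longrightarrow> w r = 0" using L20_outside[OF w, of r] by auto
    with False show ?thesis by (auto simp: f_def indicator_def)
  qed
  show int: "integrable lborel (\<lambda>r. indicator {0<..<t} r * ((w r)\<^sup>2 * sqrt r))"
    by (rule Bochner_Integration.integrable_bound[of _ "\<lambda>r. (w r)\<^sup>2 * sqrt t"])
       (use L20_square[OF w] in \<open>auto simp: indicator_def intro!: mult_left_mono\<close>)
  have ig: "integrable lborel (\<lambda>r. (g r)\<^sup>2)" "(LINT r|lborel. (g r)\<^sup>2) = 2 * sqrt t"
    using has_bochner_integral_inverse_sqrt[OF t] by (auto simp: has_bochner_integral_iff g2)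
  have "prim w t = (LINT r|lborel. f r * g r)"
    unfolding prim_def fg
    by (rule integral_cong_AE)
       (measurable, use AE_lborel_singleton[of t] in \<open>eventually_elim, auto simp: indicator_def\<close>)
  also have "\<dots>\<^sup>2 \<le> (LINT r|lborel. (f r)\<^sup>2) * (LINT r|lborel. (g r)\<^sup>2)"
    by (rule Cauchy_Schwarz_integral) (use int ig in \<open>auto simp: f2\<close>)
  finally show "(prim w t)\<^sup>2 \<le> 2 * sqrt t * (LINT r|lborel. indicator {0<..<t} r * ((w r)\<^sup>2 * sqrt r))"
    by (simp add: f2 ig mult_ac)
qed

text \<open>Cauchy-Schwarz with the weight \<open>sqrt r\<close> followed by Tonelli gives the constant 4.\<close>

lemma Hardy_nn:
  assumes w: "L20 L w"
  shows "(\<integral>\<^sup>+t. ennreal (indicator {0<..<L} t * (prim w t / t)\<^sup>2) \<partial>lborel) \<le> ennreal (4 * (LINT x|lborel. (w x)\<^sup>2))"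
proof -
  note [measurable] = L20_measurable[OF w]
  have "(\<integral>\<^sup>+t. ennreal (indicator {0<..<L} t * (prim w t / t)\<^sup>2) \<partial>lborel)
     \<le> (\<integral>\<^sup>+t. (\<integral>\<^sup>+r. ennreal (2 * t powr (-3/2)) * (indicator {0<..<t} r * ennreal ((w r)\<^sup>2 * sqrt r)) \<partial>lborel) \<partial>lborel)"
  proof (rule nn_integral_mono)
    fix t :: real
    show "ennreal (indicator {0<..<L} t * (prim w t / t)\<^sup>2)
      \<le> (\<integral>\<^sup>+r. ennreal (2 * t powr (-3/2)) * (indicator {0<..<t} r * ennreal ((w r)\<^sup>2 * sqrt r)) \<partial>lborel)"
    proof (cases "t \<in> {0<..<L}")
      case True
      then have t: "0 < t" by simp
      let ?I = "LINT r|lborel. indicator {0<..<t} r * ((w r)\<^sup>2 * sqrt r)"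
      have tt: "sqrt t / t\<^sup>2 = t powr (-3/2)"
      proof -
        have "t powr (-3/2) = t powr (1/2 - 2)" by simp
        also have "\<dots> = t powr (1/2) / t powr 2" by (rule powr_diff)
        finally show ?thesis using t by (simp add: powr_half_sqrt)
      qed
      have "(prim w t / t)\<^sup>2 \<le> 2 * sqrt t * ?I / t\<^sup>2"
        unfolding power_divide by (intro divide_right_mono prim_square_weighted(1)[OF w t]) simp
      also have "\<dots> = 2 * (sqrt t / t\<^sup>2) * ?I" by simp
      finally have "ennreal ((prim w t / t)\<^sup>2) \<le> ennreal (2 * t powr (-3/2) * ?I)"
        unfolding tt by (intro ennreal_leI)
      also have "\<dots> = ennreal (2 * t powr (-3/2)) * ennreal ?I"
        by (subst ennreal_mult) (auto intro!: Bochner_Integration.integral_nonneg simp: indicator_def)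
      also have "ennreal ?I = (\<integral>\<^sup>+r. ennreal (indicator {0<..<t} r * ((w r)\<^sup>2 * sqrt r)) \<partial>lborel)"
        by (rule nn_integral_eq_integral[symmetric, OF prim_square_weighted(2)[OF w t]])
           (auto simp: indicator_def)
      also have "\<dots> = (\<integral>\<^sup>+r. indicator {0<..<t} r * ennreal ((w r)\<^sup>2 * sqrt r) \<partial>lborel)"
        by (intro nn_integral_cong) (auto simp: indicator_def)
      also have "ennreal (2 * t powr (-3/2)) * \<dots>
        = (\<integral>\<^sup>+r. ennreal (2 * t powr (-3/2)) * (indicator {0<..<t} r * ennreal ((w r)\<^sup>2 * sqrt r)) \<partial>lborel)"
        by (rule nn_integral_cmult[symmetric]) measurable
      finally show ?thesis using True by simp
    qed simp
  qed
  also have "\<dots> = (\<integral>\<^sup>+r. (\<integral>\<^sup>+t. ennreal (2 * t powr (-3/2)) * (indicator {0<..<t} r * ennreal ((w r)\<^sup>2 * sqrt r)) \<partial>lborel) \<partial>lborel)"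
  proof (rule lborel_pair.Fubini')
    \<comment> \<open>The indicator of \<open>{0<..<t}\<close> depends on both variables; for joint
      measurability it is rewritten as the indicator of a measurable subset of the plane.\<close>
    have "(\<lambda>(r, t). ennreal (2 * t powr (-3/2)) * (indicator {x\<in>space (borel \<Otimes>\<^sub>M borel). 0 < fst x \<and> fst x < snd x} (r, t) * ennreal ((w r)\<^sup>2 * sqrt r)))
      \<in> borel_measurable (borel \<Otimes>\<^sub>M borel)" by measurable
    also have "(\<lambda>(r, t). ennreal (2 * t powr (-3/2)) * (indicator {x\<in>space (borel \<Otimes>\<^sub>M borel). 0 < fst x \<and> fst x < snd x} (r, t) * ennreal ((w r)\<^sup>2 * sqrt r)))
      = (\<lambda>(r, t). ennreal (2 * t powr (-3/2)) * (indicator {0<..<t} r * ennreal ((w r)\<^sup>2 * sqrt r)))"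
      by (auto simp: fun_eq_iff indicator_def space_pair_measure)
    finally show "(\<lambda>(r, t). ennreal (2 * t powr (-3/2)) * (indicator {0<..<t} r * ennreal ((w r)\<^sup>2 * sqrt r)))
      \<in> borel_measurable (lborel \<Otimes>\<^sub>M lborel)"
      by (simp cong: measurable_cong_sets sets_pair_measure_cong)
  qed
  also have "\<dots> \<le> (\<integral>\<^sup>+r. ennreal (4 * (w r)\<^sup>2) \<partial>lborel)"
  proof (rule nn_integral_mono)
    fix r :: real
    show "(\<integral>\<^sup>+t. ennreal (2 * t powr (-3/2)) * (indicator {0<..<t} r * ennreal ((w r)\<^sup>2 * sqrt r)) \<partial>lborel)
      \<le> ennreal (4 * (w r)\<^sup>2)"
    proof (cases "0 < r")
      case True
      have "(\<integral>\<^sup>+t. ennreal (2 * t powr (-3/2)) * (indicator {0<..<t} r * ennreal ((w r)\<^sup>2 * sqrt r)) \<partial>lborel)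
        \<le> (\<integral>\<^sup>+t. ennreal (2 * ((w r)\<^sup>2 * sqrt r)) * (ennreal (t powr (-3/2)) * indicator {r..} t) \<partial>lborel)"
        by (intro nn_integral_mono) (auto simp: indicator_def ennreal_mult[symmetric] mult_ac)
      \<comment> \<open>The constant 4 is the 2 of \<open>prim_square_weighted\<close> times the 2
        of the tail integral, and the power of \<open>r\<close> in the latter cancels
        \<open>sqrt r\<close>.\<close>
      also have "\<dots> = ennreal (2 * ((w r)\<^sup>2 * sqrt r)) * ennreal (2 * r powr (-1/2))"
        by (subst nn_integral_cmult) (auto simp only: nn_integral_powr_tail[OF True], measurable)
      also have "\<dots> = ennreal (4 * (w r)\<^sup>2 * (sqrt r * r powr (-1/2)))"
        using True by (simp add: ennreal_mult[symmetric] mult_ac)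
      also have "sqrt r * r powr (-1/2) = 1"
        using True by (simp add: powr_half_sqrt[symmetric] powr_minus)
      finally show ?thesis by simp
    next
      case False
      then have "(\<lambda>t. ennreal (2 * t powr (-3/2)) * (indicator {0<..<t} r * ennreal ((w r)\<^sup>2 * sqrt r))) = (\<lambda>t. 0)"
        by (auto simp: indicator_def)
      then show ?thesis by simp
    qed
  qed
  also have "\<dots> = ennreal (4 * (LINT x|lborel. (w x)\<^sup>2))"
    using L20_square[OF w] by (subst nn_integral_eq_integral) auto
  finally show ?thesis .
qed

lemma Hardy_left:
  assumes w: "L20 L w"
  shows "integrable lborel (\<lambda>t. indicator {0<..<L} t * (prim w t / t)\<^sup>2)"
    and "(LINT t|lborel. indicator {0<..<L} t * (prim w t / t)\<^sup>2) \<le> 4 * (LINT x|lborel. (w x)\<^sup>2)"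
proof -
  note [measurable] = L20_prim_measurable[OF w]
  show i: "integrable lborel (\<lambda>t. indicator {0<..<L} t * (prim w t / t)\<^sup>2)"
    using Hardy_nn[OF w] by (intro integrableI_nonneg) (auto simp: indicator_def le_less_trans)
  have "ennreal (LINT t|lborel. indicator {0<..<L} t * (prim w t / t)\<^sup>2) \<le> ennreal (4 * (LINT x|lborel. (w x)\<^sup>2))"
    using Hardy_nn[OF w] by (subst nn_integral_eq_integral[symmetric, OF i]) (auto simp: indicator_def)
  then show "(LINT t|lborel. indicator {0<..<L} t * (prim w t / t)\<^sup>2) \<le> 4 * (LINT x|lborel. (w x)\<^sup>2)"
    by (subst (asm) ennreal_le_iff) auto
qed

lemma Hardy_right:
  assumes w: "L20 L w"
  shows "integrable lborel (\<lambda>t. indicator {0<..<L} t * (prim w t / (L - t))\<^sup>2)"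
    and "(LINT t|lborel. indicator {0<..<L} t * (prim w t / (L - t))\<^sup>2) \<le> 4 * (LINT x|lborel. (w x)\<^sup>2)"
proof -
  define h :: "real \<Rightarrow> real" where "h t = indicator {0<..<L} t * (prim w t / (L - t))\<^sup>2" for t
  have h: "(\<lambda>t. indicator {0<..<L} t * (prim (\<lambda>x. - w (L - x)) t / t)\<^sup>2) = (\<lambda>t. h (L + (-1) * t))"
    using L20_reflect(2)[OF w] by (auto simp: h_def fun_eq_iff indicator_def)
  note H = Hardy_left[OF L20_reflect(1)[OF w], unfolded h L20_reflect(3)[OF w]]
  show "integrable lborel h"
    using H(1) lborel_integrable_real_affine_iff[of "-1" h L] by simp
  show "(LINT t|lborel. h t) \<le> 4 * (LINT x|lborel. (w x)\<^sup>2)"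
    using H(2) lborel_integral_real_affine[of "-1" h L] by simp
qed

section \<open>The weighted variational problem\<close>

definition norm2 :: "(real \<Rightarrow> real) \<Rightarrow> real" where
  "norm2 w = (LINT x|lborel. (w x)\<^sup>2)"

text \<open>Collects what the existence proof uses of the shifted weight, so that bounded intervals
  and half-lines are handled together. Positivity, continuity and the limits concern only
  \<open>{0<..<L}\<close>, because the primitives vanish elsewhere.\<close>

locale hardy_weight =
  fixes L :: real and q :: "real \<Rightarrow> real"
  assumes L_pos: "0 < L"
    and q_measurable [measurable]: "q \<in> borel_measurable borel"
    and q_cont: "continuous_on {0<..<L} q"
    and q_pos: "t \<in> {0<..<L} \<Longrightarrow> 0 < q t"
    and q_0: "((\<lambda>t. t\<^sup>2 * q t) \<longlongrightarrow> 0) (at_right 0)"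
    and q_L: "((\<lambda>t. (L - t)\<^sup>2 * q t) \<longlongrightarrow> 0) (at_left L)"
begin

definition energy :: "(real \<Rightarrow> real) \<Rightarrow> real" where
  "energy w = (LINT t|lborel. q t * (prim w t)\<^sup>2)"

text \<open>The two limits at the ends make \<open>q\<close> at most \<open>e\<close> times a Hardy
  weight near 0 and near \<open>L\<close>; on the compact middle part continuity gives the constant
  \<open>C\<close>. The value \<open>e = 1\<close> yields boundedness of the energy, a small
  \<open>e\<close> the nontriviality of the limit of a maximizing sequence.\<close>

lemma q_bound:
  assumes "0 < e"
  obtains C where "0 \<le> C" "\<And>t. t \<in> {0<..<L} \<Longrightarrow> q t \<le> e * (1 / t\<^sup>2 + 1 / (L - t)\<^sup>2) + C"
proof -
  have "eventually (\<lambda>t. t\<^sup>2 * q t < e) (at_right 0)"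
    using order_tendstoD(2)[OF q_0 assms] .
  then obtain a where a: "0 < a" "\<And>t. 0 < t \<Longrightarrow> t < a \<Longrightarrow> t\<^sup>2 * q t < e"
    unfolding eventually_at_right_field by auto
  have "eventually (\<lambda>t. (L - t)\<^sup>2 * q t < e) (at_left L)"
    using order_tendstoD(2)[OF q_L assms] .
  then obtain b where b: "b < L" "\<And>t. b < t \<Longrightarrow> t < L \<Longrightarrow> (L - t)\<^sup>2 * q t < e"
    unfolding eventually_at_left_field by auto
  define a' where "a' = min (a / 2) (L / 2)"
  define b' where "b' = max ((b + L) / 2) (L / 2)"
  have ab: "0 < a'" "a' < a" "b < b'" "b' < L"
    using a b L_pos by (auto simp: a'_def b'_def min_def max_def)
  have "continuous_on {a'..b'} q"
    by (rule continuous_on_subset[OF q_cont]) (use ab in auto)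
  then have "compact (q ` {a'..b'})" by (intro compact_continuous_image) auto
  then obtain C where C: "\<And>t. t \<in> {a'..b'} \<Longrightarrow> \<bar>q t\<bar> \<le> C"
    by (force dest!: compact_imp_bounded simp: bounded_iff)
  show ?thesis
  proof (rule that[of "\<bar>C\<bar>"])
    fix t assume t: "t \<in> {0<..<L}"
    have p: "0 \<le> e * (1 / t\<^sup>2)" "0 \<le> e * (1 / (L - t)\<^sup>2)" using assms by auto
    show "q t \<le> e * (1 / t\<^sup>2 + 1 / (L - t)\<^sup>2) + \<bar>C\<bar>"
    proof -
      consider "t < a'" | "b' < t" | "t \<in> {a'..b'}" by fastforce
      then show ?thesis
      proof cases
        case 1
        then have "q t \<le> e * (1 / t\<^sup>2)" using a(2)[of t] t ab by (simp add: field_simps)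
        with p show ?thesis unfolding distrib_left by linarith
      next
        case 2
        then have "q t \<le> e * (1 / (L - t)\<^sup>2)" using b(2)[of t] t ab by (simp add: field_simps)
        with p show ?thesis unfolding distrib_left by linarith
      next
        case 3
        then have "q t \<le> \<bar>C\<bar>" using C[OF 3] by linarith
        with p show ?thesis unfolding distrib_left by linarith
      qed
    qed
  qed simp
qed

text \<open>A crude Poincare inequality: the square of the primitive is bounded pointwise by
  \<open>L\<close> times the squared norm of \<open>w\<close>, on an interval of length
  \<open>L\<close>.\<close>

lemma prim_square_integrable:
  assumes "L20 L w"
  shows "integrable lborel (\<lambda>t. (prim w t)\<^sup>2)"
    and "(LINT t|lborel. (prim w t)\<^sup>2) \<le> L\<^sup>2 * (LINT x|lborel. (w x)\<^sup>2)"
proof -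
  note [measurable] = L20_prim_measurable[OF assms]
  let ?N = "LINT x|lborel. (w x)\<^sup>2"
  have i: "integrable lborel (\<lambda>t. indicator {0<..<L} t * (L * ?N))" by simp
  have le: "(prim w t)\<^sup>2 \<le> indicator {0<..<L} t * (L * ?N)" for t
  proof (cases "t \<in> {0<..<L}")
    case True
    have "t * ?N \<le> L * ?N" using True by (intro mult_right_mono) auto
    with L20_prim_bound(1)[OF assms, of t] True show ?thesis by simp
  next
    case False
    then show ?thesis using prim_outside[OF assms False] by simp
  qed
  show j: "integrable lborel (\<lambda>t. (prim w t)\<^sup>2)"
    by (rule Bochner_Integration.integrable_bound[OF i]) (use le in \<open>auto intro: order_trans[OF _ abs_ge_self]\<close>)
  have "(LINT t|lborel. (prim w t)\<^sup>2) \<le> (LINT t|lborel. indicator {0<..<L} t * (L * ?N))"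
    by (rule Bochner_Integration.integral_mono[OF j i le])
  also have "\<dots> = L\<^sup>2 * ?N" using L_pos by (simp add: power2_eq_square)
  finally show "(LINT t|lborel. (prim w t)\<^sup>2) \<le> L\<^sup>2 * ?N" .
qed

lemma energy_nonneg_integrand: "L20 L w \<Longrightarrow> 0 \<le> q t * (prim w t)\<^sup>2"
  using q_pos[of t] prim_outside[of L w t] by (cases "t \<in> {0<..<L}") auto

text \<open>The factor 8 is the Hardy constant 4 once for each end. The term with \<open>C\<close>
  is kept apart because along a sequence with vanishing primitives it tends to 0, whatever the size
  of \<open>C\<close>.\<close>

lemma energy_bound:
  assumes w: "L20 L w" and e: "0 < e" and C: "0 \<le> C"
    and b: "\<And>t. t \<in> {0<..<L} \<Longrightarrow> q t \<le> e * (1 / t\<^sup>2 + 1 / (L - t)\<^sup>2) + C"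
  shows "integrable lborel (\<lambda>t. q t * (prim w t)\<^sup>2)"
    and "energy w \<le> 8 * e * (LINT x|lborel. (w x)\<^sup>2) + C * (LINT t|lborel. (prim w t)\<^sup>2)"
proof -
  note [measurable] = L20_prim_measurable[OF w]
  let ?g = "\<lambda>t. e * (indicator {0<..<L} t * (prim w t / t)\<^sup>2) + e * (indicator {0<..<L} t * (prim w t / (L - t))\<^sup>2)
     + C * (prim w t)\<^sup>2"
  note H = Hardy_left[OF w] Hardy_right[OF w] prim_square_integrable[OF w]
  have i: "integrable lborel ?g" using H by simp
  have le: "q t * (prim w t)\<^sup>2 \<le> ?g t" for t
  proof (cases "t \<in> {0<..<L}")
    case True
    have "q t * (prim w t)\<^sup>2 \<le> (e * (1 / t\<^sup>2 + 1 / (L - t)\<^sup>2) + C) * (prim w t)\<^sup>2"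
      by (intro mult_right_mono b True) simp
    also have "\<dots> = ?g t" using True by (simp add: algebra_simps power_divide)
    finally show ?thesis .
  next
    case False
    then show ?thesis using prim_outside[OF w False] by simp
  qed
  show j: "integrable lborel (\<lambda>t. q t * (prim w t)\<^sup>2)"
    by (rule Bochner_Integration.integrable_bound[OF i])
       (use le energy_nonneg_integrand[OF w] in \<open>auto intro: order_trans[OF _ abs_ge_self]\<close>)
  have "energy w \<le> (LINT t|lborel. ?g t)"
    unfolding energy_def by (rule Bochner_Integration.integral_mono[OF j i le])
  also have "\<dots> = e * (LINT t|lborel. indicator {0<..<L} t * (prim w t / t)\<^sup>2)
      + e * (LINT t|lborel. indicator {0<..<L} t * (prim w t / (L - t))\<^sup>2) + C * (LINT t|lborel. (prim w t)\<^sup>2)"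
    using H by simp
  also have "\<dots> \<le> e * (4 * (LINT x|lborel. (w x)\<^sup>2)) + e * (4 * (LINT x|lborel. (w x)\<^sup>2)) + C * (LINT t|lborel. (prim w t)\<^sup>2)"
    using H e by (intro add_mono mult_left_mono order_refl) auto
  finally show "energy w \<le> 8 * e * (LINT x|lborel. (w x)\<^sup>2) + C * (LINT t|lborel. (prim w t)\<^sup>2)"
    by simp
qed

lemma energy_integrable:
  assumes "L20 L w" shows "integrable lborel (\<lambda>t. q t * (prim w t)\<^sup>2)"
proof -
  obtain C where C: "0 \<le> C" "\<And>t. t \<in> {0<..<L} \<Longrightarrow> q t \<le> 1 * (1 / t\<^sup>2 + 1 / (L - t)\<^sup>2) + C"
    using q_bound[OF zero_less_one] by blast
  show ?thesis by (rule energy_bound(1)[OF assms zero_less_one C])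
qed

lemma energy_nonneg: "L20 L w \<Longrightarrow> 0 \<le> energy w"
  unfolding energy_def by (intro Bochner_Integration.integral_nonneg energy_nonneg_integrand)

lemma energy_bounded: obtains K where "\<And>w. L20 L w \<Longrightarrow> energy w \<le> K * (LINT x|lborel. (w x)\<^sup>2)"
proof -
  obtain C where C: "0 \<le> C" "\<And>t. t \<in> {0<..<L} \<Longrightarrow> q t \<le> 1 * (1 / t\<^sup>2 + 1 / (L - t)\<^sup>2) + C"
    using q_bound[OF zero_less_one] by blast
  have "energy w \<le> (8 + C * L\<^sup>2) * (LINT x|lborel. (w x)\<^sup>2)" if w: "L20 L w" for w
  proof -
    have "energy w \<le> 8 * 1 * (LINT x|lborel. (w x)\<^sup>2) + C * (LINT t|lborel. (prim w t)\<^sup>2)"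
      by (rule energy_bound(2)[OF w zero_less_one C])
    also have "\<dots> \<le> 8 * 1 * (LINT x|lborel. (w x)\<^sup>2) + C * (L\<^sup>2 * (LINT x|lborel. (w x)\<^sup>2))"
      using C prim_square_integrable(2)[OF w] by (intro add_left_mono mult_left_mono) auto
    finally show ?thesis by (simp add: algebra_simps)
  qed
  then show ?thesis by (rule that)
qed

text \<open>Polarization: the energy is the squared norm of \<open>sqrt (q t) * prim w t\<close>, so
  the expansion of a square in \<open>integrable_add_square\<close> applies.\<close>

lemma energy_add:
  assumes f: "L20 L f" and g: "L20 L g"
  shows "integrable lborel (\<lambda>t. q t * prim f t * prim g t)"
    and "energy (\<lambda>x. f x + c * g x) = energy f + 2 * (LINT t|lborel. q t * prim f t * prim g t) * c + energy g * c\<^sup>2"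
proof -
  note [measurable] = L20_prim_measurable[OF f] L20_prim_measurable[OF g]
  let ?r = "\<lambda>w t. sqrt (q t) * prim w t"
  have eq: "?r u t * ?r v t = q t * prim u t * prim v t" if "L20 L u" for u v t
  proof -
    have "?r u t * ?r v t = (sqrt (q t) * sqrt (q t)) * prim u t * prim v t" by simp
    \<comment> \<open>Outside \<open>{0<..<L}\<close> the sign of \<open>q\<close> is unknown and
      \<open>sqrt (q t) * sqrt (q t)\<close> may differ from \<open>q t\<close>; there the identity
      holds because \<open>prim u\<close> vanishes.\<close>
    also have "\<dots> = q t * prim u t * prim v t"
      using q_pos[of t] prim_outside[OF that, of t] by (cases "t \<in> {0<..<L}") auto
    finally show ?thesis .
  qed
  have sq: "(?r w t)\<^sup>2 = q t * (prim w t)\<^sup>2" if "L20 L w" for w t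
    using eq[OF that, of t w] by (simp add: power2_eq_square)
  have m: "?r f \<in> borel_measurable lborel" "?r g \<in> borel_measurable lborel" by measurable
  have i: "integrable lborel (\<lambda>t. (?r f t)\<^sup>2)" "integrable lborel (\<lambda>t. (?r g t)\<^sup>2)"
    unfolding sq[OF f] sq[OF g] by (intro energy_integrable f g)+
  show "integrable lborel (\<lambda>t. q t * prim f t * prim g t)"
    using integrable_mult_of_square[OF m i] by (simp only: eq[OF f])
  have "energy (\<lambda>x. f x + c * g x) = (LINT t|lborel. (?r f t + c * ?r g t)\<^sup>2)"
    unfolding energy_def sq[OF L20_add(1)[OF f g], symmetric]
    unfolding L20_add(2)[OF f g] by (simp only: distrib_left mult.left_commute)
  also have "\<dots> = (LINT t|lborel. (?r f t)\<^sup>2) + 2 * (LINT t|lborel. ?r f t * ?r g t) * c + (LINT t|lborel. (?r g t)\<^sup>2) * c\<^sup>2"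
    by (rule integrable_add_square(2)[OF m i])
  finally show "energy (\<lambda>x. f x + c * g x) = energy f + 2 * (LINT t|lborel. q t * prim f t * prim g t) * c + energy g * c\<^sup>2"
    unfolding sq[OF f] sq[OF g] eq[OF f] energy_def .
qed

text \<open>Testing against \<open>green t\<close>, whose primitive is the Green function \<open>kernel t\<close> of \<open>- W''\<close> with
  Dirichlet conditions, turns the Euler-Lagrange equation into a pointwise integral equation.\<close>

definition green :: "real \<Rightarrow> real \<Rightarrow> real" where
  "green t r = indicator {0<..<L} r * (indicator {..t} r - t / L)"

definition kernel :: "real \<Rightarrow> real \<Rightarrow> real" where
  "kernel t r = indicator {0<..<L} r * (if r \<le> t then r * (L - t) / L else t * (L - r) / L)"

lemma green_integrable: "integrable lborel (green t)" "integrable lborel (\<lambda>x. (green t x)\<^sup>2)"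
proof -
  have *: "integrable lborel (\<lambda>r. indicator {0<..<L} r * (1 + \<bar>t / L\<bar>)\<^sup>2)"
    "integrable lborel (\<lambda>r. indicator {0<..<L} r * (1 + \<bar>t / L\<bar>))" by simp_all
  have b: "\<bar>green t r\<bar> \<le> indicator {0<..<L} r * (1 + \<bar>t / L\<bar>)" for r
  proof -
    define c where "c = t / L"
    have "\<bar>1 - c\<bar> \<le> 1 + \<bar>c\<bar>" by linarith
    then show ?thesis by (simp add: green_def indicator_def flip: c_def)
  qed
  have b2: "(green t r)\<^sup>2 \<le> indicator {0<..<L} r * (1 + \<bar>t / L\<bar>)\<^sup>2" for r
    using power_mono[OF b[of r], of 2] by (simp add: power_mult_distrib indicator_square)
  have [measurable]: "green t \<in> borel_measurable borel" unfolding green_def by measurable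
  show "integrable lborel (green t)"
    by (rule Bochner_Integration.integrable_bound[OF *(2)]) (use b in \<open>auto intro: order_trans[OF _ abs_ge_self]\<close>)
  show "integrable lborel (\<lambda>x. (green t x)\<^sup>2)"
    by (rule Bochner_Integration.integrable_bound[OF *(1)]) (use b2 in \<open>auto intro: order_trans[OF _ abs_ge_self]\<close>)
qed

lemma prim_green:
  assumes t: "t \<in> {0<..<L}" and r: "r \<in> {0..L}"
  shows "prim (green t) r = min r t - r * t / L"
proof -
  have "prim (green t) r = (LINT x|lborel. indicator {0<..<min r t} x * 1 - indicator {0<..<r} x * (t / L))"
    unfolding prim_def
  proof (rule integral_cong_AE)
    show "AE x in lborel. indicator {..r} x * green t x = indicator {0<..<min r t} x * 1 - indicator {0<..<r} x * (t / L)"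
      using AE_lborel_singleton[of r] AE_lborel_singleton[of t] AE_lborel_singleton[of L]
      by eventually_elim (use t r in \<open>auto simp: green_def indicator_def min_def\<close>)
  qed (unfold green_def, measurable)
  also have "\<dots> = min r t - r * t / L"
    using t r by (subst Bochner_Integration.integral_diff) (auto simp: min_def)
  finally show ?thesis .
qed

lemma L20_green:
  assumes t: "t \<in> {0<..<L}"
  shows "L20 L (green t)"
proof -
  have [measurable]: "green t \<in> borel_measurable borel" unfolding green_def by measurable
  have "(LINT x|lborel. green t x) = prim (green t) L"
    unfolding prim_def by (rule Bochner_Integration.integral_cong) (auto simp: green_def indicator_def)
  also have "\<dots> = 0" using t L_pos by (subst prim_green[OF t]) (auto simp: min_def)
  finally show ?thesis using green_integrable by (auto simp: L20_def green_def)
qed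

lemma prim_green_eq: 
  assumes t: "t \<in> {0<..<L}" shows "prim (green t) r = kernel t r"
proof (cases "r \<in> {0<..<L}")
  case True
  then show ?thesis using t L_pos
    by (subst prim_green[OF t]) (auto simp: kernel_def min_def field_simps)
next
  case False
  then show ?thesis using prim_outside[OF L20_green[OF t] False] by (simp add: kernel_def)
qed

text \<open>The constant \<open>t / L\<close> integrates to 0 against a mean-zero function, so
  \<open>green t\<close> represents evaluation of the primitive at \<open>t\<close>. Hence one term
  of the Euler-Lagrange equation becomes a point value.\<close>

lemma integral_mult_green:
  assumes w: "L20 L w"
  shows "(LINT x|lborel. w x * green t x) = prim w t"
proof -
  have "(LINT x|lborel. w x * green t x) = (LINT x|lborel. indicator {..t} x * w x - (t / L) * w x)"
    using L20_outside[OF w] by (intro Bochner_Integration.integral_cong) (auto simp: green_def algebra_simps indicator_def)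
  also have "\<dots> = prim w t"
    unfolding prim_def using L20_integrable[OF w] prim_integrable[OF L20_integrable[OF w]] L20_mean[OF w]
    by (subst Bochner_Integration.integral_diff) auto
  finally show ?thesis .
qed

text \<open>Linear decay at both ends is what compensates the singularity of \<open>q\<close>:
  together with the square-root decay of a primitive it leaves an integrable power -1/2.\<close>

lemma kernel_bounds:
  assumes t: "t \<in> {0<..<L}" and r: "r \<in> {0<..<L}"
  shows "0 < kernel t r" "kernel t r \<le> r" "kernel t r \<le> L - r"
proof -
  show "0 < kernel t r" using t r L_pos by (auto simp: kernel_def)
  have "kernel t r = min r t - r * t / L"
    using t r L_pos by (auto simp: kernel_def min_def field_simps)
  moreover have "0 < r * t / L" using t r L_pos by auto
  ultimately show "kernel t r \<le> r" by linarith
  show "kernel t r \<le> L - r"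
  proof (cases "r \<le> t")
    case True
    have "r * (L - t) / L \<le> L - t" using t r L_pos mult_right_mono[of r L "L - t"] by (simp add: divide_le_eq mult.commute)
    then show ?thesis using True r by (simp add: kernel_def)
  next
    case False
    have "t * (L - r) / L \<le> L - r" using t r L_pos mult_right_mono[of t L "L - r"] by (simp add: divide_le_eq mult.commute)
    then show ?thesis using False r by (simp add: kernel_def)
  qed
qed

text \<open>The squared norm of the operator \<open>w\<close> to \<open>sqrt q * prim w\<close>, and
  later the reciprocal of the eigenvalue. That the supremum is attained is proved in
  \<open>eigenfunction_exists\<close>.\<close>

definition energy_max :: real where
  "energy_max = (SUP w\<in>{w. L20 L w \<and> norm2 w = 1}. energy w)"

lemma energy_eq_0:
  assumes w: "L20 L w" and "norm2 w = 0" shows "energy w = 0"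
proof -
  have "prim w t = 0" for t
    using L20_prim_bound(1)[OF w, of t] prim_outside[OF w, of t] assms(2)
    by (cases "t \<in> {0<..<L}") (auto simp: norm2_def)
  then show ?thesis by (simp add: energy_def)
qed

lemma norm2_nonneg: "0 \<le> norm2 w" by (simp add: norm2_def)

lemma normalize:
  assumes w: "L20 L w" and "norm2 w \<noteq> 0"
  defines "v \<equiv> \<lambda>x. (1 / sqrt (norm2 w)) * w x"
  shows "L20 L v" "norm2 v = 1" "energy v = energy w / norm2 w"
proof -
  let ?c = "1 / sqrt (norm2 w)"
  have c2: "?c\<^sup>2 = 1 / norm2 w" using norm2_nonneg[of w] by (simp add: power_divide)
  show "L20 L v" unfolding v_def by (rule L20_scale(1)[OF w])
  have "norm2 v = ?c\<^sup>2 * norm2 w"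
    unfolding norm2_def v_def power_mult_distrib by (rule Bochner_Integration.integral_mult_right_zero)
  then show "norm2 v = 1" unfolding c2 using assms(2) by simp
  have "energy v = (LINT t|lborel. ?c\<^sup>2 * (q t * (prim w t)\<^sup>2))"
    unfolding energy_def v_def L20_scale(2)[OF w] power_mult_distrib
    by (rule Bochner_Integration.integral_cong) (simp_all add: mult_ac)
  also have "\<dots> = ?c\<^sup>2 * energy w" unfolding energy_def by (rule Bochner_Integration.integral_mult_right_zero)
  finally show "energy v = energy w / norm2 w" unfolding c2 by simp
qed

lemma energy_bdd: "bdd_above (energy ` {w. L20 L w \<and> norm2 w = 1})"
proof -
  obtain K where "\<And>w. L20 L w \<Longrightarrow> energy w \<le> K * (LINT x|lborel. (w x)\<^sup>2)"
    by (rule energy_bounded) blast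
  then show ?thesis unfolding norm2_def by (intro bdd_aboveI[of _ K]) (force)
qed

lemma energy_le:
  assumes w: "L20 L w" shows "energy w \<le> energy_max * norm2 w"
proof (cases "norm2 w = 0")
  case True
  then show ?thesis using energy_eq_0[OF w] by simp
next
  case False
  note n = normalize[OF w False]
  have "energy w / norm2 w \<le> energy_max"
    unfolding n(3)[symmetric] energy_max_def
    by (rule cSUP_upper[OF _ energy_bdd]) (use n in auto)
  then show ?thesis using False norm2_nonneg[of w] by (simp add: divide_le_eq)
qed

lemma energy_pos:
  assumes w: "L20 L w" and pos: "\<And>t. t \<in> {0<..<L} \<Longrightarrow> prim w t \<noteq> 0"
  shows "0 < energy w"
proof (rule ccontr)
  assume "\<not> 0 < energy w"
  then have "energy w = 0" using energy_nonneg[OF w] by simp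
  then have "AE t in lborel. q t * (prim w t)\<^sup>2 = 0"
    unfolding energy_def
    by (subst (asm) integral_nonneg_eq_0_iff_AE[OF energy_integrable[OF w]]) (use energy_nonneg_integrand[OF w] in auto)
  then have "AE t in lborel. t \<notin> {0<..<L}"
    by eventually_elim (use q_pos pos in force)
  then have "emeasure lborel {0<..<L} = 0"
    by (subst (asm) AE_iff_measurable[of "{0<..<L}"]) auto
  with L_pos show False by simp
qed

text \<open>The trial function is \<open>green (L / 2)\<close>, whose primitive is a tent with its
  peak in the middle and is positive on the whole interval.\<close>

lemma energy_max_pos: "0 < energy_max"
proof -
  have L2: "L / 2 \<in> {0<..<L}" using L_pos by simp
  have "0 < energy (green (L/2))"
    by (rule energy_pos[OF L20_green[OF L2]]) (use kernel_bounds(1)[OF L2] in \<open>force simp: prim_green_eq[OF L2]\<close>)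
  also have "\<dots> \<le> energy_max * norm2 (green (L/2))" by (rule energy_le[OF L20_green[OF L2]])
  finally show ?thesis using norm2_nonneg[of "green (L/2)"] by (auto simp: zero_less_mult_iff)
qed

text \<open>Cauchy-Schwarz for the positive semidefinite form \<open>energy_max * norm2 w - energy w\<close>: along a
  maximizing sequence the right-hand side tends to 0, so the limit satisfies the Euler-Lagrange
  equation without any appeal to weak compactness.\<close>

lemma euler_lagrange_defect:
  assumes f: "L20 L f" and g: "L20 L g"
  shows "(energy_max * (LINT x|lborel. f x * g x) - (LINT t|lborel. q t * prim f t * prim g t))\<^sup>2
    \<le> (energy_max * norm2 f - energy f) * (energy_max * norm2 g - energy g)"
proof (rule discriminant_nonpos)
  fix c
  have n: "norm2 (\<lambda>x. f x + c * g x) = norm2 f + 2 * (LINT x|lborel. f x * g x) * c + norm2 g * c\<^sup>2"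
    unfolding norm2_def using f g by (intro integrable_add_square(2)) (auto simp: L20_def)
  have "0 \<le> energy_max * norm2 (\<lambda>x. f x + c * g x) - energy (\<lambda>x. f x + c * g x)"
    using energy_le[OF L20_add(1)[OF f g]] by simp
  then show "0 \<le> energy_max * norm2 f - energy f +
      2 * (energy_max * (LINT x|lborel. f x * g x) - (LINT t|lborel. q t * prim f t * prim g t)) * c +
      (energy_max * norm2 g - energy g) * c\<^sup>2"
    unfolding n energy_add(2)[OF f g] by (simp add: algebra_simps)
qed

end

section \<open>Limit of a maximizing sequence and its integral equation\<close>

context hardy_weight
begin

lemma maximizing_sequence:
  obtains v where "\<And>n::nat. L20 L (v n)" "\<And>n. norm2 (v n) = 1" "(\<lambda>n. energy (v n)) \<longlonglongrightarrow> energy_max"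
proof -
  let ?S = "{w. L20 L w \<and> norm2 w = 1}"
  have ne: "?S \<noteq> {}"
  proof -
    have L2: "L / 2 \<in> {0<..<L}" using L_pos by simp
    have "0 < energy (green (L/2))"
      by (rule energy_pos[OF L20_green[OF L2]]) (use kernel_bounds(1)[OF L2] in \<open>force simp: prim_green_eq[OF L2]\<close>)
    then have "norm2 (green (L/2)) \<noteq> 0" using energy_eq_0[OF L20_green[OF L2]] by force
    from normalize[OF L20_green[OF L2] this] show ?thesis by blast
  qed
  have "\<exists>w\<in>?S. energy_max - 1 / real (Suc n) < energy w" for n
    using less_cSUP_iff[OF ne energy_bdd, of "energy_max - 1 / real (Suc n)"]
    unfolding energy_max_def by simp
  then obtain v where v: "\<And>n. v n \<in> ?S" "\<And>n. energy_max - 1 / real (Suc n) < energy (v n)" by metis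
  have up: "energy (v n) \<le> energy_max" for n
    using energy_le[of "v n"] v(1)[of n] by simp
  have "(\<lambda>n. energy (v n)) \<longlonglongrightarrow> energy_max"
  proof (rule real_tendsto_sandwich)
    show "(\<lambda>n. energy_max - 1 / real (Suc n)) \<longlonglongrightarrow> energy_max"
      using tendsto_diff[OF tendsto_const LIMSEQ_inverse_real_of_nat, of energy_max] by (simp add: inverse_eq_divide)
    show "(\<lambda>n. energy_max) \<longlonglongrightarrow> energy_max" by simp
  qed (use less_imp_le[OF v(2)] up in \<open>auto simp del: of_nat_Suc\<close>)
  with v that show ?thesis by auto
qed

text \<open>Arzela-Ascoli applied to primitives of unit-norm functions, which satisfy a Hoelder
  condition with exponent 1/2 and constant 1 and vanish at 0. At this stage \<open>G\<close> is only
  a limit of primitives, not yet known to be one.\<close>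

lemma limit_profile:
  obtains v G where "\<And>n::nat. L20 L (v n)" "\<And>n. norm2 (v n) = 1" "(\<lambda>n. energy (v n)) \<longlonglongrightarrow> energy_max"
    "\<And>t. (\<lambda>n. prim (v n) t) \<longlonglongrightarrow> G t" "continuous_on {0<..<L} G"
proof -
  obtain v where v: "\<And>n::nat. L20 L (v n)" "\<And>n. norm2 (v n) = 1" "(\<lambda>n. energy (v n)) \<longlonglongrightarrow> energy_max"
    using maximizing_sequence by blast
  have sq: "\<bar>prim (v n) x - prim (v n) y\<bar> \<le> sqrt \<bar>x - y\<bar>" for n x y
    using real_sqrt_le_mono[OF L20_prim_Holder[OF v(1), of n x y]] v(2)[of n] by (simp add: norm2_def)
  obtain G k where G: "continuous_on {0..L} G" "strict_mono (k :: nat \<Rightarrow> nat)"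
    and lim: "\<And>e. 0 < e \<Longrightarrow> \<exists>N. \<forall>n x. n \<ge> N \<and> x \<in> {0..L} \<longrightarrow> norm (prim (v (k n)) x - G x) < e"
  proof (rule Arzela_Ascoli[of "{0..L}" "\<lambda>n. prim (v n)" "sqrt L"])
    show "compact {0..L}" by simp
    fix n x assume "x \<in> {0..L}"
    have "\<bar>prim (v n) x - prim (v n) 0\<bar> \<le> sqrt \<bar>x\<bar>" using sq[of n x 0] by simp
    moreover have "prim (v n) 0 = 0" by (rule prim_outside[OF v(1)]) simp
    moreover have "sqrt \<bar>x\<bar> \<le> sqrt L" using \<open>x \<in> {0..L}\<close> by simp
    ultimately show "norm (prim (v n) x) \<le> sqrt L" unfolding real_norm_def by linarith
  next
    fix x e :: real assume "x \<in> {0..L}" "0 < e"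
    have "norm (prim (v n) x - prim (v n) y) < e" if "norm (x - y) < e\<^sup>2" for n y
    proof -
      have "sqrt \<bar>x - y\<bar> < e" using that \<open>0 < e\<close> by (intro real_less_lsqrt) auto
      with sq[of n x y] show ?thesis by simp
    qed
    with \<open>0 < e\<close> show "\<exists>d. 0 < d \<and> (\<forall>n y. y \<in> {0..L} \<and> norm (x - y) < d \<longrightarrow> norm (prim (v n) x - prim (v n) y) < e)"
      by (intro exI[of _ "e\<^sup>2"]) auto
  qed (rule that)
  \<comment> \<open>Extending the limit by 0 makes the convergence hold at every real point, since
    all the primitives vanish outside \<open>{0<..<L}\<close>.\<close>
  let ?G = "\<lambda>t. if t \<in> {0<..<L} then G t else 0"
  have "(\<lambda>n. prim (v (k n)) t) \<longlonglongrightarrow> ?G t" for t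
  proof (cases "t \<in> {0<..<L}")
    case True
    have "(\<lambda>n. prim (v (k n)) t) \<longlonglongrightarrow> G t"
    proof (rule LIMSEQ_I)
      fix e :: real assume "0 < e"
      obtain N where "\<And>n x. n \<ge> N \<Longrightarrow> x \<in> {0..L} \<Longrightarrow> norm (prim (v (k n)) x - G x) < e"
        using lim[OF \<open>0 < e\<close>] by blast
      moreover have "t \<in> {0..L}" using True by simp
      ultimately show "\<exists>N. \<forall>n\<ge>N. norm (prim (v (k n)) t - G t) < e" by blast
    qed
    with True show ?thesis by simp
  next
    case False
    then have "prim (v (k n)) t = 0" for n using prim_outside[OF v(1)] by blast
    with False show ?thesis by auto
  qed
  moreover have "continuous_on {0<..<L} ?G"
    by (rule continuous_on_eq[OF continuous_on_subset[OF G(1)]]) auto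
  moreover have "(\<lambda>n. energy (v (k n))) \<longlonglongrightarrow> energy_max"
    using LIMSEQ_subseq_LIMSEQ[OF v(3) G(2)] by (simp add: o_def)
  ultimately show ?thesis using that[of "\<lambda>n. v (k n)" ?G] v by blast
qed

text \<open>The integrable majorant for the Euler-Lagrange integrand: near 0 the weight contributes
  at most order -2, the primitive order 1/2 and the kernel order 1, so the product has order -1/2;
  likewise near \<open>L\<close>.\<close>

definition dom :: "real \<Rightarrow> real" where
  "dom r = indicator {0<..<L} r * (r powr (-1/2) + (L - r) powr (-1/2))"

lemma dom_integrable: "integrable lborel dom"
proof -
  have i: "integrable lborel (\<lambda>r. indicator {0<..<L} r * r powr (-1/2))"
    using has_bochner_integral_inverse_sqrt[OF L_pos] by (simp add: has_bochner_integral_iff)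
  then have "integrable lborel (\<lambda>r. indicator {0<..<L} (L + (-1) * r) * (L + (-1) * r) powr (-1/2))"
    by (subst lborel_integrable_real_affine_iff) auto
  also have "(\<lambda>r. indicator {0<..<L} (L + (-1) * r) * (L + (-1) * r) powr (-1/2))
    = (\<lambda>r. indicator {0<..<L} r * (L - r) powr (-1/2))"
    by (auto simp: indicator_def fun_eq_iff)
  finally show ?thesis unfolding dom_def distrib_left using i by (intro Bochner_Integration.integrable_add)
qed

lemma dom_bound:
  obtains D where "\<And>r x k. r \<in> {0<..<L} \<Longrightarrow> x\<^sup>2 \<le> r \<Longrightarrow> x\<^sup>2 \<le> L - r \<Longrightarrow> 0 \<le> k \<Longrightarrow> k \<le> r \<Longrightarrow> k \<le> L - r \<Longrightarrow>
    \<bar>q r * x * k\<bar> \<le> D * dom r"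
proof -
  obtain C where C: "0 \<le> C" "\<And>t. t \<in> {0<..<L} \<Longrightarrow> q t \<le> 1 * (1 / t\<^sup>2 + 1 / (L - t)\<^sup>2) + C"
    using q_bound[OF zero_less_one] by blast
  \<comment> \<open>The constant \<open>C\<close> of \<open>q_bound\<close> is absorbed into the
    singular term at 0 because \<open>1 \<le> L^2 / r^2\<close> on the interval.\<close>
  let ?D = "1 + C * L\<^sup>2"
  have "\<bar>q r * x * k\<bar> \<le> ?D * dom r"
    if r: "r \<in> {0<..<L}" and x: "x\<^sup>2 \<le> r" "x\<^sup>2 \<le> L - r" and k: "0 \<le> k" "k \<le> r" "k \<le> L - r" for r x k
  proof -
    have p: "y / y\<^sup>2 * sqrt y = y powr (-1/2)" if "0 < y" for y :: real
      using that by (simp add: powr_minus powr_half_sqrt power2_eq_square field_simps)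
    have xb: "\<bar>x\<bar> \<le> sqrt r" "\<bar>x\<bar> \<le> sqrt (L - r)"
      using real_sqrt_le_mono[OF x(1)] real_sqrt_le_mono[OF x(2)] by simp_all
    have "r\<^sup>2 \<le> L\<^sup>2" using r by (intro power_mono) auto
    then have "1 \<le> L\<^sup>2 / r\<^sup>2" using r by simp
    then have C1: "C \<le> C * (L\<^sup>2 / r\<^sup>2)" using C(1) mult_left_mono[of 1 "L\<^sup>2 / r\<^sup>2" C] by simp
    have C2: "0 \<le> C * (L\<^sup>2 / (L - r)\<^sup>2)" using C(1) by simp
    have "q r \<le> (1 / r\<^sup>2 + 1 / (L - r)\<^sup>2) + (C + 0)" using C(2)[OF r] by simp
    also have "\<dots> \<le> (1 / r\<^sup>2 + 1 / (L - r)\<^sup>2) + (C * (L\<^sup>2 / r\<^sup>2) + C * (L\<^sup>2 / (L - r)\<^sup>2))"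
      by (intro add_left_mono add_mono C1 C2)
    also have "\<dots> = ?D * (1 / r\<^sup>2 + 1 / (L - r)\<^sup>2)" by (simp add: algebra_simps add_divide_distrib)
    finally have qb: "q r \<le> ?D * (1 / r\<^sup>2 + 1 / (L - r)\<^sup>2)" .
    have "\<bar>q r * x * k\<bar> = q r * (k * \<bar>x\<bar>)" using q_pos[OF r] k by (simp add: abs_mult)
    also have "\<dots> \<le> (?D * (1 / r\<^sup>2 + 1 / (L - r)\<^sup>2)) * (k * \<bar>x\<bar>)"
      using k by (intro mult_right_mono qb) simp
    also have "\<dots> = ?D * (1 / r\<^sup>2 * (k * \<bar>x\<bar>) + 1 / (L - r)\<^sup>2 * (k * \<bar>x\<bar>))"
      by (simp add: algebra_simps add_divide_distrib)
    also have "\<dots> \<le> ?D * (1 / r\<^sup>2 * (r * sqrt r) + 1 / (L - r)\<^sup>2 * ((L - r) * sqrt (L - r)))"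
      using C(1) k xb r by (intro mult_left_mono add_mono mult_mono) auto
    also have "\<dots> = ?D * dom r"
      using p[of r] p[of "L - r"] r by (simp add: dom_def mult_ac)
    finally show ?thesis .
  qed
  then show ?thesis by (rule that)
qed

text \<open>Pointwise convergence with the uniform bounds at both ends is enough to pass to the
  limit in all the integrals needed. The decisive facts are that \<open>G\<close> is not identically
  0 and that it solves the integral equation with kernel \<open>kernel t\<close>.\<close>

lemma limit_profile_properties:
  assumes v: "\<And>n::nat. L20 L (v n)" "\<And>n. norm2 (v n) = 1" "(\<lambda>n. energy (v n)) \<longlonglongrightarrow> energy_max"
    and lim: "\<And>t. (\<lambda>n. prim (v n) t) \<longlonglongrightarrow> G t"
  shows "G \<in> borel_measurable borel"
    and "\<And>t. t \<notin> {0<..<L} \<Longrightarrow> G t = 0"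
    and "\<And>t. t \<in> {0<..<L} \<Longrightarrow> (G t)\<^sup>2 \<le> t"
    and "\<And>t. t \<in> {0<..<L} \<Longrightarrow> (G t)\<^sup>2 \<le> L - t"
    and "\<exists>t\<in>{0<..<L}. G t \<noteq> 0"
    and "\<And>t. t \<in> {0<..<L} \<Longrightarrow> integrable lborel (\<lambda>r. q r * G r * kernel t r)"
    and "\<And>t. t \<in> {0<..<L} \<Longrightarrow> energy_max * G t = (LINT r|lborel. q r * G r * kernel t r)"
    and "integrable lborel (\<lambda>t. q t * (G t)\<^sup>2)"
    and "integrable lborel (\<lambda>r. q r * G r * (r * (L - r) / L))"
proof -
  have vm [measurable]: "prim (v n) \<in> borel_measurable borel" for n by (rule L20_prim_measurable[OF v(1)])
  show Gm [measurable]: "G \<in> borel_measurable borel"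
    by (rule borel_measurable_LIMSEQ_real[OF lim vm])
  have vb: "(prim (v n) t)\<^sup>2 \<le> t" "(prim (v n) t)\<^sup>2 \<le> L - t" if "t \<in> {0<..<L}" for n t
    using L20_prim_bound[OF v(1), of t n] v(2)[of n] that by (auto simp: norm2_def)
  have lim2: "(\<lambda>n. (prim (v n) t)\<^sup>2) \<longlonglongrightarrow> (G t)\<^sup>2" for t by (intro tendsto_power lim)
  show G0: "G t = 0" if "t \<notin> {0<..<L}" for t
    using lim[of t] prim_outside[OF v(1) that] by (simp add: LIMSEQ_const_iff)
  show Gb1: "(G t)\<^sup>2 \<le> t" if "t \<in> {0<..<L}" for t
    by (rule LIMSEQ_le_const2[OF lim2]) (use vb that in auto)
  show Gb2: "(G t)\<^sup>2 \<le> L - t" if "t \<in> {0<..<L}" for t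
    by (rule LIMSEQ_le_const2[OF lim2]) (use vb that in auto)
  have bnd: "(prim (v n) t)\<^sup>2 \<le> indicator {0<..<L} t * L" for n t
    using vb(1)[of t n] prim_outside[OF v(1), of t n] by (cases "t \<in> {0<..<L}") auto
  have lim3: "(\<lambda>n. LINT t|lborel. (prim (v n) t)\<^sup>2) \<longlonglongrightarrow> (LINT t|lborel. (G t)\<^sup>2)"
  proof (rule integral_dominated_convergence[where w="\<lambda>t. indicator {0<..<L} t * L"])
    show "integrable lborel (\<lambda>t. indicator {0<..<L} t * L)" by simp
  qed (use lim2 bnd in \<open>auto simp: power2_eq_square\<close>)
  show "\<exists>t\<in>{0<..<L}. G t \<noteq> 0"
  proof (rule ccontr)
    assume "\<not> (\<exists>t\<in>{0<..<L}. G t \<noteq> 0)"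
    then have "G t = 0" for t using G0[of t] by blast
    then have l0: "(\<lambda>n. LINT t|lborel. (prim (v n) t)\<^sup>2) \<longlonglongrightarrow> 0" using lim3 by simp
    \<comment> \<open>With this value the Hardy part \<open>8 * ?e\<close> is half of
      \<open>energy_max\<close>. If \<open>G\<close> were 0, the remaining part would tend to 0 and
      the energies could not approach \<open>energy_max\<close>.\<close>
    let ?e = "energy_max / 16"
    have e: "0 < ?e" using energy_max_pos by simp
    obtain C where C: "0 \<le> C" "\<And>t. t \<in> {0<..<L} \<Longrightarrow> q t \<le> ?e * (1 / t\<^sup>2 + 1 / (L - t)\<^sup>2) + C"
      using q_bound[OF e] by blast
    have "energy (v n) \<le> 8 * ?e + C * (LINT t|lborel. (prim (v n) t)\<^sup>2)" for n
      using energy_bound(2)[OF v(1) e C, of n] v(2)[of n] by (simp add: norm2_def)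
    moreover have "(\<lambda>n. 8 * ?e + C * (LINT t|lborel. (prim (v n) t)\<^sup>2)) \<longlonglongrightarrow> 8 * ?e + C * 0"
      by (intro tendsto_intros l0)
    ultimately have "energy_max \<le> 8 * ?e + C * 0"
      using v(3) by (intro LIMSEQ_le[OF v(3)]) auto
    with energy_max_pos show False by simp
  qed
  obtain D where D: "\<And>r x k. r \<in> {0<..<L} \<Longrightarrow> x\<^sup>2 \<le> r \<Longrightarrow> x\<^sup>2 \<le> L - r \<Longrightarrow> 0 \<le> k \<Longrightarrow> k \<le> r \<Longrightarrow> k \<le> L - r \<Longrightarrow>
    \<bar>q r * x * k\<bar> \<le> D * dom r"
    by (rule dom_bound) blast
  have kb: "norm (q r * prim (v n) r * kernel t r) \<le> D * dom r" "norm (q r * G r * kernel t r) \<le> D * dom r"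
    if t: "t \<in> {0<..<L}" for r n t
  proof -
    show "norm (q r * prim (v n) r * kernel t r) \<le> D * dom r"
      using D[of r "prim (v n) r" "kernel t r"] vb[of r n] kernel_bounds[OF t, of r] 
      by (cases "r \<in> {0<..<L}") (auto simp: less_imp_le dom_def kernel_def)
    show "norm (q r * G r * kernel t r) \<le> D * dom r"
      using D[of r "G r" "kernel t r"] Gb1[of r] Gb2[of r] kernel_bounds[OF t, of r] 
      by (cases "r \<in> {0<..<L}") (auto simp: less_imp_le dom_def kernel_def)
  qed
  have Di: "integrable lborel (\<lambda>r. D * dom r)" using dom_integrable by simp
  have km [measurable]: "kernel t \<in> borel_measurable borel" for t unfolding kernel_def by measurable
  show "integrable lborel (\<lambda>r. q r * G r * kernel t r)" if t: "t \<in> {0<..<L}" for t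
    by (rule Bochner_Integration.integrable_bound[OF Di])
       (measurable, use kb(2)[OF t] in \<open>auto intro: order_trans[OF _ abs_ge_self]\<close>)
  show "integrable lborel (\<lambda>r. q r * G r * (r * (L - r) / L))"
  proof (rule Bochner_Integration.integrable_bound[OF Di])
    have "norm (q r * G r * (r * (L - r) / L)) \<le> D * dom r" for r
    proof (cases "r \<in> {0<..<L}")
      case True
      \<comment> \<open>The factor \<open>r * (L - r) / L\<close> is the diagonal value
        \<open>kernel r r\<close>, so the bound for kernels applies with
        \<open>t = r\<close>.\<close>
      with kb(2)[of r r] show ?thesis by (simp add: kernel_def)
    next
      case False
      then show ?thesis using G0[OF False] by (simp add: dom_def)
    qed
    then show "AE r in lborel. norm (q r * G r * (r * (L - r) / L)) \<le> norm (D * dom r)"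
      by (auto intro!: AE_I2 order_trans[OF _ abs_ge_self])
  qed measurable
  show "energy_max * G t = (LINT r|lborel. q r * G r * kernel t r)" if t: "t \<in> {0<..<L}" for t
  proof -
    have l1: "(\<lambda>n. LINT r|lborel. q r * prim (v n) r * kernel t r) \<longlonglongrightarrow> (LINT r|lborel. q r * G r * kernel t r)"
      by (rule integral_dominated_convergence[OF _ _ Di])
         (measurable, use kb[OF t] lim in \<open>auto intro!: tendsto_intros\<close>)
    \<comment> \<open>The defect in the Euler-Lagrange equation of \<open>v n\<close>, tested with
      \<open>green t\<close>. Its square is at most \<open>energy_max - energy (v n)\<close> times a
      number independent of \<open>n\<close>, hence it tends to 0.\<close>
    let ?d = "\<lambda>n. energy_max * prim (v n) t - (LINT r|lborel. q r * prim (v n) r * kernel t r)"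
    have d: "(?d n)\<^sup>2 \<le> (energy_max - energy (v n)) * (energy_max * norm2 (green t) - energy (green t))" for n
      using euler_lagrange_defect[OF v(1)[of n] L20_green[OF t]] v(2)[of n]
      by (simp add: integral_mult_green[OF v(1)] prim_green_eq[OF t])
    have "(\<lambda>n. (energy_max - energy (v n)) * (energy_max * norm2 (green t) - energy (green t)))
       \<longlonglongrightarrow> (energy_max - energy_max) * (energy_max * norm2 (green t) - energy (green t))"
      by (intro tendsto_intros v(3))
    then have z: "(\<lambda>n. (energy_max - energy (v n)) * (energy_max * norm2 (green t) - energy (green t))) \<longlonglongrightarrow> 0"
      by simp
    have "(\<lambda>n. (?d n)\<^sup>2) \<longlonglongrightarrow> 0"
      by (rule real_tendsto_sandwich[OF always_eventually always_eventually tendsto_const z])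
         (intro allI zero_le_power2 d)+
    then have "?d \<longlonglongrightarrow> 0" by (rule power_tendsto_0_iff[THEN iffD1, rotated]) simp
    moreover have "?d \<longlonglongrightarrow> energy_max * G t - (LINT r|lborel. q r * G r * kernel t r)"
      by (intro tendsto_intros l1 lim)
    ultimately have "energy_max * G t - (LINT r|lborel. q r * G r * kernel t r) = 0"
      using LIMSEQ_unique by blast
    then show ?thesis by simp
  qed
  show "integrable lborel (\<lambda>t. q t * (G t)\<^sup>2)"
  proof (rule integrableI_nonneg)
    show "AE t in lborel. 0 \<le> q t * (G t)\<^sup>2"
    proof (rule AE_I2)
      fix t show "0 \<le> q t * (G t)\<^sup>2" using q_pos[of t] G0[of t] by (cases "t \<in> {0<..<L}") auto
    qed
    have "(\<integral>\<^sup>+t. ennreal (q t * (G t)\<^sup>2) \<partial>lborel) = (\<integral>\<^sup>+t. liminf (\<lambda>n. ennreal (q t * (prim (v n) t)\<^sup>2)) \<partial>lborel)"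
    proof (rule nn_integral_cong)
      fix t
      have "(\<lambda>n. ennreal (q t * (prim (v n) t)\<^sup>2)) \<longlonglongrightarrow> ennreal (q t * (G t)\<^sup>2)"
        by (intro tendsto_intros lim)
      then show "ennreal (q t * (G t)\<^sup>2) = liminf (\<lambda>n. ennreal (q t * (prim (v n) t)\<^sup>2))"
        using lim_imp_Liminf[OF sequentially_bot] by metis
    qed
    \<comment> \<open>Fatou's lemma: the energies of the sequence converge, so the energy of the
      limit is finite.\<close>
    also have "\<dots> \<le> liminf (\<lambda>n. \<integral>\<^sup>+t. ennreal (q t * (prim (v n) t)\<^sup>2) \<partial>lborel)"
      by (rule nn_integral_liminf) measurable
    also have "\<dots> = liminf (\<lambda>n. ennreal (energy (v n)))"
      by (subst nn_integral_eq_integral[OF energy_integrable[OF v(1)]])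
         (auto simp: energy_nonneg_integrand[OF v(1)] energy_def)
    also have "\<dots> = ennreal energy_max"
      by (intro lim_imp_Liminf[OF sequentially_bot] tendsto_intros v(3))
    also have "\<dots> < \<infinity>" by simp
    finally show "(\<integral>\<^sup>+t. ennreal (q t * (G t)\<^sup>2) \<partial>lborel) < \<infinity>" .
  qed measurable
qed

end

section \<open>Regularity of the maximizer\<close>

lemma prim_tendsto:
  fixes f :: "real \<Rightarrow> real"
  assumes f: "integrable lborel f"
  shows "(prim f \<longlongrightarrow> prim f t) (at t)"
  unfolding tendsto_at_iff_sequentially
proof (intro allI impI)
  fix X :: "nat \<Rightarrow> real" assume "\<forall>i. X i \<in> UNIV - {t}" and X: "X \<longlonglongrightarrow> t"
  have [measurable]: "f \<in> borel_measurable borel" using f by (simp add: borel_measurable_integrable)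
  show "(prim f \<circ> X) \<longlonglongrightarrow> prim f t"
    unfolding prim_def o_def
  proof (rule integral_dominated_convergence[where w="\<lambda>r. \<bar>f r\<bar>"])
    show "AE r in lborel. (\<lambda>i. indicator {..X i} r * f r) \<longlonglongrightarrow> indicator {..t} r * f r"
      using AE_lborel_singleton[of t]
    proof eventually_elim
      case (elim r)
      have "eventually (\<lambda>i. indicator {..X i} r * f r = indicator {..t} r * f r) sequentially"
      proof (cases "r < t")
        case True
        from order_tendstoD(1)[OF X this] show ?thesis
          by eventually_elim (use True in \<open>auto simp: indicator_def\<close>)
      next
        case False
        with elim have "t < r" by simp
        from order_tendstoD(2)[OF X this] show ?thesis
          by eventually_elim (use \<open>t < r\<close> in \<open>auto simp: indicator_def\<close>)
      qed
      then show ?case by (rule tendsto_eventually)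
    qed
  qed (use f in \<open>auto simp: indicator_def\<close>)
qed

text \<open>Continuity is demanded only near \<open>t\<close>, so that integrands singular at the
  ends of the interval, but integrable, can be treated. Near \<open>t\<close> the primitive differs
  by a constant from an integral over a compact interval.\<close>

lemma prim_has_real_derivative:
  fixes f :: "real \<Rightarrow> real"
  assumes f: "integrable lborel f" and S: "open S" "continuous_on S f" "t \<in> S"
  shows "(prim f has_real_derivative f t) (at t)"
proof -
  obtain e where e: "0 < e" "cball t e \<subseteq> S" using S open_contains_cball by blast
  define a b where "a = t - e" and "b = t + e"
  have ab: "a < t" "t < b" "{a..b} \<subseteq> S"
    using e by (auto simp: a_def b_def cball_eq_atLeastAtMost)
  have cont: "continuous_on {a..b} f" by (rule continuous_on_subset[OF S(2) ab(3)])
  have [measurable]: "f \<in> borel_measurable borel" using f by (simp add: borel_measurable_integrable)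
  have eq: "prim f a + integral {a..x} f = prim f x" if "x \<in> {a<..<b}" for x
  proof -
    have "prim f x - prim f a = (LINT r|lborel. indicator {a<..x} r * f r)"
      by (rule prim_diff[OF f]) (use that in simp)
    also have "\<dots> = (LINT r|lborel. indicator {a..x} r *\<^sub>R f r)"
      by (rule integral_cong_AE)
         (measurable, use AE_lborel_singleton[of a] in \<open>eventually_elim, auto simp: indicator_def\<close>)
    also have "\<dots> = integral {a..x} f"
    proof (rule set_borel_integral_eq_integral(2)[unfolded set_lebesgue_integral_def])
      show "set_integrable lborel {a..x} f"
        using f unfolding set_integrable_def by (intro integrable_mult_indicator) auto
    qed
    finally show ?thesis by simp
  qed
  have "((\<lambda>x. integral {a..x} f) has_real_derivative f t) (at t within {a..b})"
    by (rule integral_has_real_derivative[OF cont]) (use ab in auto)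
  then have "((\<lambda>x. integral {a..x} f) has_real_derivative f t) (at t)"
    using ab by (simp add: at_within_Icc_at)
  then have "((\<lambda>x. prim f a + integral {a..x} f) has_real_derivative f t) (at t)"
    by (auto intro!: derivative_eq_intros)
  then show ?thesis
    by (rule has_field_derivative_transform_within_open[of _ _ _ "{a<..<b}"]) (use ab eq in auto)
qed

text \<open>This kills the boundary terms when \<open>\<integral> w\<^sup>2\<close> is integrated by parts. By l'Hospital,
  \<open>w = o(t\<^sup>-\<^sup>1\<^sup>/\<^sup>2)\<close>, whereas \<open>G = O(t\<^sup>1\<^sup>/\<^sup>2)\<close>.\<close>

lemma boundary_product_vanishes:
  fixes w G p :: "real \<Rightarrow> real"
  assumes M: "0 < M"
    and w: "\<forall>\<^sub>F t in at_right 0. (w has_real_derivative - p t * G t / M) (at t)"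
    and G: "\<forall>\<^sub>F t in at_right 0. (G t)\<^sup>2 \<le> t"
    and p: "\<forall>\<^sub>F t in at_right 0. 0 \<le> p t" "((\<lambda>t. t\<^sup>2 * p t) \<longlongrightarrow> 0) (at_right 0)"
  shows "((\<lambda>t. w t * G t) \<longlongrightarrow> 0) (at_right 0)"
proof -
  have pos: "\<forall>\<^sub>F t in at_right (0::real). 0 < t" by (rule eventually_at_right_less)
  \<comment> \<open>The denominator tends to infinity, so this form of l'Hospital's rule presupposes
    no limit of \<open>w\<close>. The quotient of the derivatives is
    \<open>2 / M * p t * G t * t powr (3/2)\<close>, of absolute value at most
    \<open>2 / M * (p t * t^2)\<close>.\<close>
  have "((\<lambda>t. w t / t powr (-1/2)) \<longlongrightarrow> 0) (at_right 0)"
  proof (rule lhopital_right_0_at_top[OF _ _ w])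
    show "LIM t at_right (0::real). t powr (-1/2) :> at_top"
      by real_asymp
    show "\<forall>\<^sub>F t in at_right (0::real). - (1/2) * t powr (-3/2) \<noteq> 0"
      using pos by eventually_elim simp
    show "\<forall>\<^sub>F t in at_right (0::real). ((\<lambda>t. t powr (-1/2)) has_real_derivative - (1/2) * t powr (-3/2)) (at t)"
      using pos by eventually_elim (auto intro!: derivative_eq_intros)
    show "((\<lambda>t. - p t * G t / M / (- (1/2) * t powr (-3/2))) \<longlongrightarrow> 0) (at_right 0)"
    proof (rule Lim_null_comparison)
      show "((\<lambda>t. 2 / M * (t\<^sup>2 * p t)) \<longlongrightarrow> 0) (at_right 0)"
        using p(2) by (rule tendsto_mult_right_zero)
      show "\<forall>\<^sub>F t in at_right 0. norm (- p t * G t / M / (- (1/2) * t powr (-3/2))) \<le> 2 / M * (t\<^sup>2 * p t)"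
        using pos G p(1)
      proof eventually_elim
        case (elim t)
        have "\<bar>G t\<bar> \<le> sqrt t" using real_sqrt_le_mono[OF elim(2)] by simp
        then have le: "\<bar>G t\<bar> * t powr (3/2) \<le> sqrt t * t powr (3/2)" by (intro mult_right_mono) auto
        have "sqrt t * t powr (3/2) = t powr (1/2 + 3/2)"
          using elim(1) by (subst powr_add) (simp add: powr_half_sqrt)
        also have "\<dots> = t\<^sup>2" using elim(1) by simp
        finally have t2: "\<bar>G t\<bar> * t powr (3/2) \<le> t\<^sup>2" using le by simp
        have "norm (- p t * G t / M / (- (1/2) * t powr (-3/2))) = 2 / M * p t * (\<bar>G t\<bar> / t powr (-3/2))"
          using M elim by (simp add: abs_mult abs_divide)
        also have "\<bar>G t\<bar> / t powr (-3/2) = \<bar>G t\<bar> * t powr (3/2)"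
          by (simp add: powr_minus_divide)
        also have "2 / M * p t * \<dots> \<le> 2 / M * p t * t\<^sup>2"
          using t2 M elim by (intro mult_left_mono) auto
        finally show ?case by (simp add: mult_ac)
      qed
    qed
  qed
  then have "((\<lambda>t. \<bar>w t / t powr (-1/2)\<bar>) \<longlongrightarrow> 0) (at_right 0)"
    by (rule tendsto_rabs_zero)
  then show ?thesis
  proof (rule Lim_null_comparison[rotated])
    show "\<forall>\<^sub>F t in at_right 0. norm (w t * G t) \<le> \<bar>w t / t powr (-1/2)\<bar>"
      using pos G
    proof eventually_elim
      case (elim t)
      have "\<bar>G t\<bar> \<le> sqrt t" using real_sqrt_le_mono[OF elim(2)] by simp
      then have "\<bar>w t\<bar> * \<bar>G t\<bar> \<le> \<bar>w t\<bar> * sqrt t" by (rule mult_left_mono) simp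
      also have "\<dots> = \<bar>w t / t powr (-1/2)\<bar>"
        using elim(1) by (simp add: powr_minus_divide powr_half_sqrt abs_mult)
      finally show ?case by (simp add: abs_mult)
    qed
  qed
qed

lemma at_left_reflect: "at_left L = filtermap (\<lambda>t. L - t) (at_right (0::real))"
  by (simp add: at_left_minus[of L] at_right_to_0[of "- L"] filtermap_filtermap)

context hardy_weight
begin

lemma eventually_interval_right: "\<forall>\<^sub>F t in at_right 0. t \<in> {0<..<L}"
  using L_pos by (auto simp: eventually_at_right_field)

lemma eventually_interval_left: "\<forall>\<^sub>F t in at_left L. t \<in> {0<..<L}"
  using L_pos by (auto simp: eventually_at_left_field)

lemma eventually_interval_reflect: "\<forall>\<^sub>F t in at_right 0. L - t \<in> {0<..<L}"
  using eventually_interval_left by (simp add: at_left_reflect eventually_filtermap)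

text \<open>Cutting the kernel at \<open>r = t\<close> writes \<open>M * L * G t\<close> as
  \<open>(L - t) * A t + t * B t\<close>, where \<open>A\<close> integrates \<open>f\<close> up to
  \<open>t\<close> and \<open>B\<close> integrates \<open>g\<close> beyond \<open>t\<close>. In the
  derivative the terms \<open>(L - t) * f t\<close> and \<open>t * g t\<close> cancel, leaving
  \<open>B t - A t\<close>; this is again differentiable, with derivative
  \<open>- g t - f t = - L * (q t * G t)\<close>.\<close>

lemma kernel_equation_differentiated:
  assumes G: "G \<in> borel_measurable borel" "continuous_on {0<..<L} G" "\<And>t. t \<notin> {0<..<L} \<Longrightarrow> G t = 0"
    and i: "integrable lborel (\<lambda>r. q r * G r * (r * (L - r) / L))" and M: "0 < M"
    and eq: "\<And>t. t \<in> {0<..<L} \<Longrightarrow> M * G t = (LINT r|lborel. q r * G r * kernel t r)"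
  obtains w where "\<And>t. t \<in> {0<..<L} \<Longrightarrow> (G has_real_derivative w t) (at t)"
    "\<And>t. t \<in> {0<..<L} \<Longrightarrow> (w has_real_derivative - q t * G t / M) (at t)"
    "\<And>t. t \<notin> {0<..<L} \<Longrightarrow> w t = 0"
proof -
  note [measurable] = G(1)
  define f where "f r = r * (q r * G r)" for r
  define g where "g r = (L - r) * (q r * G r)" for r
  \<comment> \<open>Only the product with both factors \<open>r\<close> and \<open>L - r\<close> is
    known to be integrable. Away from \<open>L\<close> the factor \<open>L - r\<close> is bounded
    below by \<open>L - t\<close>, which gives the constant \<open>L / (L - t)\<close>.\<close>
  have fi: "integrable lborel (\<lambda>r. indicator {..t} r * f r)" if t: "t < L" for t
  proof (rule Bochner_Integration.integrable_bound)
    show "integrable lborel (\<lambda>r. (L / (L - t)) * (q r * G r * (r * (L - r) / L)))" using i by (intro integrable_mult_right)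
    show "AE r in lborel. norm (indicator {..t} r * f r) \<le> norm ((L / (L - t)) * (q r * G r * (r * (L - r) / L)))"
    proof (rule AE_I2)
      fix r
      show "norm (indicator {..t} r * f r) \<le> norm ((L / (L - t)) * (q r * G r * (r * (L - r) / L)))"
      proof (cases "r \<in> {0<..<L} \<and> r \<le> t")
        case True
        have "norm ((L / (L - t)) * (q r * G r * (r * (L - r) / L))) = norm ((L - r) / (L - t) * f r)"
          using L_pos by (intro arg_cong[where f=norm]) (simp add: f_def)
        then have e1: "norm ((L / (L - t)) * (q r * G r * (r * (L - r) / L))) = \<bar>(L - r) / (L - t)\<bar> * \<bar>f r\<bar>"
          by (simp only: real_norm_def abs_mult)
        have e0: "norm (indicator {..t} r * f r) = 1 * \<bar>f r\<bar>" using True by simp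
        have le: "1 * \<bar>f r\<bar> \<le> \<bar>(L - r) / (L - t)\<bar> * \<bar>f r\<bar>"
          using True t by (intro mult_right_mono) (auto simp: le_divide_eq)
        show ?thesis unfolding e0 e1 by (rule le)
      next
        case False
        then show ?thesis using G(3)[of r] by (auto simp: f_def indicator_def)
      qed
    qed
  qed (unfold f_def, measurable)
  have gi: "integrable lborel (\<lambda>r. indicator {t<..} r * g r)" if t: "0 < t" for t
  proof (rule Bochner_Integration.integrable_bound)
    show "integrable lborel (\<lambda>r. (L / t) * (q r * G r * (r * (L - r) / L)))" using i by (intro integrable_mult_right)
    show "AE r in lborel. norm (indicator {t<..} r * g r) \<le> norm ((L / t) * (q r * G r * (r * (L - r) / L)))"
    proof (rule AE_I2)
      fix r
      show "norm (indicator {t<..} r * g r) \<le> norm ((L / t) * (q r * G r * (r * (L - r) / L)))"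
      proof (cases "r \<in> {0<..<L} \<and> t < r")
        case True
        have "norm ((L / t) * (q r * G r * (r * (L - r) / L))) = norm (r / t * g r)"
          using L_pos by (intro arg_cong[where f=norm]) (simp add: g_def)
        then have e1: "norm ((L / t) * (q r * G r * (r * (L - r) / L))) = \<bar>r / t\<bar> * \<bar>g r\<bar>"
          by (simp only: real_norm_def abs_mult)
        have e0: "norm (indicator {t<..} r * g r) = 1 * \<bar>g r\<bar>" using True by simp
        have le: "1 * \<bar>g r\<bar> \<le> \<bar>r / t\<bar> * \<bar>g r\<bar>"
          using True t by (intro mult_right_mono) (auto simp: le_divide_eq)
        show ?thesis unfolding e0 e1 by (rule le)
      next
        case False
        then show ?thesis using G(3)[of r] by (auto simp: g_def indicator_def)
      qed
    qed
  qed (unfold g_def, measurable)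
  define A where "A t = (LINT r|lborel. indicator {..t} r * f r)" for t
  define B where "B t = (LINT r|lborel. indicator {t<..} r * g r)" for t
  have cont: "continuous_on S f" "continuous_on S g" if "S \<subseteq> {0<..<L}" for S
    unfolding f_def g_def
    by (intro continuous_intros continuous_on_subset[OF G(2) that] continuous_on_subset[OF q_cont that])+
  have dA: "(A has_real_derivative f t) (at t)" if t: "t \<in> {0<..<L}" for t
  proof -
    \<comment> \<open>\<open>A\<close> need not be the primitive of a globally integrable function,
      so \<open>f\<close> is cut off at a point \<open>c\<close> between \<open>t\<close> and
      \<open>L\<close> before differentiating.\<close>
    define c where "c = (t + L) / 2"
    have c: "t < c" "c < L" using t by (auto simp: c_def)
    let ?f = "\<lambda>r. indicator {..c} r * f r"
    have "continuous_on {0<..<c} ?f"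
      by (rule continuous_on_eq[OF cont(1)]) (use c in auto)
    then have "(prim ?f has_real_derivative ?f t) (at t)"
      using t c by (intro prim_has_real_derivative[OF fi[OF c(2)], of "{0<..<c}"]) auto
    then have "(prim ?f has_real_derivative f t) (at t)" using c by simp
    then show ?thesis
    proof (rule has_field_derivative_transform_within_open[of _ _ _ "{0<..<c}"])
      show "prim ?f x = A x" if "x \<in> {0<..<c}" for x
        unfolding prim_def A_def
        by (rule Bochner_Integration.integral_cong) (use that in \<open>auto simp: indicator_def\<close>)
    qed (use t c in auto)
  qed
  have dB: "(B has_real_derivative - g t) (at t)" if t: "t \<in> {0<..<L}" for t
  proof -
    define c where "c = t / 2"
    have c: "0 < c" "c < t" using t by (auto simp: c_def)
    let ?g = "\<lambda>r. indicator {c<..} r * g r"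
    have "continuous_on {c<..<L} ?g"
      by (rule continuous_on_eq[OF cont(2)]) (use c in auto)
    then have "(prim ?g has_real_derivative ?g t) (at t)"
      using t c by (intro prim_has_real_derivative[OF gi[OF c(1)], of "{c<..<L}"]) auto
    then have "((\<lambda>t. (LINT r|lborel. ?g r) - prim ?g t) has_real_derivative - g t) (at t)"
      using c by (auto intro!: derivative_eq_intros)
    then show ?thesis
    proof (rule has_field_derivative_transform_within_open[of _ _ _ "{c<..<L}"])
      show "(LINT r|lborel. ?g r) - prim ?g x = B x" if "x \<in> {c<..<L}" for x
      proof -
        have "(LINT r|lborel. ?g r) - prim ?g x = (LINT r|lborel. ?g r - indicator {..x} r * ?g r)"
          unfolding prim_def
          by (rule Bochner_Integration.integral_diff[symmetric])
             (use gi[OF c(1)] prim_integrable[OF gi[OF c(1)]] in simp_all)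
        also have "\<dots> = B x"
          unfolding B_def by (rule Bochner_Integration.integral_cong) (use that in \<open>auto simp: indicator_def\<close>)
        finally show ?thesis .
      qed
    qed (use t c in auto)
  qed
  have GAB: "((L - t) * A t + t * B t) / (M * L) = G t" if t: "t \<in> {0<..<L}" for t
  proof -
    have "M * G t = (LINT r|lborel. (L - t) / L * (indicator {..t} r * f r) + t / L * (indicator {t<..} r * g r))"
      unfolding eq[OF t]
    proof (rule Bochner_Integration.integral_cong[OF refl])
      fix r
      show "q r * G r * kernel t r = (L - t) / L * (indicator {..t} r * f r) + t / L * (indicator {t<..} r * g r)"
        using G(3)[of r] by (cases "r \<in> {0<..<L}") (auto simp: kernel_def f_def g_def)
    qed
    also have "\<dots> = (L - t) / L * A t + t / L * B t"
      unfolding A_def B_def using fi[of t] gi[of t] t by simp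
    finally have "G t = ((L - t) / L * A t + t / L * B t) / M" using M by (simp add: field_simps)
    also have "\<dots> = ((L - t) * A t + t * B t) / (M * L)" by (simp add: add_divide_distrib mult.commute[of M L])
    finally show ?thesis by simp
  qed
  define w where "w t = indicator {0<..<L} t * ((B t - A t) / (M * L))" for t
  show ?thesis
  proof (rule that[of w])
    fix t assume t: "t \<in> {0<..<L}"
    have "((\<lambda>t. ((L - t) * A t + t * B t) / (M * L)) has_real_derivative
      (- A t + (L - t) * f t + (B t - t * g t)) / (M * L)) (at t)"
      using M L_pos by (auto intro!: derivative_eq_intros dA[OF t] dB[OF t])
    also have "(- A t + (L - t) * f t + (B t - t * g t)) / (M * L) = w t"
      using t M L_pos by (simp add: w_def f_def g_def)
    finally show "(G has_real_derivative w t) (at t)"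
      by (rule has_field_derivative_transform_within_open[of _ _ _ "{0<..<L}"]) (use t GAB in auto)
    have "((\<lambda>t. (B t - A t) / (M * L)) has_real_derivative (- g t - f t) / (M * L)) (at t)"
      using M L_pos by (auto intro!: derivative_eq_intros dA[OF t] dB[OF t])
    also have "(- g t - f t) / (M * L) = - q t * G t / M"
    proof -
      have "- g t - f t = L * (- q t * G t)" by (simp add: g_def f_def algebra_simps)
      then show ?thesis using L_pos M by simp
    qed
    finally show "(w has_real_derivative - q t * G t / M) (at t)"
      by (rule has_field_derivative_transform_within_open[of _ _ _ "{0<..<L}"]) (use t in \<open>auto simp: w_def\<close>)
  qed (simp add: w_def)
qed

text \<open>With \<open>w\<close> the derivative of the limit \<open>G\<close>, it remains to see
  that \<open>w\<close> is square integrable with primitive \<open>G\<close>. One integration by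
  parts gives the integrability of the square and, at the same time, the equality case
  \<open>energy w = energy_max * norm2 w\<close>.\<close>

lemma eigenfunction_exists:
  obtains w where "L20 L w" "energy w = energy_max * norm2 w" "0 < norm2 w"
    "\<And>t. t \<in> {0<..<L} \<Longrightarrow> (prim w has_real_derivative w t) (at t)"
    "\<And>t. t \<in> {0<..<L} \<Longrightarrow> (w has_real_derivative - q t * prim w t / energy_max) (at t)"
proof -
  obtain v G where v: "\<And>n::nat. L20 L (v n)" "\<And>n. norm2 (v n) = 1" "(\<lambda>n. energy (v n)) \<longlonglongrightarrow> energy_max"
    "\<And>t. (\<lambda>n. prim (v n) t) \<longlonglongrightarrow> G t" and Gc: "continuous_on {0<..<L} G"
    using limit_profile by blast
  note G = limit_profile_properties[OF v]
  note [measurable] = G(1)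
  let ?M = energy_max
  obtain w where w: "\<And>t. t \<in> {0<..<L} \<Longrightarrow> (G has_real_derivative w t) (at t)"
    "\<And>t. t \<in> {0<..<L} \<Longrightarrow> (w has_real_derivative - q t * G t / ?M) (at t)"
    "\<And>t. t \<notin> {0<..<L} \<Longrightarrow> w t = 0"
    using kernel_equation_differentiated[OF G(1) Gc G(2) G(9) energy_max_pos G(7)] by blast
  have wc: "continuous_on {0<..<L} w"
    by (intro continuous_at_imp_continuous_on ballI) (use w(2) DERIV_isCont in blast)
  have "(\<lambda>x. indicator {0<..<L} x *\<^sub>R w x) \<in> borel_measurable borel"
    by (rule borel_measurable_continuous_on_indicator[OF _ wc]) simp
  also have "(\<lambda>x. indicator {0<..<L} x *\<^sub>R w x) = w" using w(3) by (auto simp: indicator_def fun_eq_iff)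
  finally have wm [measurable]: "w \<in> borel_measurable borel" .
  have G0: "((\<lambda>t. G t) \<longlongrightarrow> 0) (at_right 0)"
  proof (rule Lim_null_comparison)
    show "((\<lambda>t. sqrt t) \<longlongrightarrow> 0) (at_right 0)" by (auto intro!: tendsto_eq_intros)
    show "\<forall>\<^sub>F t in at_right 0. norm (G t) \<le> sqrt t"
      using eventually_interval_right
      by eventually_elim (use G(3) in \<open>force dest: real_sqrt_le_mono\<close>)
  qed
  have GL: "((\<lambda>t. G t) \<longlongrightarrow> 0) (at_left L)"
  proof (rule Lim_null_comparison)
    show "((\<lambda>t. sqrt (L - t)) \<longlongrightarrow> 0) (at_left L)" by (auto intro!: tendsto_eq_intros)
    show "\<forall>\<^sub>F t in at_left L. norm (G t) \<le> sqrt (L - t)"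
      using eventually_interval_left
      by eventually_elim (use G(4) in \<open>force dest: real_sqrt_le_mono\<close>)
  qed
  have b0: "((\<lambda>t. w t * G t) \<longlongrightarrow> 0) (at_right 0)"
  proof (rule boundary_product_vanishes[OF energy_max_pos, of w q])
    show "\<forall>\<^sub>F t in at_right 0. (w has_real_derivative - q t * G t / ?M) (at t)"
      using eventually_interval_right by eventually_elim (rule w(2))
    show "\<forall>\<^sub>F t in at_right 0. (G t)\<^sup>2 \<le> t"
      using eventually_interval_right by eventually_elim (rule G(3))
    show "\<forall>\<^sub>F t in at_right 0. 0 \<le> q t"
      using eventually_interval_right by eventually_elim (use q_pos in \<open>force intro: less_imp_le\<close>)
  qed (rule q_0)
  \<comment> \<open>The right end is reduced to the left one by reflection:
    \<open>- w (L - t)\<close> is the derivative of \<open>G (L - t)\<close>.\<close>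
  have "((\<lambda>t. - w (L - t) * G (L - t)) \<longlongrightarrow> 0) (at_right 0)"
  proof (rule boundary_product_vanishes[OF energy_max_pos, of _ "\<lambda>t. q (L - t)"])
    show "\<forall>\<^sub>F t in at_right 0. ((\<lambda>t. - w (L - t)) has_real_derivative - q (L - t) * G (L - t) / ?M) (at t)"
      using eventually_interval_reflect
    proof eventually_elim
      case (elim t)
      have "((\<lambda>s. w (L - s)) has_real_derivative (- q (L - t) * G (L - t) / ?M) * (- 1)) (at t)"
        by (rule DERIV_chain2[of w _ "\<lambda>s. L - s", OF w(2)[OF elim]]) (auto intro!: derivative_eq_intros)
      then show ?case by (auto dest: DERIV_minus)
    qed
    show "\<forall>\<^sub>F t in at_right 0. (G (L - t))\<^sup>2 \<le> t"
      using eventually_interval_reflect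
    proof eventually_elim
      case (elim t)
      show ?case using G(4)[OF elim] by simp
    qed
    show "\<forall>\<^sub>F t in at_right 0. 0 \<le> q (L - t)"
      using eventually_interval_reflect by eventually_elim (use q_pos in \<open>force intro: less_imp_le\<close>)
    show "((\<lambda>t. t\<^sup>2 * q (L - t)) \<longlongrightarrow> 0) (at_right 0)"
      using q_L by (simp add: at_left_reflect filterlim_filtermap)
  qed
  then have bL: "((\<lambda>t. w t * G t) \<longlongrightarrow> 0) (at_left L)"
    using tendsto_minus by (fastforce simp: at_left_reflect filterlim_filtermap)
  let ?Q = "\<lambda>t. q t * (G t)\<^sup>2"
  \<comment> \<open>An antiderivative of the square of \<open>w\<close>: differentiating
    \<open>w t * G t\<close> also produces \<open>- q t * (G t)^2 / ?M\<close>, which the second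
    summand cancels.\<close>
  let ?H = "\<lambda>t. w t * G t + prim ?Q t / ?M"
  have Qc: "continuous_on {0<..<L} ?Q" by (intro continuous_intros q_cont Gc)
  have dH: "(?H has_real_derivative (w t)\<^sup>2) (at t)" if t: "t \<in> {0<..<L}" for t
  proof -
    have "(?H has_real_derivative (- q t * G t / ?M) * G t + w t * w t + ?Q t / ?M) (at t)"
      using DERIV_mult[OF w(2)[OF t] w(1)[OF t]] DERIV_cdivide[OF prim_has_real_derivative[OF G(8) open_greaterThanLessThan Qc t]]
      by (intro DERIV_add) (auto simp: mult.commute)
    also have "(- q t * G t / ?M) * G t + w t * w t + ?Q t / ?M = (w t)\<^sup>2"
      by (simp add: power2_eq_square)
    finally show ?thesis .
  qed
  have Q0: "prim ?Q 0 = 0"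
    unfolding prim_def by (rule integral_eq_zero_AE) (use G(2) in \<open>auto simp: indicator_def\<close>)
  have QL: "prim ?Q L = (LINT t|lborel. ?Q t)"
    unfolding prim_def by (rule Bochner_Integration.integral_cong) (use G(2) in \<open>auto simp: indicator_def\<close>)
  have "(?H \<longlongrightarrow> 0 + prim ?Q 0 / ?M) (at_right 0)"
    by (intro tendsto_add b0 tendsto_divide tendsto_const tendsto_within_subset[OF prim_tendsto[OF G(8)]])
       (use energy_max_pos in auto)
  then have A: "((?H \<circ> real_of_ereal) \<longlongrightarrow> 0) (at_right 0)"
    unfolding zero_ereal_def ereal_tendsto_simps using Q0 by simp
  have "(?H \<longlongrightarrow> 0 + prim ?Q L / ?M) (at_left L)"
    by (intro tendsto_add bL tendsto_divide tendsto_const tendsto_within_subset[OF prim_tendsto[OF G(8)]])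
       (use energy_max_pos in auto)
  then have B: "((?H \<circ> real_of_ereal) \<longlongrightarrow> (LINT t|lborel. ?Q t) / ?M) (at_left (ereal L))"
    unfolding ereal_tendsto_simps using QL by simp
  have ei: "einterval 0 (ereal L) = {0<..<L}" by (auto simp: einterval_def)
  \<comment> \<open>Because the integrand is nonnegative, finite limits of the antiderivative at
    both ends yield its integrability together with the value of the integral.\<close>
  have I: "set_integrable lborel (einterval 0 (ereal L)) (\<lambda>t. (w t)\<^sup>2)"
    "(LBINT t=0..ereal L. (w t)\<^sup>2) = (LINT t|lborel. ?Q t) / ?M - 0"
  proof -
    have l: "0 < ereal L" using L_pos by simp
    have d: "(?H has_real_derivative (w x)\<^sup>2) (at x)" if "0 < ereal x" "ereal x < ereal L" for x
      by (rule dH) (use that in auto)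
    have c: "isCont (\<lambda>t. (w t)\<^sup>2) x" if "0 < ereal x" "ereal x < ereal L" for x
      using that w(2)[of x] by (intro continuous_intros) (auto intro: DERIV_isCont)
    show "set_integrable lborel (einterval 0 (ereal L)) (\<lambda>t. (w t)\<^sup>2)"
      by (rule interval_integral_FTC_nonneg(1)[OF l d c _ A B]) auto
    show "(LBINT t=0..ereal L. (w t)\<^sup>2) = (LINT t|lborel. ?Q t) / ?M - 0"
      by (rule interval_integral_FTC_nonneg(2)[OF l d c _ A B]) auto
  qed
  have iw2: "(\<lambda>t. indicator {0<..<L} t *\<^sub>R (w t)\<^sup>2) = (\<lambda>t. (w t)\<^sup>2)"
    using w(3) by (auto simp: indicator_def fun_eq_iff)
  have w2: "integrable lborel (\<lambda>t. (w t)\<^sup>2)"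
    using I(1) unfolding set_integrable_def ei iw2 .
  have n2: "norm2 w = (LINT t|lborel. ?Q t) / ?M"
    using I(2) L_pos unfolding interval_lebesgue_integral_def set_lebesgue_integral_def ei iw2 norm2_def by simp
  have wi: "integrable lborel w"
    by (rule integrable_of_square_on_Ioo[OF wm w2 w(3)])
  have pd: "(prim w has_real_derivative w t) (at t)" if "t \<in> {0<..<L}" for t
    by (rule prim_has_real_derivative[OF wi _ wc that]) simp
  \<comment> \<open>Both functions have derivative \<open>w\<close>. The limit at 0 shows that the
    constant is 0, and the limit at \<open>L\<close> then gives \<open>prim w L = 0\<close>, that
    is, mean zero.\<close>
  have "\<exists>c. \<forall>t\<in>{0<..<L}. prim w t - G t = c"
  proof (rule has_field_derivative_zero_constant)
    fix t assume t: "t \<in> {0<..<L}"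
    have "((\<lambda>t. prim w t - G t) has_real_derivative w t - w t) (at t)"
      by (intro derivative_intros pd w(1) t)
    then show "((\<lambda>t. prim w t - G t) has_real_derivative 0) (at t within {0<..<L})"
      by (simp add: has_field_derivative_at_within)
  qed simp
  then obtain c where c: "\<And>t. t \<in> {0<..<L} \<Longrightarrow> prim w t - G t = c" by blast
  have p0: "prim w t = 0" if "t \<le> 0" for t
    unfolding prim_def by (rule integral_eq_zero_AE) (use w(3) that in \<open>auto simp: indicator_def\<close>)
  have pL: "prim w t = (LINT x|lborel. w x)" if "t \<ge> L" for t
    unfolding prim_def by (rule Bochner_Integration.integral_cong) (use w(3) that in \<open>auto simp: indicator_def\<close>)
  have "((\<lambda>t. prim w t - G t) \<longlongrightarrow> prim w 0 - 0) (at_right 0)"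
    by (intro tendsto_diff G0 tendsto_within_subset[OF prim_tendsto[OF wi]]) auto
  moreover have "((\<lambda>t. prim w t - G t) \<longlongrightarrow> c) (at_right 0)"
    by (rule tendsto_eventually, rule eventually_mono[OF eventually_interval_right], rule c)
  ultimately have c0: "c = 0"
    using tendsto_unique[OF trivial_limit_at_right_real] p0[of 0] by fastforce
  have "((\<lambda>t. prim w t - G t) \<longlongrightarrow> prim w L - 0) (at_left L)"
    by (intro tendsto_diff GL tendsto_within_subset[OF prim_tendsto[OF wi]]) auto
  moreover have "((\<lambda>t. prim w t - G t) \<longlongrightarrow> 0) (at_left L)"
    by (rule tendsto_eventually, rule eventually_mono[OF eventually_interval_left]) (use c c0 in simp)
  ultimately have "prim w L = 0"
    using tendsto_unique[OF trivial_limit_at_left_real] by fastforce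
  then have mean: "(LINT x|lborel. w x) = 0" using pL[of L] by simp
  have pG: "prim w = G"
  proof
    fix t show "prim w t = G t"
      using c[of t] c0 p0[of t] pL[of t] mean G(2)[of t] by (cases "t \<in> {0<..<L}") auto
  qed
  have L20w: "L20 L w" unfolding L20_def using wm w2 w(3) mean by auto
  obtain t where t: "t \<in> {0<..<L}" "G t \<noteq> 0" using G(5) by blast
  have "0 < (G t)\<^sup>2" using t(2) by simp
  also have "(G t)\<^sup>2 \<le> t * norm2 w"
    using L20_prim_bound(1)[OF L20w, of t] t(1) unfolding pG norm2_def by simp
  finally have pos: "0 < norm2 w" using t(1) by (simp add: zero_less_mult_iff)
  show ?thesis
  proof (rule that[OF L20w _ pos pd])
    show "energy w = ?M * norm2 w"
      unfolding n2 energy_def pG using energy_max_pos by simp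
    show "(w has_real_derivative - q t * prim w t / ?M) (at t)" if "t \<in> {0<..<L}" for t
      unfolding pG by (rule w(2)[OF that])
  qed
qed

end

section \<open>Density of continuous functions\<close>

text \<open>A continuous cutoff between 0 and 1, supported at distance \<open>L / (n + 3)\<close>
  from the ends. The 3 leaves a nondegenerate support \<open>[L / 3, 2 * L / 3]\<close> for
  \<open>n = 0\<close>, and the slope \<open>n + 1\<close> makes the cutoffs tend to 1
  inside.\<close>

definition tent :: "real \<Rightarrow> nat \<Rightarrow> real \<Rightarrow> real" where
  "tent L n x = max 0 (min 1 (real (n + 1) * min (x - L / (real n + 3)) (L - L / (real n + 3) - x)))"

lemma tent_bounds: "0 \<le> tent L n x" "tent L n x \<le> 1"
  by (auto simp: tent_def)

lemma tent_continuous: "continuous_on UNIV (tent L n)"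
  unfolding tent_def by (intro continuous_intros)

lemma tent_outside:
  assumes "x \<notin> {L / (real n + 3)..L - L / (real n + 3)}" shows "tent L n x = 0"
proof -
  have "min (x - L / (real n + 3)) (L - L / (real n + 3) - x) \<le> 0" using assms by auto
  then have "real (n + 1) * min (x - L / (real n + 3)) (L - L / (real n + 3) - x) \<le> 0"
    by (rule mult_nonneg_nonpos[rotated]) simp
  then show ?thesis unfolding tent_def by linarith
qed

lemma tent_support:
  assumes "0 < L" "x \<notin> {0<..<L}" shows "tent L n x = 0"
proof (rule tent_outside, rule notI)
  assume "x \<in> {L / (real n + 3)..L - L / (real n + 3)}"
  moreover have "0 < L / (real n + 3)" using assms by simp
  ultimately show False using assms(2) by auto
qed

lemma tent_tendsto:
  assumes "x \<in> {0<..<L}" shows "(\<lambda>n. tent L n x) \<longlonglongrightarrow> 1"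
proof -
  have s: "(\<lambda>n. L / (real n + 3)) \<longlonglongrightarrow> 0" by real_asymp
  have m: "(\<lambda>n. min (x - L / (real n + 3)) (L - L / (real n + 3) - x)) \<longlonglongrightarrow> min (x - 0) (L - 0 - x)"
    by (intro tendsto_intros s)
  have p: "0 < min (x - 0) (L - 0 - x)" using assms by simp
  have "filterlim (\<lambda>n. min (x - L / (real n + 3)) (L - L / (real n + 3) - x) * real (n + 1)) at_top sequentially"
    by (rule filterlim_tendsto_pos_mult_at_top[OF m p]) real_asymp
  then have "eventually (\<lambda>n. 1 \<le> min (x - L / (real n + 3)) (L - L / (real n + 3) - x) * real (n + 1)) sequentially"
    by (simp add: filterlim_at_top)
  then have "eventually (\<lambda>n. tent L n x = 1) sequentially"
    by eventually_elim (simp add: tent_def mult.commute)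
  then show ?thesis by (rule tendsto_eventually)
qed

text \<open>Lebesgue measurability in the sense of \<open>measurable_on\<close> means being a limit
  of continuous functions off a negligible set. That set is enclosed in a Borel null set to obtain a
  statement about \<open>lborel\<close>.\<close>

lemma borel_measurable_ae_limit_continuous:
  fixes w :: "real \<Rightarrow> real"
  assumes "w \<in> borel_measurable borel"
  obtains g where "\<And>n::nat. continuous_on UNIV (g n)" "AE x in lborel. (\<lambda>n. g n x) \<longlonglongrightarrow> w x"
proof -
  have "w \<in> borel_measurable lebesgue" using assms by (simp add: measurable_completion)
  then have "w measurable_on UNIV" by (intro lebesgue_measurable_imp_measurable_on) auto
  then obtain N g where N: "negligible N" and g: "\<And>n. continuous_on UNIV (g n)" "\<And>x. x \<notin> N \<Longrightarrow> (\<lambda>n. g n x) \<longlonglongrightarrow> w x"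
    unfolding measurable_on_def by auto
  from N have "N \<in> null_sets lebesgue" by (simp add: negligible_iff_null_sets)
  then obtain N' where "N' \<in> null_sets lborel" "N \<subseteq> N'" by (auto simp: null_sets_completion_iff2)
  then have "AE x in lborel. (\<lambda>n. g n x) \<longlonglongrightarrow> w x"
    using AE_not_in[of N' lborel] by (auto elim!: eventually_mono intro: g(2))
  with g(1) that show ?thesis by blast
qed

lemma square_sum_le: "(a + b)\<^sup>2 \<le> 2 * a\<^sup>2 + 2 * b\<^sup>2" for a b :: real
  using sum_squares_bound[of a b] by (simp add: power2_sum)

lemma square_integrable_diff:
  fixes f g :: "'a \<Rightarrow> real"
  assumes [measurable]: "f \<in> borel_measurable M" "g \<in> borel_measurable M"
    and "integrable M (\<lambda>x. (f x)\<^sup>2)" "integrable M (\<lambda>x. (g x)\<^sup>2)"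
  shows "integrable M (\<lambda>x. (f x - g x)\<^sup>2)"
  using integrable_add_square(1)[OF assms, of "-1"] by simp

lemma square_distance_triangle:
  fixes f g h :: "'a \<Rightarrow> real"
  assumes [measurable]: "f \<in> borel_measurable M" "g \<in> borel_measurable M" "h \<in> borel_measurable M"
    and i: "integrable M (\<lambda>x. (f x)\<^sup>2)" "integrable M (\<lambda>x. (g x)\<^sup>2)" "integrable M (\<lambda>x. (h x)\<^sup>2)"
  shows "(LINT x|M. (f x - h x)\<^sup>2) \<le> 2 * (LINT x|M. (f x - g x)\<^sup>2) + 2 * (LINT x|M. (g x - h x)\<^sup>2)"
proof -
  note fg = square_integrable_diff[OF assms(1,2) i(1,2)]
  note gh = square_integrable_diff[OF assms(2,3) i(2,3)]
  note fh = square_integrable_diff[OF assms(1,3) i(1,3)]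
  have "(LINT x|M. (f x - h x)\<^sup>2) \<le> (LINT x|M. 2 * (f x - g x)\<^sup>2 + 2 * (g x - h x)\<^sup>2)"
  proof (rule Bochner_Integration.integral_mono[OF fh])
    show "integrable M (\<lambda>x. 2 * (f x - g x)\<^sup>2 + 2 * (g x - h x)\<^sup>2)" using fg gh by simp
    show "(f x - h x)\<^sup>2 \<le> 2 * (f x - g x)\<^sup>2 + 2 * (g x - h x)\<^sup>2" for x
      using square_sum_le[of "f x - g x" "g x - h x"] by simp
  qed
  also have "\<dots> = 2 * (LINT x|M. (f x - g x)\<^sup>2) + 2 * (LINT x|M. (g x - h x)\<^sup>2)"
    using fg gh by simp
  finally show ?thesis .
qed

lemma integral_square_less:
  fixes h :: "nat \<Rightarrow> real \<Rightarrow> real"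
  assumes "(\<lambda>n. LINT x|lborel. (h n x)\<^sup>2) \<longlonglongrightarrow> 0" "0 < e"
  obtains n where "(LINT x|lborel. (h n x)\<^sup>2) < e"
proof -
  have "eventually (\<lambda>n. (LINT x|lborel. (h n x)\<^sup>2) < e) sequentially"
    by (rule order_tendstoD(2)[OF assms])
  then show ?thesis using that by (auto simp: eventually_sequentially)
qed

lemma bounded_square_integrable:
  fixes h :: "real \<Rightarrow> real"
  assumes [measurable]: "h \<in> borel_measurable borel" and "\<And>x. \<bar>h x\<bar> \<le> c" "\<And>x. x \<notin> {a<..<b} \<Longrightarrow> h x = 0"
  shows "integrable lborel (\<lambda>x. (h x)\<^sup>2)"
proof (rule Bochner_Integration.integrable_bound[of _ "\<lambda>x. indicator {a<..<b} x * c\<^sup>2"])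
  show "AE x in lborel. norm ((h x)\<^sup>2) \<le> norm (indicator {a<..<b} x * c\<^sup>2)"
  proof (rule AE_I2)
    fix x
    have "\<bar>h x\<bar>\<^sup>2 \<le> c\<^sup>2" using assms(2)[of x] by (intro power_mono) auto
    then show "norm ((h x)\<^sup>2) \<le> norm (indicator {a<..<b} x * c\<^sup>2)"
      using assms(3)[of x] by (cases "x \<in> {a<..<b}") auto
  qed
qed auto

text \<open>Two dominated convergences. Cutting off in space by \<open>tent\<close> and in height by
  \<open>?clip\<close> changes \<open>w\<close> little; inside a fixed cutoff \<open>w\<close> can
  then be replaced by continuous functions converging almost everywhere, since the cutoff supplies
  the majorant.\<close>

lemma L2_continuous_approx:
  fixes w :: "real \<Rightarrow> real"
  assumes L: "0 < L" and w: "w \<in> borel_measurable borel" "integrable lborel (\<lambda>x. (w x)\<^sup>2)"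
    and w0: "\<And>x. x \<notin> {0<..<L} \<Longrightarrow> w x = 0" and e: "0 < e"
  obtains f n where "continuous_on UNIV f" "\<And>x. x \<notin> {L / (real n + 3)..L - L / (real n + 3)} \<Longrightarrow> f x = 0"
    "integrable lborel (\<lambda>x. (f x)\<^sup>2)" "(LINT x|lborel. (w x - f x)\<^sup>2) < e"
proof -
  note [measurable] = w(1)
  let ?clip = "\<lambda>n y. max (- real n) (min (real n) y)"
  have [measurable]: "tent L n \<in> borel_measurable borel" for n
    by (intro borel_measurable_continuous_onI tent_continuous)
  have cl: "\<bar>?clip n y\<bar> \<le> \<bar>y\<bar>" "\<bar>?clip n y\<bar> \<le> real n" for n y by auto
  have tc: "\<bar>tent L n x * ?clip n y\<bar> \<le> real n" "\<bar>tent L n x * ?clip n y\<bar> \<le> \<bar>y\<bar>" for n x y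
  proof -
    have "\<bar>tent L n x * ?clip n y\<bar> = tent L n x * \<bar>?clip n y\<bar>"
      using tent_bounds(1)[of L n x] by (simp add: abs_mult)
    also have "\<dots> \<le> 1 * \<bar>?clip n y\<bar>" by (intro mult_right_mono tent_bounds) simp
    finally show "\<bar>tent L n x * ?clip n y\<bar> \<le> real n" "\<bar>tent L n x * ?clip n y\<bar> \<le> \<bar>y\<bar>"
      using cl[of n y] by linarith+
  qed
  have lim1: "(\<lambda>n. LINT x|lborel. (w x - tent L n x * ?clip n (w x))\<^sup>2) \<longlonglongrightarrow> (LINT x::real|lborel. 0)"
  proof (rule integral_dominated_convergence[where w="\<lambda>x. 4 * (w x)\<^sup>2"])
    show "AE x in lborel. (\<lambda>n. (w x - tent L n x * ?clip n (w x))\<^sup>2) \<longlonglongrightarrow> 0"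
    proof (rule AE_I2)
      fix x
      have c: "(\<lambda>n. ?clip n (w x)) \<longlonglongrightarrow> w x"
      proof (rule tendsto_eventually)
        show "eventually (\<lambda>n. ?clip n (w x) = w x) sequentially"
          using eventually_ge_at_top[of "nat \<lceil>\<bar>w x\<bar>\<rceil>"]
        proof eventually_elim
          case (elim n)
          then have "\<bar>w x\<bar> \<le> real n" by linarith
          then show ?case by auto
        qed
      qed
      show "(\<lambda>n. (w x - tent L n x * ?clip n (w x))\<^sup>2) \<longlonglongrightarrow> 0"
      proof (cases "x \<in> {0<..<L}")
        case True
        have "(\<lambda>n. (w x - tent L n x * ?clip n (w x))\<^sup>2) \<longlonglongrightarrow> (w x - 1 * w x)\<^sup>2"
          by (intro tendsto_intros c tent_tendsto True)
        then show ?thesis by simp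
      next
        case False
        then show ?thesis using w0[OF False] by simp
      qed
    qed
    show "AE x in lborel. norm ((w x - tent L n x * ?clip n (w x))\<^sup>2) \<le> 4 * (w x)\<^sup>2" for n
    proof (rule AE_I2)
      fix x
      have "\<bar>w x - tent L n x * ?clip n (w x)\<bar> \<le> 2 * \<bar>w x\<bar>" using tc(2)[of n x "w x"] by linarith
      then have "\<bar>w x - tent L n x * ?clip n (w x)\<bar>\<^sup>2 \<le> (2 * \<bar>w x\<bar>)\<^sup>2" by (intro power_mono) auto
      then show "norm ((w x - tent L n x * ?clip n (w x))\<^sup>2) \<le> 4 * (w x)\<^sup>2"
        by (simp add: power_mult_distrib)
    qed
  qed (use w in auto)
  \<comment> \<open>Each of the two errors is allowed \<open>e / 4\<close> because
    \<open>square_distance_triangle\<close> doubles them both.\<close>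
  then obtain n where n: "(LINT x|lborel. (w x - tent L n x * ?clip n (w x))\<^sup>2) < e / 4"
    using integral_square_less[of "\<lambda>n x. w x - tent L n x * ?clip n (w x)" "e / 4"] e by auto
  obtain g where g: "\<And>k::nat. continuous_on UNIV (g k)" "AE x in lborel. (\<lambda>k. g k x) \<longlonglongrightarrow> w x"
    using borel_measurable_ae_limit_continuous[OF w(1)] by blast
  have [measurable]: "g k \<in> borel_measurable borel" for k by (intro borel_measurable_continuous_onI g)
  have lim2: "(\<lambda>k. LINT x|lborel. (tent L n x * ?clip n (w x) - tent L n x * ?clip n (g k x))\<^sup>2) \<longlonglongrightarrow> (LINT x::real|lborel. 0)"
  proof (rule integral_dominated_convergence[where w="\<lambda>x. indicator {0<..<L} x * (2 * real n)\<^sup>2"])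
    show "AE x in lborel. (\<lambda>k. (tent L n x * ?clip n (w x) - tent L n x * ?clip n (g k x))\<^sup>2) \<longlonglongrightarrow> 0"
      using g(2)
    proof eventually_elim
      case (elim x)
      have "(\<lambda>k. (tent L n x * ?clip n (w x) - tent L n x * ?clip n (g k x))\<^sup>2)
         \<longlonglongrightarrow> (tent L n x * ?clip n (w x) - tent L n x * ?clip n (w x))\<^sup>2"
        by (intro tendsto_intros elim)
      then show ?case by simp
    qed
    show "AE x in lborel. norm ((tent L n x * ?clip n (w x) - tent L n x * ?clip n (g k x))\<^sup>2)
      \<le> indicator {0<..<L} x * (2 * real n)\<^sup>2" for k
    proof (rule AE_I2)
      fix x
      define y where "y = tent L n x * ?clip n (w x)"
      define z where "z = tent L n x * ?clip n (g k x)"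
      have "\<bar>y\<bar> \<le> real n" "\<bar>z\<bar> \<le> real n" unfolding y_def z_def by (rule tc)+
      then have "\<bar>y - z\<bar> \<le> 2 * real n" by linarith
      then have "\<bar>y - z\<bar>\<^sup>2 \<le> (2 * real n)\<^sup>2" by (intro power_mono) auto
      moreover have "y = 0" "z = 0" if "x \<notin> {0<..<L}"
        using tent_support[OF L that] by (simp_all add: y_def z_def)
      ultimately show "norm ((tent L n x * ?clip n (w x) - tent L n x * ?clip n (g k x))\<^sup>2)
        \<le> indicator {0<..<L} x * (2 * real n)\<^sup>2"
        unfolding y_def[symmetric] z_def[symmetric] by (cases "x \<in> {0<..<L}") auto
    qed
  qed auto
  then obtain k where k: "(LINT x|lborel. (tent L n x * ?clip n (w x) - tent L n x * ?clip n (g k x))\<^sup>2) < e / 4"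
    using integral_square_less[of "\<lambda>k x. tent L n x * ?clip n (w x) - tent L n x * ?clip n (g k x)" "e / 4"] e by auto
  let ?f = "\<lambda>x. tent L n x * ?clip n (g k x)"
  have i: "integrable lborel (\<lambda>x. (tent L n x * ?clip n (h x))\<^sup>2)" if [measurable]: "h \<in> borel_measurable borel" for h
    by (rule bounded_square_integrable[of _ "real n" 0 L]) (measurable, use tc tent_support[OF L] in auto)
  have "(LINT x|lborel. (w x - ?f x)\<^sup>2) \<le> 2 * (LINT x|lborel. (w x - tent L n x * ?clip n (w x))\<^sup>2)
     + 2 * (LINT x|lborel. (tent L n x * ?clip n (w x) - ?f x)\<^sup>2)"
    by (rule square_distance_triangle) (measurable, use w i in auto)
  also have "\<dots> < e" using n k by linarith
  finally have "(LINT x|lborel. (w x - ?f x)\<^sup>2) < e" .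
  moreover have "continuous_on UNIV ?f"
    by (intro continuous_intros tent_continuous g)
  moreover have "?f x = 0" if "x \<notin> {L / (real n + 3)..L - L / (real n + 3)}" for x
    using tent_outside[of x L n] that by simp
  moreover have "integrable lborel (\<lambda>x. (?f x)\<^sup>2)" by (rule i) simp
  ultimately show ?thesis using that[of ?f n] by blast
qed

text \<open>The approximation \<open>f\<close> need not have mean zero, so its mean \<open>c\<close>
  times a fixed bump \<open>b\<close> of integral 1 is subtracted. As \<open>w\<close> has mean
  zero, \<open>c\<close> is controlled by the error itself, and the correction is as small as the
  error.\<close>

lemma L20_continuous_approx:
  assumes L: "0 < L" and w: "L20 L w" and e: "0 < e"
  obtains f a b where "0 < a" "a \<le> b" "b < L" "continuous_on UNIV f" "\<And>x. x \<notin> {a..b} \<Longrightarrow> f x = 0"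
    "L20 L f" "(LINT x|lborel. (w x - f x)\<^sup>2) < e"
proof -
  define I where "I = (LINT x|lborel. tent L 0 x)"
  have tm [measurable]: "tent L 0 \<in> borel_measurable borel"
    by (intro borel_measurable_continuous_onI tent_continuous)
  have t2: "integrable lborel (\<lambda>x. (tent L 0 x)\<^sup>2)"
    by (rule bounded_square_integrable[of _ 1 0 L]) (use tent_bounds tent_support[OF L] in auto)
  have t1: "integrable lborel (tent L 0)"
    by (rule integrable_of_square_on_Ioo[OF tm t2, of 0 L]) (use tent_support[OF L] in auto)
  have I: "0 < I"
  proof (rule ccontr)
    assume "\<not> 0 < I"
    moreover have "0 \<le> I" unfolding I_def by (intro Bochner_Integration.integral_nonneg tent_bounds)
    ultimately have "I = 0" by simp
    then have "AE x in lborel. tent L 0 x = 0"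
      unfolding I_def by (subst (asm) integral_nonneg_eq_0_iff_AE[OF t1]) (auto simp: tent_bounds)
    then have "AE x in lborel. x \<notin> {L/3<..<L - L/3}"
      by eventually_elim (auto simp: tent_def min_def max_def split: if_splits)
    then have "emeasure lborel {L/3<..<L - L/3} = 0"
      by (subst (asm) AE_iff_measurable[of "{L/3<..<L - L/3}"]) auto
    with L show False by simp
  qed
  define b where "b x = tent L 0 x / I" for x
  have bm [measurable]: "b \<in> borel_measurable borel" unfolding b_def by measurable
  have b2: "integrable lborel (\<lambda>x. (b x)\<^sup>2)" using t2 by (simp add: b_def power_divide)
  have bi: "integrable lborel b" "(LINT x|lborel. b x) = 1"
    using t1 I by (auto simp: b_def[abs_def] I_def)
  define K where "K = (LINT x|lborel. (b x)\<^sup>2)"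
  have K: "0 \<le> K" by (simp add: K_def)
  \<comment> \<open>Subtracting \<open>c * b\<close> enlarges the squared error by at most the
    factor \<open>2 + 2 * L * K\<close>, since \<open>c^2\<close> is at most \<open>L\<close> times
    the squared error.\<close>
  define e' where "e' = e / (2 + 2 * L * K)"
  have d: "0 < 2 + 2 * L * K" using L K by (simp add: add_pos_nonneg)
  have e': "0 < e'" using e d by (simp add: e'_def)
  obtain f n where f: "continuous_on UNIV f" "\<And>x. x \<notin> {L / (real n + 3)..L - L / (real n + 3)} \<Longrightarrow> f x = 0"
    "integrable lborel (\<lambda>x. (f x)\<^sup>2)" "(LINT x|lborel. (w x - f x)\<^sup>2) < e'"
    using L2_continuous_approx[OF L L20_measurable[OF w] L20_square[OF w] L20_outside[OF w] e'] by blast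
  have ln: "0 < L / (real n + 3)" "L / (real n + 3) \<le> L / 3" using L by (auto simp: field_simps)
  have f0: "f x = 0" if "x \<notin> {0<..<L}" for x
    by (rule f(2)) (use that ln in auto)
  note wm [measurable] = L20_measurable[OF w]
  have fm [measurable]: "f \<in> borel_measurable borel" by (rule borel_measurable_continuous_onI[OF f(1)])
  have fi: "integrable lborel f"
    by (rule integrable_of_square_on_Ioo[OF fm f(3) f0])
  define c where "c = (LINT x|lborel. f x)"
  have wf: "integrable lborel (\<lambda>x. (f x - w x)\<^sup>2)"
    by (rule square_integrable_diff) (use f L20_square[OF w] in auto)
  have "c = (LINT x|lborel. indicator {0<..<L} x * (f x - w x))"
  proof -
    have "c = (LINT x|lborel. f x - w x)"
      using fi L20_integrable[OF w] L20_mean[OF w] by (simp add: c_def)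
    also have "\<dots> = (LINT x|lborel. indicator {0<..<L} x * (f x - w x))"
    proof (rule Bochner_Integration.integral_cong[OF refl])
      fix x show "f x - w x = indicator {0<..<L} x * (f x - w x)"
        using f0[of x] L20_outside[OF w, of x] by (cases "x \<in> {0<..<L}") simp_all
    qed
    finally show ?thesis .
  qed
  also have "\<dots>\<^sup>2 \<le> (LINT x|lborel. (indicator {0<..<L} x)\<^sup>2) * (LINT x|lborel. (f x - w x)\<^sup>2)"
    by (rule Cauchy_Schwarz_integral) (use wf in \<open>auto simp: indicator_square\<close>)
  also have "\<dots> = L * (LINT x|lborel. (w x - f x)\<^sup>2)"
    using L by (simp add: indicator_square power2_commute)
  finally have c2: "c\<^sup>2 \<le> L * (LINT x|lborel. (w x - f x)\<^sup>2)" .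
  let ?h = "\<lambda>x. f x + (- c) * b x"
  have hi: "integrable lborel (\<lambda>x. (?h x)\<^sup>2)"
    by (rule integrable_add_square) (use f b2 in auto)
  have "(LINT x|lborel. (w x - ?h x)\<^sup>2) \<le> 2 * (LINT x|lborel. (w x - f x)\<^sup>2) + 2 * (LINT x|lborel. (f x - ?h x)\<^sup>2)"
    by (rule square_distance_triangle) (use f hi L20_square[OF w] in auto)
  also have "(\<lambda>x. (f x - ?h x)\<^sup>2) = (\<lambda>x. c\<^sup>2 * (b x)\<^sup>2)" by (simp add: power_mult_distrib)
  also have "(LINT x|lborel. c\<^sup>2 * (b x)\<^sup>2) = c\<^sup>2 * K" by (simp add: K_def)
  also have "2 * (LINT x|lborel. (w x - f x)\<^sup>2) + 2 * (c\<^sup>2 * K)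
    \<le> 2 * (LINT x|lborel. (w x - f x)\<^sup>2) + 2 * (L * (LINT x|lborel. (w x - f x)\<^sup>2) * K)"
    using c2 K by (intro add_left_mono mult_left_mono mult_right_mono) auto
  also have "\<dots> = (2 + 2 * L * K) * (LINT x|lborel. (w x - f x)\<^sup>2)" by (simp add: algebra_simps)
  also have "\<dots> < (2 + 2 * L * K) * e'" using f(4) d by (intro mult_strict_left_mono)
  also have "\<dots> = e" using d by (simp add: e'_def)
  finally have less: "(LINT x|lborel. (w x - ?h x)\<^sup>2) < e" .
  have h0: "?h x = 0" if "x \<notin> {L / (real n + 3)..L - L / (real n + 3)}" for x
  proof -
    \<comment> \<open>The bump is built from \<open>tent L 0\<close>, whose support is contained in
      the support interval for every \<open>n\<close>.\<close>
    have "x \<notin> {L / (real 0 + 3)..L - L / (real 0 + 3)}"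
      using that ln unfolding atLeastAtMost_iff of_nat_0 add_0 by linarith
    then have "tent L 0 x = 0" by (rule tent_outside)
    with f(2)[OF that] show ?thesis by (simp add: b_def)
  qed
  have hc: "continuous_on UNIV ?h"
    unfolding b_def using I by (intro continuous_intros f tent_continuous) auto
  have mean: "(LINT x|lborel. ?h x) = 0" using fi bi by (simp add: c_def)
  have out: "?h x = 0" if "x \<notin> {0<..<L}" for x by (rule h0) (use that ln in auto)
  have hm: "?h \<in> borel_measurable borel" by measurable
  have h20: "L20 L ?h" unfolding L20_def by (intro conjI allI impI hm hi mean out)
  have "L / (real n + 3) \<le> L - L / (real n + 3)" using ln L by (simp only: le_diff_eq)
  moreover have "L - L / (real n + 3) < L" using ln by simp
  ultimately show ?thesis
    by (rule that[OF ln(1) _ _ hc h0 h20 less])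
qed

section \<open>The Gaussian distribution function and its weight\<close>

definition Phi :: "real \<Rightarrow> real" where "Phi = prim std_normal_density"

text \<open>The value 0 outside the open unit interval is a convention that makes the function Borel
  measurable on the whole line.\<close>

definition Phi_inv :: "real \<Rightarrow> real" where "Phi_inv t = (if t \<in> {0<..<1} then inv Phi t else 0)"

text \<open>The Gaussian isoperimetric function. It satisfies \<open>profile' = - Phi_inv\<close>
  and \<open>Phi_inv' = 1 / profile\<close>, from which all its properties below follow.\<close>

definition profile :: "real \<Rightarrow> real" where "profile t = std_normal_density (Phi_inv t)"

lemma std_normal_density_deriv: "(std_normal_density has_real_derivative - x * std_normal_density x) (at x)"
proof -
  define c where "c = 1 / sqrt (2 * pi)"
  have eq: "std_normal_density = (\<lambda>x. c * exp (- x\<^sup>2 / 2))"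
    by (simp add: fun_eq_iff std_normal_density_def c_def)
  show ?thesis unfolding eq by (auto intro!: derivative_eq_intros)
qed

lemma std_normal_density_pos: "0 < std_normal_density x"
  by (rule normal_density_pos) simp

lemma std_normal_density_continuous: "continuous_on S std_normal_density"
  by (intro continuous_at_imp_continuous_on ballI DERIV_isCont[OF std_normal_density_deriv])

lemma std_normal_density_minus: "std_normal_density (- x) = std_normal_density x"
  by (simp add: normal_density_def)

lemma std_normal_density_less_1: "std_normal_density x < 1"
proof -
  have "1 < sqrt (2 * pi)" using pi_gt3 by simp
  then have "1 / sqrt (2 * pi) < 1" by simp
  moreover have "1 / sqrt (2 * pi) * exp (- x\<^sup>2 / 2) \<le> 1 / sqrt (2 * pi) * 1" by (intro mult_left_mono) auto
  ultimately show ?thesis unfolding std_normal_density_def by linarith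
qed

lemma Phi_deriv: "(Phi has_real_derivative std_normal_density x) (at x)"
  unfolding Phi_def
  by (rule prim_has_real_derivative[OF _ open_UNIV std_normal_density_continuous]) auto

lemma Phi_strict_mono: "strict_mono Phi"
proof (rule strict_monoI)
  fix x y :: real assume "x < y"
  then show "Phi x < Phi y" by (rule DERIV_pos_imp_increasing) (use Phi_deriv std_normal_density_pos in blast)
qed

lemma Phi_less_iff: "Phi x < Phi y \<longleftrightarrow> x < y"
  by (rule strict_mono_less[OF Phi_strict_mono])

lemma Phi_continuous: "continuous_on S Phi"
  by (intro continuous_at_imp_continuous_on ballI DERIV_isCont[OF Phi_deriv])

lemma gauss_eq: "gauss = std_normal_distribution"
  by (simp add: gauss_def)

lemma real_distribution_gauss: "real_distribution gauss"
  unfolding gauss_eq by (rule real_dist_normal_dist)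

text \<open>Supplies the limits of the distribution function and the representation of the measure
  as the image of Lebesgue measure on the unit interval.\<close>

interpretation gauss: cdf_distribution gauss
  unfolding cdf_distribution_def by (rule real_distribution_gauss)

lemma LINT_gauss:
  fixes f :: "real \<Rightarrow> real"
  assumes "f \<in> borel_measurable borel"
  shows "(LINT x|gauss. f x) = (LINT x|lborel. std_normal_density x * f x)"
    and "integrable gauss f \<longleftrightarrow> integrable lborel (\<lambda>x. std_normal_density x * f x)"
  using assms unfolding gauss_def by (auto simp: integral_density integrable_density)

lemma cdf_gauss: "cdf gauss = Phi"
proof
  fix x
  have "cdf gauss x = (LINT y|gauss. indicator {..x} y)"
    unfolding cdf_def by simp
  also have "\<dots> = Phi x" unfolding Phi_def prim_def by (subst LINT_gauss) (auto simp: mult.commute)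
  finally show "cdf gauss x = Phi x" .
qed

lemma Phi_at_bot: "(Phi \<longlongrightarrow> 0) at_bot" and Phi_at_top: "(Phi \<longlongrightarrow> 1) at_top"
  using gauss.cdf_lim_at_bot gauss.cdf_lim_at_top_prob by (simp_all add: cdf_gauss)

lemma Phi_range: "0 < Phi x" "Phi x < 1"
proof -
  have "0 \<le> Phi (x - 1)" using gauss.cdf_nonneg[of "x - 1"] by (simp add: cdf_gauss)
  also have "\<dots> < Phi x" by (simp add: Phi_less_iff)
  finally show "0 < Phi x" .
  have "Phi x < Phi (x + 1)" by (simp add: Phi_less_iff)
  also have "\<dots> \<le> 1" using gauss.cdf_bounded_prob[of "x + 1"] by (simp add: cdf_gauss)
  finally show "Phi x < 1" .
qed

lemma Phi_inj: "inj Phi" by (rule strict_mono_imp_inj_on[OF Phi_strict_mono])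

lemma Phi_inv_Phi: "Phi_inv (Phi x) = x" using Phi_range[of x] by (simp add: Phi_inv_def inv_f_f[OF Phi_inj])

lemma Phi_surj:
  assumes "t \<in> {0<..<1}" obtains x where "Phi x = t"
proof -
  have "eventually (\<lambda>x. Phi x < t) at_bot" using order_tendstoD(2)[OF Phi_at_bot, of t] assms by simp
  then obtain a where a: "Phi a < t" using eventually_happens'[OF trivial_limit_at_bot_linorder] by blast
  have "eventually (\<lambda>x. t < Phi x) at_top" using order_tendstoD(1)[OF Phi_at_top, of t] assms by simp
  then obtain b where b: "t < Phi b" using eventually_happens'[OF trivial_limit_at_top_linorder] by blast
  have "a \<le> b" using a b Phi_less_iff[of a b] by simp
  then obtain x where "Phi x = t"
    using IVT'[of Phi a t b] a b Phi_continuous by force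
  then show ?thesis by (rule that)
qed

lemma Phi_Phi_inv: "t \<in> {0<..<1} \<Longrightarrow> Phi (Phi_inv t) = t"
  by (metis Phi_surj Phi_inv_Phi)

lemma Phi_inv_less_iff: "t \<in> {0<..<1} \<Longrightarrow> Phi_inv t < x \<longleftrightarrow> t < Phi x"
  "t \<in> {0<..<1} \<Longrightarrow> x < Phi_inv t \<longleftrightarrow> Phi x < t"
  by (metis Phi_Phi_inv Phi_less_iff)+

lemma Phi_minus: "Phi (- x) = 1 - Phi x"
proof -
  let ?g = std_normal_density
  have gi: "integrable lborel ?g" by simp
  have "Phi (- x) = (LINT r|lborel. indicator {..- x} r * ?g r)" by (simp add: Phi_def prim_def)
  also have "\<dots> = (LINT r|lborel. indicator {..- x} (0 + (-1) * r) * ?g (0 + (-1) * r))"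
    by (subst lborel_integral_real_affine[of "-1" _ 0]) auto
  also have "\<dots> = (LINT r|lborel. ?g r - indicator {..x} r * ?g r)"
    by (rule integral_cong_AE)
       (measurable, use AE_lborel_singleton[of x] in \<open>eventually_elim, auto simp: indicator_def std_normal_density_minus\<close>)
  also have "\<dots> = 1 - Phi x"
    unfolding Phi_def prim_def using prim_integrable[OF gi, of x] by simp
  finally show ?thesis .
qed

lemma Phi_inv_minus: "t \<in> {0<..<1} \<Longrightarrow> Phi_inv (1 - t) = - Phi_inv t"
  by (metis Phi_Phi_inv Phi_minus Phi_inv_Phi)

lemma profile_pos: "0 < profile t" by (simp add: profile_def std_normal_density_pos)

lemma profile_less_1: "profile t < 1" by (simp add: profile_def std_normal_density_less_1)

lemma profile_symmetric: "t \<in> {0<..<1} \<Longrightarrow> profile (1 - t) = profile t"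
  by (simp add: profile_def Phi_inv_minus std_normal_density_minus)

lemma Phi_inv_deriv:
  assumes t: "t \<in> {0<..<1}" shows "(Phi_inv has_real_derivative 1 / profile t) (at t)"
proof -
  have "(Phi_inv has_real_derivative inverse (std_normal_density (Phi_inv t))) (at t)"
  proof (rule DERIV_inverse_function[where f=Phi and a=0 and b=1])
    show "(Phi has_real_derivative std_normal_density (Phi_inv t)) (at (Phi_inv t))" by (rule Phi_deriv)
    show "isCont Phi_inv t"
    proof -
      have "isCont Phi_inv (Phi (Phi_inv t))"
        by (rule isCont_inverse_function[of 1]) (auto simp: Phi_inv_Phi DERIV_isCont[OF Phi_deriv])
      then show ?thesis by (simp add: Phi_Phi_inv[OF t])
    qed
  qed (use t Phi_Phi_inv normal_density_pos[of 1 0 "Phi_inv t"] in auto)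
  then show ?thesis by (simp add: profile_def divide_inverse)
qed

lemma profile_deriv:
  assumes t: "t \<in> {0<..<1}" shows "(profile has_real_derivative - Phi_inv t) (at t)"
proof -
  have "(profile has_real_derivative - Phi_inv t * std_normal_density (Phi_inv t) * (1 / profile t)) (at t)"
    unfolding profile_def[abs_def] by (rule DERIV_chain2[OF std_normal_density_deriv Phi_inv_deriv[OF t, unfolded profile_def]])
  then show ?thesis using profile_pos[of t] by (simp add: profile_def)
qed

lemma Phi_inv_continuous: "continuous_on {0<..<1} Phi_inv"
  by (intro continuous_at_imp_continuous_on ballI DERIV_isCont[OF Phi_inv_deriv])

lemma Phi_inv_measurable [measurable]: "Phi_inv \<in> borel_measurable borel"
proof -
  have "(\<lambda>x. indicator {0<..<1} x *\<^sub>R Phi_inv x) \<in> borel_measurable borel"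
    by (rule borel_measurable_continuous_on_indicator[OF _ Phi_inv_continuous]) simp
  also have "(\<lambda>x. indicator {0<..<1} x *\<^sub>R Phi_inv x) = Phi_inv" by (auto simp: Phi_inv_def indicator_def)
  finally show ?thesis .
qed

lemma profile_measurable [measurable]: "profile \<in> borel_measurable borel"
  unfolding profile_def[abs_def] by measurable

lemma profile_continuous: "continuous_on {0<..<1} profile"
  by (intro continuous_at_imp_continuous_on ballI DERIV_isCont[OF profile_deriv])

lemma Phi_inv_at_right_0: "filterlim Phi_inv at_bot (at_right 0)"
  unfolding filterlim_at_bot
proof
  fix Z :: real
  have "eventually (\<lambda>t::real. t \<in> {0<..<min 1 (Phi Z)}) (at_right 0)"
    using Phi_range[of Z] by (intro eventually_at_right_real) auto
  then show "eventually (\<lambda>t. Phi_inv t \<le> Z) (at_right 0)"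
  proof eventually_elim
    case (elim t)
    then have "Phi_inv t < Z" by (subst Phi_inv_less_iff) auto
    then show ?case by simp
  qed
qed

lemma profile_at_right_0: "(profile \<longlongrightarrow> 0) (at_right 0)"
proof -
  have "(std_normal_density \<longlongrightarrow> 0) at_bot" unfolding normal_density_def by real_asymp
  from filterlim_compose[OF this Phi_inv_at_right_0] show ?thesis by (simp add: profile_def[abs_def])
qed

text \<open>L'Hospital: the denominator has derivative \<open>- Phi_inv t\<close>, which tends to
  infinity at 0. The square of this quotient is the quantity that has to vanish for the weight to be
  weaker than Hardy's.\<close>

lemma t_over_profile: "((\<lambda>t. t / profile t) \<longlongrightarrow> 0) (at_right 0)"
proof (rule lhopital_right_0[where f'="\<lambda>_. 1" and g'="\<lambda>t. - Phi_inv t"])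
  have neg: "\<forall>\<^sub>F t in at_right 0. Phi_inv t \<le> - 1" using Phi_inv_at_right_0 unfolding filterlim_at_bot by blast
  show "\<forall>\<^sub>F t in at_right 0. - Phi_inv t \<noteq> 0" using neg by eventually_elim auto
  show "\<forall>\<^sub>F t in at_right 0. profile t \<noteq> 0" using profile_pos by (intro always_eventually allI) (simp add: less_imp_neq[symmetric])
  have "\<forall>\<^sub>F t in at_right (0::real). t \<in> {0<..<1}" by (rule eventually_at_right_real) simp
  then show "\<forall>\<^sub>F t in at_right 0. (profile has_real_derivative - Phi_inv t) (at t)"
    by eventually_elim (rule profile_deriv)
  have "filterlim (\<lambda>t. - Phi_inv t) at_top (at_right 0)"
    using Phi_inv_at_right_0 by (simp add: filterlim_uminus_at_top)
  then show "((\<lambda>t. 1 / - Phi_inv t) \<longlongrightarrow> 0) (at_right 0)"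
    using tendsto_inverse_0_at_top by (simp only: inverse_eq_divide[symmetric]) 
qed (use profile_at_right_0 in auto)

text \<open>The cutoff to the unit interval makes the symmetry
  \<open>weight (1 - t) = weight t\<close> valid for every real \<open>t\<close>.\<close>

definition weight :: "real \<Rightarrow> real" where
  "weight t = indicator {0<..<1} t / (profile t)\<^sup>2"

lemma weight_eq: "t \<in> {0<..<1} \<Longrightarrow> weight t = 1 / (profile t)\<^sup>2" by (simp add: weight_def)

lemma weight_continuous: "continuous_on {0<..<1} weight"
  by (rule continuous_on_eq[of _ "\<lambda>t. 1 / (profile t)\<^sup>2"])
     (use profile_pos in \<open>auto intro!: continuous_intros profile_continuous simp: weight_eq less_imp_neq[symmetric]\<close>)

lemma weight_pos: "t \<in> {0<..<1} \<Longrightarrow> 0 < weight t" using profile_pos[of t] by (simp add: weight_eq)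

lemma weight_symmetric: "weight (1 - t) = weight t"
  using profile_symmetric[of t] by (auto simp: weight_def indicator_def)

lemma weight_measurable [measurable]: "weight \<in> borel_measurable borel"
proof -
  have "(\<lambda>x. indicator {0<..<1} x *\<^sub>R weight x) \<in> borel_measurable borel"
    by (rule borel_measurable_continuous_on_indicator[OF _ weight_continuous]) simp
  also have "(\<lambda>x. indicator {0<..<1} x *\<^sub>R weight x) = weight" by (auto simp: weight_def indicator_def)
  finally show ?thesis .
qed

lemma weight_shift_limit:
  assumes "0 \<le> s" "s < 1" shows "((\<lambda>t. t\<^sup>2 * weight (s + t)) \<longlongrightarrow> 0) (at_right 0)"
proof (cases "s = 0")
  case True
  have "((\<lambda>t. (t / profile t)\<^sup>2) \<longlongrightarrow> 0\<^sup>2) (at_right 0)" by (intro tendsto_power t_over_profile)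
  then have "((\<lambda>t. (t / profile t)\<^sup>2) \<longlongrightarrow> 0) (at_right 0)" by simp
  moreover have "\<forall>\<^sub>F t in at_right 0. t\<^sup>2 * weight (s + t) = (t / profile t)\<^sup>2"
  proof -
    have "\<forall>\<^sub>F t in at_right (0::real). t \<in> {0<..<1}" by (rule eventually_at_right_real) simp
    then show ?thesis by eventually_elim (simp add: weight_eq True power_divide)
  qed
  ultimately show ?thesis by (simp add: tendsto_cong)
next
  case False
  then have "isCont weight s"
    using weight_continuous assms by (simp add: continuous_on_eq_continuous_at)
  then have "(weight \<longlongrightarrow> weight s) (at s)" by (simp add: isCont_def)
  then have "((\<lambda>t. weight (s + t)) \<longlongrightarrow> weight s) (at 0)" by (simp add: LIM_offset_zero_iff)
  then have "((\<lambda>t. weight (s + t)) \<longlongrightarrow> weight s) (at_right 0)" by (rule tendsto_within_subset) simp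
  then have "((\<lambda>t. t\<^sup>2 * weight (s + t)) \<longlongrightarrow> 0\<^sup>2 * weight s) (at_right 0)" by (intro tendsto_intros)
  then show ?thesis by simp
qed

lemma hardy_weight_shift:
  assumes L: "0 < L" and s: "0 \<le> s" "s + L \<le> 1"
  shows "hardy_weight L (\<lambda>t. weight (s + t))"
proof
  show "continuous_on {0<..<L} (\<lambda>t. weight (s + t))"
    by (rule continuous_on_compose2[OF weight_continuous]) (use s in \<open>auto intro!: continuous_intros\<close>)
  show "0 < weight (s + t)" if "t \<in> {0<..<L}" for t by (rule weight_pos) (use that s in auto)
  show "((\<lambda>t. t\<^sup>2 * weight (s + t)) \<longlongrightarrow> 0) (at_right 0)" by (rule weight_shift_limit) (use s L in auto)
  \<comment> \<open>Reflection about 1/2 exchanges the two ends: the right end for the shift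
    \<open>s\<close> is the left end for the shift \<open>1 - s - L\<close>.\<close>
  have "((\<lambda>t. t\<^sup>2 * weight ((1 - s - L) + t)) \<longlongrightarrow> 0) (at_right 0)" by (rule weight_shift_limit) (use s L in auto)
  also have "(\<lambda>t. t\<^sup>2 * weight ((1 - s - L) + t)) = (\<lambda>t. t\<^sup>2 * weight (s + (L - t)))"
  proof
    fix t
    have "weight ((1 - s - L) + t) = weight (1 - (s + (L - t)))" by (rule arg_cong[where f=weight]) simp
    then show "t\<^sup>2 * weight ((1 - s - L) + t) = t\<^sup>2 * weight (s + (L - t))" by (simp only: weight_symmetric)
  qed
  finally show "((\<lambda>t. (L - t)\<^sup>2 * weight (s + t)) \<longlongrightarrow> 0) (at_left L)"
    by (simp add: at_left_reflect filterlim_filtermap)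
qed (use L in auto)

text \<open>The second derivative \<open>(2 + 6 * x^2) / profile^4\<close> with
  \<open>x = Phi_inv t\<close> is at least 2 because \<open>profile\<close> is below 1. Hence
  \<open>h\<close>, the weight minus the square of \<open>t\<close>, is still convex, and strictness
  comes from the square.\<close>

lemma weight_strictly_convex:
  assumes "x \<in> {0<..<1}" "y \<in> {0<..<1}" "x \<noteq> y" "0 < c" "c < 1"
  shows "weight (c * x + (1 - c) * y) < c * weight x + (1 - c) * weight y"
proof -
  define h where "h t = 1 / (profile t)\<^sup>2 - t\<^sup>2" for t
  have nz: "profile t \<noteq> 0" for t using profile_pos[of t] by simp
  have "convex_on {0<..<1} h"
  proof (rule f''_ge0_imp_convex)
    show "(h has_real_derivative 2 * Phi_inv t / profile t ^ 3 - 2 * t) (at t)" if "t \<in> {0<..<1}" for t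
      unfolding h_def using nz[of t]
      by (auto intro!: derivative_eq_intros profile_deriv[OF that] simp: field_simps power2_eq_square power3_eq_cube)
    show "((\<lambda>t. 2 * Phi_inv t / profile t ^ 3 - 2 * t) has_real_derivative (2 + 6 * (Phi_inv t)\<^sup>2) / profile t ^ 4 - 2) (at t)"
      if "t \<in> {0<..<1}" for t
      using nz[of t]
      by (auto intro!: derivative_eq_intros profile_deriv[OF that] Phi_inv_deriv[OF that] simp: field_simps power2_eq_square power3_eq_cube power4_eq_xxxx)
    show "0 \<le> (2 + 6 * (Phi_inv t)\<^sup>2) / profile t ^ 4 - 2" if "t \<in> {0<..<1}" for t
    proof -
      have "profile t ^ 4 \<le> 1" using profile_pos[of t] profile_less_1[of t] by (intro power_le_one) auto
      then have "2 * profile t ^ 4 \<le> 2 + 6 * (Phi_inv t)\<^sup>2" using zero_le_power2[of "Phi_inv t"] by linarith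
      then have "2 \<le> (2 + 6 * (Phi_inv t)\<^sup>2) / profile t ^ 4" using profile_pos[of t] by (simp add: le_divide_eq)
      then show ?thesis by simp
    qed
  qed simp
  then have "h ((1 - (1 - c)) *\<^sub>R x + (1 - c) *\<^sub>R y) \<le> (1 - (1 - c)) * h x + (1 - c) * h y"
    using assms by (intro convex_onD) auto
  then have le: "h (c * x + (1 - c) * y) \<le> c * h x + (1 - c) * h y" by simp
  have "0 < c * (1 - c) * (x - y)\<^sup>2" using assms by simp
  also have "\<dots> = c * x\<^sup>2 + (1 - c) * y\<^sup>2 - (c * x + (1 - c) * y)\<^sup>2"
    by (simp add: power2_eq_square algebra_simps)
  finally have sq: "(c * x + (1 - c) * y)\<^sup>2 < c * x\<^sup>2 + (1 - c) * y\<^sup>2" by simp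
  have m: "c * x + (1 - c) * y \<in> {0<..<1}"
  proof -
    have "0 < c * x + (1 - c) * y" using assms by (intro add_pos_pos mult_pos_pos) auto
    moreover have "c * x + (1 - c) * y < c * 1 + (1 - c) * 1"
      using assms by (intro add_strict_mono mult_strict_left_mono) auto
    ultimately show ?thesis by simp
  qed
  have p: "weight t = h t + t\<^sup>2" if "t \<in> {0<..<1}" for t by (simp add: weight_eq[OF that] h_def)
  have "weight (c * x + (1 - c) * y) < (c * h x + (1 - c) * h y) + (c * x\<^sup>2 + (1 - c) * y\<^sup>2)"
    unfolding p[OF m] using le sq by simp
  also have "\<dots> = c * weight x + (1 - c) * weight y"
    unfolding p[OF assms(1)] p[OF assms(2)] by (simp add: algebra_simps)
  finally show ?thesis .
qed

section \<open>Transforming the Gaussian Rayleigh quotient\<close>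

lemma distr_Phi_inv: "distr (restrict_space lborel {0<..<1}) borel Phi_inv = gauss"
proof -
  have "distr (restrict_space lborel {0<..<1}) borel Phi_inv
    = distr (restrict_space lborel {0<..<1}) borel (\<lambda>\<omega>. Inf {x. \<omega> \<le> cdf gauss x})"
  proof (rule distr_cong[OF refl refl])
    fix t :: real assume "t \<in> space (restrict_space lborel {0<..<1})"
    then have t: "t \<in> {0<..<1}" by (simp add: space_restrict_space)
    \<comment> \<open>The generalized inverse in the quantile representation is an infimum; since
      \<open>Phi\<close> is a strictly increasing bijection onto the unit interval, it is the
      ordinary inverse.\<close>
    have "{x. t \<le> cdf gauss x} = {Phi_inv t..}"
      unfolding cdf_gauss atLeast_def by (metis Phi_inv_less_iff(2)[OF t] not_less)
    then show "Phi_inv t = Inf {x. t \<le> cdf gauss x}" by simp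
  qed
  then show ?thesis using gauss.distr_I_eq_M by simp
qed

lemma gauss_quantile_transform:
  fixes f :: "real \<Rightarrow> real"
  assumes [measurable]: "f \<in> borel_measurable borel"
  shows "(LINT x|gauss. f x) = (LINT t|lborel. indicator {0<..<1} t * f (Phi_inv t))"
    and "integrable gauss f \<longleftrightarrow> integrable lborel (\<lambda>t. indicator {0<..<1} t * f (Phi_inv t))"
proof -
  have [measurable]: "Phi_inv \<in> measurable (restrict_space lborel {0<..<1}) borel"
    by (rule measurable_restrict_space1) simp
  have "(LINT x|gauss. f x) = (LINT t|restrict_space lborel {0<..<1}. f (Phi_inv t))"
    by (subst distr_Phi_inv[symmetric], rule integral_distr) measurable
  also have "\<dots> = (LINT t|lborel. indicator {0<..<1} t * f (Phi_inv t))"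
    by (subst integral_restrict_space) auto
  finally show "(LINT x|gauss. f x) = (LINT t|lborel. indicator {0<..<1} t * f (Phi_inv t))" .
  have "integrable gauss f \<longleftrightarrow> integrable (restrict_space lborel {0<..<1}) (\<lambda>t. f (Phi_inv t))"
    by (subst distr_Phi_inv[symmetric], rule integrable_distr_eq) measurable
  also have "\<dots> \<longleftrightarrow> integrable lborel (\<lambda>t. indicator {0<..<1} t * f (Phi_inv t))"
    by (subst integrable_restrict_space) auto
  finally show "integrable gauss f \<longleftrightarrow> integrable lborel (\<lambda>t. indicator {0<..<1} t * f (Phi_inv t))" .
qed

text \<open>Extends the inverse of \<open>Phi\<close> to the closed unit interval, so that the two
  half-lines of mass \<open>L\<close> appear as the ordinary parameters \<open>s = 0\<close> and
  \<open>s = 1 - L\<close>.\<close>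

definition quantile :: "real \<Rightarrow> ereal" where
  "quantile s = (if s \<le> 0 then -\<infinity> else if 1 \<le> s then \<infinity> else ereal (Phi_inv s))"

lemma einterval_quantile: "einterval (quantile s) (quantile s') = {x. s < Phi x \<and> Phi x < s'}"
proof -
  have "quantile s < ereal x \<longleftrightarrow> s < Phi x" for x
    using Phi_range[of x] Phi_inv_less_iff(1)[of s x] by (auto simp: quantile_def)
  moreover have "ereal x < quantile s' \<longleftrightarrow> Phi x < s'" for x
    using Phi_range[of x] Phi_inv_less_iff(2)[of s' x] by (auto simp: quantile_def)
  ultimately show ?thesis by (auto simp: einterval_def)
qed

text \<open>Local integrability speaks only of compact subsets, and \<open>u\<close> is arbitrary
  outside the interval. Exhausting the interval by compact ones presents the truncated function as a
  limit of measurable functions.\<close>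

lemma locally_integrable_on_measurable:
  assumes u: "locally_integrable_on u (einterval a b)" and ab: "a < b"
  shows "(\<lambda>x. indicator (einterval a b) x * u x :: real) \<in> borel_measurable borel"
proof -
  obtain r l where approx: "einterval a b = (\<Union>i. {l i .. r i})" "incseq r" "decseq l"
    "\<And>i. l i < r i" "\<And>i. a < l i" "\<And>i. r i < b" "(\<lambda>x. ereal (l x)) \<longlonglongrightarrow> a" "(\<lambda>x. ereal (r x)) \<longlonglongrightarrow> b"
    by (blast intro: einterval_Icc_approximation[OF ab])
  have m: "(\<lambda>x. indicator {l i..r i} x * u x) \<in> borel_measurable borel" for i
  proof -
    have "{l i..r i} \<subseteq> einterval a b" using approx(1) by blast
    then have "set_integrable lborel {l i..r i} u" using u by (auto simp: locally_integrable_on_def)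
    then show ?thesis unfolding set_integrable_def by (auto dest: borel_measurable_integrable)
  qed
  show ?thesis
  proof (rule borel_measurable_LIMSEQ_real[OF _ m])
    fix x
    show "(\<lambda>i. indicator {l i..r i} x * u x) \<longlonglongrightarrow> indicator (einterval a b) x * u x"
    proof (cases "x \<in> einterval a b")
      case True
      then obtain i where i: "x \<in> {l i..r i}" using approx(1) by blast
      have "x \<in> {l j..r j}" if "i \<le> j" for j
        using i incseqD[OF approx(2) that] decseqD[OF approx(3) that] by auto
      then have "eventually (\<lambda>j. indicator {l j..r j} x * u x = indicator (einterval a b) x * u x) sequentially"
        using True by (intro eventually_sequentiallyI[of i]) simp
      then show ?thesis by (rule tendsto_eventually)
    next
      case False
      then have "x \<notin> {l i..r i}" for i using approx(1) by blast
      with False show ?thesis by simp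
    qed
  qed
qed

text \<open>An interval of mass \<open>L\<close> is parametrized by the mass \<open>s\<close> lying
  to its left; equality in either bound on \<open>s\<close> means an infinite endpoint.\<close>

locale gauss_strip =
  fixes L s :: real
  assumes L: "0 < L" and s: "0 \<le> s" "s + L \<le> 1"

sublocale gauss_strip \<subseteq> hardy_weight L "\<lambda>t. weight (s + t)"
  by (rule hardy_weight_shift[OF L s])

context gauss_strip
begin

abbreviation "strip \<equiv> einterval (quantile s) (quantile (s + L))"

lemma strip_eq: "strip = {x. s < Phi x \<and> Phi x < s + L}"
  by (rule einterval_quantile)

lemma mem_strip: "x \<in> strip \<longleftrightarrow> Phi x - s \<in> {0<..<L}"
  by (auto simp: strip_eq)

lemma Phi_inv_mem_strip: "t \<in> {0<..<L} \<Longrightarrow> Phi_inv (s + t) \<in> strip"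
  using s Phi_Phi_inv[of "s + t"] by (auto simp: strip_eq)

lemma Phi_Phi_inv_strip: "t \<in> {0<..<L} \<Longrightarrow> Phi (Phi_inv (s + t)) = s + t"
  using s by (intro Phi_Phi_inv) auto

lemma quantile_less: "quantile s < quantile (s + L)"
proof -
  have "L / 2 \<in> {0<..<L}" using L by simp
  from Phi_inv_mem_strip[OF this] have "quantile s < ereal (Phi_inv (s + L / 2))" "ereal (Phi_inv (s + L / 2)) < quantile (s + L)"
    by (auto simp: einterval_def)
  then show ?thesis by (rule less_trans)
qed

text \<open>The substitution \<open>x = Phi_inv (s + t)\<close> carries the Gaussian measure on the
  strip to Lebesgue measure on \<open>{0<..<L}\<close>. Measurability is asked of the truncated
  function only, since Sobolev functions are controlled only on the strip.\<close>

lemma strip_transform: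
  fixes f :: "real \<Rightarrow> real"
  assumes m: "(\<lambda>x. indicator strip x * f x) \<in> borel_measurable borel"
  shows "(LINT x:strip|gauss. f x) = (LINT t|lborel. indicator {0<..<L} t * f (Phi_inv (s + t)))"
    and "set_integrable gauss strip f \<longleftrightarrow> integrable lborel (\<lambda>t. indicator {0<..<L} t * f (Phi_inv (s + t)))"
    and "(\<lambda>t. indicator {0<..<L} t * f (Phi_inv (s + t))) \<in> borel_measurable borel"
proof -
  let ?h = "\<lambda>t. indicator {0<..<1} t * (indicator strip (Phi_inv t) * f (Phi_inv t))"
  have eq: "?h (s + 1 * t) = indicator {0<..<L} t * f (Phi_inv (s + t))" for t
  proof (cases "t \<in> {0<..<L}")
    case True
    then have "s + t \<in> {0<..<1}" using s by auto
    then show ?thesis using True Phi_inv_mem_strip[OF True] by simp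
  next
    case False
    have "s + t \<in> {0<..<1} \<Longrightarrow> Phi_inv (s + t) \<notin> strip"
      using False Phi_Phi_inv[of "s + t"] by (auto simp: strip_eq)
    with False show ?thesis by (auto simp: indicator_def)
  qed
  have "(LINT x:strip|gauss. f x) = (LINT t|lborel. ?h t)"
    unfolding set_lebesgue_integral_def using gauss_quantile_transform(1)[OF m] by simp
  also have "\<dots> = (LINT t|lborel. ?h (s + 1 * t))"
    by (subst lborel_integral_real_affine[of 1 _ s]) auto
  finally show "(LINT x:strip|gauss. f x) = (LINT t|lborel. indicator {0<..<L} t * f (Phi_inv (s + t)))"
    unfolding eq .
  have "set_integrable gauss strip f \<longleftrightarrow> integrable lborel ?h"
    unfolding set_integrable_def using gauss_quantile_transform(2)[OF m] by simp
  also have "\<dots> \<longleftrightarrow> integrable lborel (\<lambda>t. ?h (s + 1 * t))"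
    by (rule lborel_integrable_real_affine_iff[symmetric]) simp
  finally show "set_integrable gauss strip f \<longleftrightarrow> integrable lborel (\<lambda>t. indicator {0<..<L} t * f (Phi_inv (s + t)))"
    unfolding eq .
  have "(\<lambda>t. (\<lambda>x. indicator strip x * f x) (Phi_inv (s + t))) \<in> borel_measurable borel"
    by (rule measurable_compose[OF _ m]) measurable
  then have "(\<lambda>t. indicator {0<..<L} t * (indicator strip (Phi_inv (s + t)) * f (Phi_inv (s + t)))) \<in> borel_measurable borel"
    by measurable
  also have "(\<lambda>t. indicator {0<..<L} t * (indicator strip (Phi_inv (s + t)) * f (Phi_inv (s + t))))
    = (\<lambda>t. indicator {0<..<L} t * f (Phi_inv (s + t)))"
    using Phi_inv_mem_strip by (auto simp: indicator_def fun_eq_iff)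
  finally show "(\<lambda>t. indicator {0<..<L} t * f (Phi_inv (s + t))) \<in> borel_measurable borel" .
qed

lemma strip_density:
  fixes f :: "real \<Rightarrow> real"
  assumes "(\<lambda>x. indicator strip x * f x) \<in> borel_measurable borel"
  shows "(LINT x:strip|lborel. f x * std_normal_density x) = (LINT x:strip|gauss. f x)"
  unfolding set_lebesgue_integral_def
  using LINT_gauss(1)[OF assms] by (simp add: mult_ac)

text \<open>The weak derivative is tested only against \<open>\<phi>(x) = F(\<Phi>(x) - s)\<close>, where \<open>F\<close> is the primitive of a
  continuous function approximating \<open>u\<close> in the transformed variable.\<close>

lemma rayleigh_lower_bound:
  assumes H: "H1_gauss (quantile s) (quantile (s + L)) u u'"
    and mean: "(LINT x:strip|gauss. u x) = 0"
  shows "(LINT x:strip|gauss. (u x)\<^sup>2) \<le> energy_max * (LINT x:strip|gauss. (u' x)\<^sup>2)"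
proof -
  note m = locally_integrable_on_measurable[OF _ quantile_less]
  have um: "(\<lambda>x. indicator strip x * u x) \<in> borel_measurable borel"
    and u'm: "(\<lambda>x. indicator strip x * u' x) \<in> borel_measurable borel"
    using H by (auto simp: H1_gauss_def W11_loc_def intro!: m)
  have sq: "(\<lambda>x. indicator strip x * (f x)\<^sup>2) \<in> borel_measurable borel"
    if "(\<lambda>x. indicator strip x * f x) \<in> borel_measurable borel" for f :: "real \<Rightarrow> real"
  proof -
    have "(\<lambda>x. (indicator strip x * f x)\<^sup>2) \<in> borel_measurable borel" using that by measurable
    then show ?thesis by (simp add: power_mult_distrib indicator_square)
  qed
  define w where "w t = indicator {0<..<L} t * u (Phi_inv (s + t))" for t
  define v where "v t = indicator {0<..<L} t * u' (Phi_inv (s + t))" for t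
  have w2: "(w t)\<^sup>2 = indicator {0<..<L} t * (u (Phi_inv (s + t)))\<^sup>2" for t
    by (simp add: w_def power_mult_distrib indicator_square)
  have v2: "(v t)\<^sup>2 = indicator {0<..<L} t * (u' (Phi_inv (s + t)))\<^sup>2" for t
    by (simp add: v_def power_mult_distrib indicator_square)
  note tw = strip_transform[OF sq[OF um], folded w2]
  note tv = strip_transform[OF sq[OF u'm], folded v2]
  have wm [measurable]: "w \<in> borel_measurable borel" using strip_transform(3)[OF um] by (simp add: w_def[abs_def])
  have vm [measurable]: "v \<in> borel_measurable borel" using strip_transform(3)[OF u'm] by (simp add: v_def[abs_def])
  have wi: "integrable lborel (\<lambda>t. (w t)\<^sup>2)" using H tw(2) by (simp add: H1_gauss_def)
  have vi: "integrable lborel (\<lambda>t. (v t)\<^sup>2)" using H tv(2) by (simp add: H1_gauss_def)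
  have wmean: "(LINT t|lborel. w t) = 0" using strip_transform(1)[OF um, folded w_def] mean by simp
  have w20: "L20 L w"
    unfolding L20_def by (intro conjI allI impI wm wi wmean) (simp add: w_def)
  define N where "N = (LINT t|lborel. (w t)\<^sup>2)"
  define D where "D = (LINT t|lborel. (v t)\<^sup>2)"
  have N: "0 \<le> N" and D: "0 \<le> D" by (auto simp: N_def D_def)
  \<comment> \<open>The adjoint estimate on a dense class: the pairing of \<open>w\<close> with
    \<open>f\<close> is, up to sign, that of \<open>v\<close> with \<open>prim f / profile\<close>,
    and the squared norm of the latter is \<open>energy f\<close>. Letting \<open>f\<close> approach
    \<open>w\<close> then bounds the norm of \<open>w\<close> itself.\<close>
  have key: "(LINT t|lborel. w t * f t)\<^sup>2 \<le> D * (energy_max * norm2 f)"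
    if ab: "0 < a" "a \<le> b" "b < L" and fc: "continuous_on UNIV f" and f0: "\<And>x. x \<notin> {a..b} \<Longrightarrow> f x = 0"
      and f20: "L20 L f" for a b f
  proof -
    note [measurable] = L20_measurable[OF f20] L20_prim_measurable[OF f20]
    define \<phi> where "\<phi> x = prim f (Phi x - s)" for x
    define \<phi>' where "\<phi>' x = f (Phi x - s) * std_normal_density x" for x
    have d: "(\<phi> has_real_derivative \<phi>' x) (at x)" for x
      unfolding \<phi>_def \<phi>'_def
      by (rule DERIV_chain2[OF prim_has_real_derivative[OF L20_integrable[OF f20] open_UNIV fc UNIV_I]])
         (auto intro!: derivative_eq_intros Phi_deriv)
    have c: "continuous_on UNIV \<phi>'"
      unfolding \<phi>'_def
      by (intro continuous_intros continuous_on_compose2[OF fc] Phi_continuous std_normal_density_continuous) auto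
    have ts: "a + s \<in> {0<..<1}" "b + s \<in> {0<..<1}" using ab s by auto
    have K: "{Phi_inv (a + s)..Phi_inv (b + s)} \<subseteq> strip"
    proof
      fix x assume "x \<in> {Phi_inv (a + s)..Phi_inv (b + s)}"
      then have "\<not> x < Phi_inv (a + s)" "\<not> Phi_inv (b + s) < x" by auto
      then have "a + s \<le> Phi x" "Phi x \<le> b + s" using Phi_inv_less_iff(2)[OF ts(1)] Phi_inv_less_iff(1)[OF ts(2)] by auto
      then show "x \<in> strip" using ab by (auto simp: strip_eq)
    qed
    \<comment> \<open>To the right of the support of \<open>f\<close> its primitive equals its full
      integral; this is where mean zero of \<open>f\<close> makes \<phi> an admissible test
      function.\<close>
    have out: "\<phi> x = 0" if "x \<notin> {Phi_inv (a + s)..Phi_inv (b + s)}" for x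
    proof -
      from that consider "x < Phi_inv (a + s)" | "Phi_inv (b + s) < x" by fastforce
      then show ?thesis
      proof cases
        case 1
        then have "Phi x - s < a" using Phi_inv_less_iff(2)[OF ts(1)] by simp
        then show ?thesis unfolding \<phi>_def prim_def
          by (intro integral_eq_zero_AE) (use f0 in \<open>auto simp: indicator_def\<close>)
      next
        case 2
        then have "b < Phi x - s" using Phi_inv_less_iff(1)[OF ts(2)] by simp
        then have "prim f (Phi x - s) = (LINT t|lborel. f t)"
          unfolding prim_def
          by (intro Bochner_Integration.integral_cong) (use f0 in \<open>auto simp: indicator_def\<close>)
        then show ?thesis using L20_mean[OF f20] by (simp add: \<phi>_def)
      qed
    qed
    have weak: "(LINT x:strip|lborel. u x * \<phi>' x) = - (LINT x:strip|lborel. u' x * \<phi> x)"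
    proof -
      have "\<exists>K. compact K \<and> K \<subseteq> strip \<and> (\<forall>x. x \<notin> K \<longrightarrow> \<phi> x = 0)"
        by (rule exI[of _ "{Phi_inv (a + s)..Phi_inv (b + s)}"]) (use K out in auto)
      with H d c show ?thesis unfolding H1_gauss_def W11_loc_def by blast
    qed
    have Pm [measurable]: "Phi \<in> borel_measurable borel"
      by (rule borel_measurable_continuous_onI[OF Phi_continuous])
    have m1: "(\<lambda>x. indicator strip x * (u x * f (Phi x - s))) \<in> borel_measurable borel"
      using borel_measurable_times[OF um, of "\<lambda>x. f (Phi x - s)"] by (simp add: mult_ac)
    have m2: "(\<lambda>x. indicator strip x * (u' x * \<phi> x / std_normal_density x)) \<in> borel_measurable borel"
      using borel_measurable_times[OF u'm, of "\<lambda>x. \<phi> x / std_normal_density x"] unfolding \<phi>_def by (simp add: mult_ac)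
    have "(LINT x:strip|lborel. u x * \<phi>' x) = (LINT x:strip|lborel. (u x * f (Phi x - s)) * std_normal_density x)"
      by (simp add: \<phi>'_def mult_ac)
    also have "\<dots> = (LINT t|lborel. w t * f t)"
      unfolding strip_density[OF m1] strip_transform(1)[OF m1]
      by (rule Bochner_Integration.integral_cong) (auto simp: w_def indicator_def Phi_Phi_inv_strip)
    finally have e1: "(LINT x:strip|lborel. u x * \<phi>' x) = (LINT t|lborel. w t * f t)" .
    \<comment> \<open>One factor \<open>std_normal_density\<close> is spent on turning Lebesgue into
      Gaussian measure, which puts \<open>profile\<close> into the denominator; squaring
      \<open>r\<close> therefore produces \<open>weight\<close>.\<close>
    define r where "r t = prim f t / profile (s + t)" for t
    have rm [measurable]: "r \<in> borel_measurable borel" unfolding r_def by measurable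
    have "(LINT x:strip|lborel. u' x * \<phi> x) = (LINT x:strip|lborel. (u' x * \<phi> x / std_normal_density x) * std_normal_density x)"
      using std_normal_density_pos by (simp add: less_imp_neq[symmetric])
    also have "\<dots> = (LINT t|lborel. v t * r t)"
      unfolding strip_density[OF m2] strip_transform(1)[OF m2]
      by (rule Bochner_Integration.integral_cong) (auto simp: v_def r_def \<phi>_def profile_def indicator_def Phi_Phi_inv_strip)
    finally have e2: "(LINT x:strip|lborel. u' x * \<phi> x) = (LINT t|lborel. v t * r t)" .
    have r2: "(r t)\<^sup>2 = weight (s + t) * (prim f t)\<^sup>2" for t
    proof (cases "t \<in> {0<..<L}")
      case True
      then have "s + t \<in> {0<..<1}" using s by auto
      then show ?thesis by (simp add: r_def weight_eq power_divide)
    next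
      case False
      then show ?thesis using prim_outside[OF f20 False] by (simp add: r_def)
    qed
    have "(LINT t|lborel. w t * f t)\<^sup>2 = (LINT t|lborel. v t * r t)\<^sup>2"
      using weak unfolding e1 e2 by simp
    also have "\<dots> \<le> D * (LINT t|lborel. (r t)\<^sup>2)"
      unfolding D_def by (rule Cauchy_Schwarz_integral) (use vi energy_integrable[OF f20] in \<open>auto simp: r2\<close>)
    also have "(LINT t|lborel. (r t)\<^sup>2) = energy f" by (simp add: r2 energy_def)
    also have "D * energy f \<le> D * (energy_max * norm2 f)" by (intro mult_left_mono energy_le[OF f20] D)
    finally show ?thesis .
  qed
  let ?P = "\<lambda>n f. L20 L f \<and> (LINT x|lborel. (w x - f x)\<^sup>2) < 1 / real (Suc n) \<and>
      (LINT t|lborel. w t * f t)\<^sup>2 \<le> D * (energy_max * norm2 f)"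
  have "\<forall>n. \<exists>f. ?P n f"
  proof
    fix n
    have pos: "0 < 1 / real (Suc n)" by simp
    show "\<exists>f. ?P n f"
    proof (rule L20_continuous_approx[OF L w20 pos])
      fix f a b
      assume ab: "0 < a" "a \<le> b" "b < L" and fc: "continuous_on UNIV f"
        and f0: "\<And>x. x \<notin> {a..b} \<Longrightarrow> f x = 0" and f20: "L20 L f"
        and less: "(LINT x|lborel. (w x - f x)\<^sup>2) < 1 / real (Suc n)"
      show "\<exists>f. ?P n f" by (intro exI[of _ f] conjI f20 less key[OF ab fc f0 f20])
    qed
  qed
  from choice[OF this] obtain f where "\<forall>n. ?P n (f n)" by (rule exE)
  then have f: "\<And>n. L20 L (f n)" "\<And>n. (LINT x|lborel. (w x - f n x)\<^sup>2) < 1 / real (Suc n)"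
    "\<And>n. (LINT t|lborel. w t * f n t)\<^sup>2 \<le> D * (energy_max * norm2 (f n))" by simp_all
  define e where "e n = (LINT x|lborel. (w x - f n x)\<^sup>2)" for n
  define c where "c n = (LINT x|lborel. w x * (w x - f n x))" for n
  have elim: "e \<longlonglongrightarrow> 0"
  proof (rule real_tendsto_sandwich[where f="\<lambda>_. 0" and h="\<lambda>n. 1 / real (Suc n)"])
    show "(\<lambda>n. 1 / real (Suc n)) \<longlonglongrightarrow> 0" using LIMSEQ_inverse_real_of_nat by (simp add: inverse_eq_divide)
    show "\<forall>\<^sub>F n in sequentially. e n \<le> 1 / real (Suc n)"
      using f(2) by (intro always_eventually allI) (simp add: e_def less_imp_le)
  qed (auto simp: e_def)
  have L2: "integrable lborel (\<lambda>x. (w x - f n x)\<^sup>2)" "(\<lambda>x. w x - f n x) \<in> borel_measurable borel" for n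
    using L20_square[OF f(1)[of n]] L20_measurable[OF f(1)[of n]] by (auto intro!: square_integrable_diff wi)
  have c2: "(c n)\<^sup>2 \<le> N * e n" for n
    unfolding c_def N_def e_def by (rule Cauchy_Schwarz_integral) (use L2 wi in auto)
  have clim: "c \<longlonglongrightarrow> 0"
  proof -
    have z: "(\<lambda>n. N * e n) \<longlonglongrightarrow> 0" using tendsto_mult_right_zero[OF elim] .
    have "(\<lambda>n. (c n)\<^sup>2) \<longlonglongrightarrow> 0"
      by (rule real_tendsto_sandwich[OF always_eventually always_eventually tendsto_const z])
         (intro allI zero_le_power2 c2)+
    then show ?thesis by (rule power_tendsto_0_iff[THEN iffD1, rotated]) simp
  qed
  have wd: "integrable lborel (\<lambda>x. w x * (w x - f n x))" for n
    by (rule integrable_mult_of_square) (use L2 wi in auto)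
  have wf: "(LINT t|lborel. w t * f n t) = N - c n" for n
  proof -
    have "(LINT t|lborel. w t * f n t) = (LINT t|lborel. (w t)\<^sup>2 - w t * (w t - f n t))"
      by (rule Bochner_Integration.integral_cong) (auto simp: power2_eq_square algebra_simps)
    also have "\<dots> = N - c n" using wi wd by (simp add: N_def c_def)
    finally show ?thesis .
  qed
  have nf: "norm2 (f n) = N - 2 * c n + e n" for n
  proof -
    have "norm2 (f n) = (LINT t|lborel. (w t)\<^sup>2 - 2 * (w t * (w t - f n t)) + (w t - f n t)\<^sup>2)"
      unfolding norm2_def by (rule Bochner_Integration.integral_cong) (auto simp: power2_eq_square algebra_simps)
    also have "\<dots> = N - 2 * c n + e n" using wi wd L2(1) by (simp add: N_def c_def e_def)
    finally show ?thesis .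
  qed
  have l1: "(\<lambda>n. (N - c n)\<^sup>2) \<longlonglongrightarrow> (N - 0)\<^sup>2" by (intro tendsto_intros clim)
  have l2: "(\<lambda>n. D * (energy_max * (N - 2 * c n + e n))) \<longlonglongrightarrow> D * (energy_max * (N - 2 * 0 + 0))"
    by (intro tendsto_intros clim elim)
  \<comment> \<open>In the limit the estimate reads \<open>N^2 \<le> D * energy_max * N\<close>, and
    one factor \<open>N\<close> is cancelled unless it is 0, where the claim is trivial.\<close>
  have "(N - 0)\<^sup>2 \<le> D * (energy_max * (N - 2 * 0 + 0))"
    by (rule LIMSEQ_le[OF l1 l2]) (use f(3) in \<open>auto simp: wf nf\<close>)
  then have "N * N \<le> N * (energy_max * D)" by (simp add: power2_eq_square mult_ac)
  then have "N \<le> energy_max * D"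
    using N D energy_max_pos by (cases "N = 0") auto
  then show ?thesis unfolding tw(1) tv(1) N_def D_def .
qed

end

section \<open>Classical derivatives as weak derivatives, and the minimizer\<close>

lemma continuous_on_locally_integrable: "continuous_on S u \<Longrightarrow> locally_integrable_on u S"
  unfolding locally_integrable_on_def set_integrable_def
  by (auto simp del: real_scaleR_def intro: borel_integrable_compact continuous_on_subset)

lemma compact_subset_einterval:
  assumes "compact K" "K \<noteq> {}" "K \<subseteq> einterval a b"
  obtains c d where "c < d" "{c..d} \<subseteq> einterval a b" "K \<subseteq> {c<..<d}"
proof -
  have in_ab: "Inf K \<in> einterval a b" "Sup K \<in> einterval a b"
    using assms closed_contains_Inf[of K] closed_contains_Sup[of K]
    by (auto simp: compact_imp_closed bounded_imp_bdd_below bounded_imp_bdd_above compact_imp_bounded)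
  obtain c where c: "a < ereal c" "ereal c < ereal (Inf K)"
    using in_ab ereal_dense2[of a "Inf K"] by (auto simp: einterval_def)
  obtain d where d: "ereal (Sup K) < ereal d" "ereal d < b"
    using in_ab ereal_dense2[of "Sup K" b] by (auto simp: einterval_def)
  have bnd: "Inf K \<le> x" "x \<le> Sup K" if "x \<in> K" for x
    using that compact_imp_bounded[OF assms(1)]
    by (auto intro: cInf_lower cSup_upper bounded_imp_bdd_below bounded_imp_bdd_above)
  have K: "K \<subseteq> {c<..<d}" using bnd c d by force
  moreover have "c < d" using assms(2) K by force
  moreover have "{c..d} \<subseteq> einterval a b"
  proof
    fix x assume "x \<in> {c..d}"
    then have "ereal c \<le> ereal x" "ereal x \<le> ereal d" by auto
    then show "x \<in> einterval a b"
      using less_le_trans[OF c(1)] le_less_trans[OF _ d(2)] by (simp add: einterval_def)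
  qed
  ultimately show ?thesis using that by blast
qed

text \<open>The fundamental theorem for \<open>u * \<phi>\<close> on a compact interval that
  contains the support of \<phi> in its interior, so that the boundary terms vanish. Both factors
  are continuously differentiable there.\<close>

lemma W11_loc_of_derivative:
  assumes u: "\<And>x. x \<in> einterval a b \<Longrightarrow> (u has_real_derivative u' x) (at x)"
    and u': "continuous_on (einterval a b) u'"
  shows "W11_loc (einterval a b) u u'"
proof -
  let ?S = "einterval a b"
  have uc: "continuous_on ?S u"
    by (intro continuous_at_imp_continuous_on ballI) (use u DERIV_isCont in blast)
  have weak: "(LINT x:?S|lborel. u x * \<phi>' x) = - (LINT x:?S|lborel. u' x * \<phi> x)"
    if d: "\<And>x. (\<phi> has_real_derivative \<phi>' x) (at x)" and c: "continuous_on UNIV \<phi>'"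
      and K: "compact K" "K \<subseteq> ?S" "\<And>x. x \<notin> K \<Longrightarrow> \<phi> x = 0" for \<phi> \<phi>' K
  proof (cases "K = {}")
    case True
    then have "\<phi> = (\<lambda>_. 0)" using K by auto
    then have "\<phi>' x = 0" for x using DERIV_unique[OF d[of x], of 0] by simp
    with \<open>\<phi> = (\<lambda>_. 0)\<close> show ?thesis by simp
  next
    case False
    then obtain c0 d0 where cd: "c0 < d0" "{c0..d0} \<subseteq> ?S" "K \<subseteq> {c0<..<d0}"
      using compact_subset_einterval[OF K(1) _ K(2)] by blast
    have KS: "x \<in> {c0..d0} \<and> x \<in> ?S" if "x \<in> K" for x
      using subsetD[OF cd(3) that] subsetD[OF K(2) that] by simp
    \<comment> \<open>The complement of \<open>K\<close> is open and \<phi> is constant on it, so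
      the derivative vanishes there too; thus both integrands vanish off \<open>K\<close>.\<close>
    have \<phi>'0: "\<phi>' x = 0" if "x \<notin> K" for x
    proof (rule DERIV_unique[OF d])
      have "open (- K)" using K(1) by (simp add: compact_imp_closed open_Compl)
      then show "(\<phi> has_real_derivative 0) (at x)"
        by (rule has_field_derivative_transform_within_open[OF DERIV_const[of 0]]) (use that K(3) in auto)
    qed
    have \<phi>c: "continuous_on UNIV \<phi>"
      by (intro continuous_at_imp_continuous_on ballI) (use d DERIV_isCont in blast)
    have i1: "integrable lborel (\<lambda>x. indicator {c0..d0} x *\<^sub>R (u x * \<phi>' x))"
      and i2: "integrable lborel (\<lambda>x. indicator {c0..d0} x *\<^sub>R (u' x * \<phi> x))"
      by (intro borel_integrable_compact continuous_on_mult continuous_on_subset[OF uc cd(2)]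
          continuous_on_subset[OF u' cd(2)] continuous_on_subset[OF c] continuous_on_subset[OF \<phi>c]; simp)+
    have "has_bochner_integral lborel (\<lambda>x. (u x * \<phi>' x + u' x * \<phi> x) * indicator {c0..d0} x)
      (u d0 * \<phi> d0 - u c0 * \<phi> c0)"
    proof (rule has_bochner_integral_FTC_Icc_real)
      fix x assume x: "c0 \<le> x" "x \<le> d0"
      then have xS: "x \<in> ?S" using cd(2) by auto
      show "((\<lambda>x. u x * \<phi> x) has_real_derivative u x * \<phi>' x + u' x * \<phi> x) (at x)"
        using DERIV_mult[OF u[OF xS] d[of x]] by (simp add: algebra_simps)
      have "isCont u' x" using u' xS by (simp add: continuous_on_eq_continuous_at)
      moreover have "isCont \<phi>' x" using c by (simp add: continuous_on_eq_continuous_at)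
      ultimately show "isCont (\<lambda>x. u x * \<phi>' x + u' x * \<phi> x) x"
        using DERIV_isCont[OF u[OF xS]] DERIV_isCont[OF d[of x]] by (intro continuous_intros)
    qed (use cd in simp)
    moreover have "c0 \<notin> K" "d0 \<notin> K"
      using cd(3) greaterThanLessThan_iff less_irrefl by blast+
    then have "\<phi> c0 = 0" "\<phi> d0 = 0" by (simp_all add: K(3))
    ultimately have "0 = (LINT x|lborel. (u x * \<phi>' x + u' x * \<phi> x) * indicator {c0..d0} x)"
      by (simp add: has_bochner_integral_iff)
    also have "\<dots> = (LINT x|lborel. indicator {c0..d0} x *\<^sub>R (u x * \<phi>' x) + indicator {c0..d0} x *\<^sub>R (u' x * \<phi> x))"
      by (rule Bochner_Integration.integral_cong) (auto simp: algebra_simps)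
    also have "\<dots> = (LINT x|lborel. indicator {c0..d0} x *\<^sub>R (u x * \<phi>' x)) + (LINT x|lborel. indicator {c0..d0} x *\<^sub>R (u' x * \<phi> x))"
      by (rule Bochner_Integration.integral_add[OF i1 i2])
    also have "(LINT x|lborel. indicator {c0..d0} x *\<^sub>R (u x * \<phi>' x)) = (LINT x:?S|lborel. u x * \<phi>' x)"
      unfolding set_lebesgue_integral_def
    proof (rule Bochner_Integration.integral_cong[OF refl])
      fix x
      show "indicator {c0..d0} x *\<^sub>R (u x * \<phi>' x) = indicator ?S x *\<^sub>R (u x * \<phi>' x)"
        using \<phi>'0[of x] KS[of x] by (cases "x \<in> K") simp_all
    qed
    also have "(LINT x|lborel. indicator {c0..d0} x *\<^sub>R (u' x * \<phi> x)) = (LINT x:?S|lborel. u' x * \<phi> x)"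
      unfolding set_lebesgue_integral_def
    proof (rule Bochner_Integration.integral_cong[OF refl])
      fix x
      show "indicator {c0..d0} x *\<^sub>R (u' x * \<phi> x) = indicator ?S x *\<^sub>R (u' x * \<phi> x)"
        using K(3)[of x] KS[of x] by (cases "x \<in> K") simp_all
    qed
    finally show ?thesis by simp
  qed
  show ?thesis
    unfolding W11_loc_def
  proof (intro conjI allI impI)
    show "locally_integrable_on u ?S" "locally_integrable_on u' ?S"
      by (intro continuous_on_locally_integrable uc u')+
  qed (use weak in blast)
qed

context gauss_strip
begin

lemma continuous_on_strip_measurable:
  "continuous_on strip f \<Longrightarrow> (\<lambda>x. indicator strip x * f x :: real) \<in> borel_measurable borel"
  using borel_measurable_continuous_on_indicator[of strip f] by simp

text \<open>The eigenfunction comes from \<open>w = W'\<close>, not from \<open>W\<close>: the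
  Euler-Lagrange equation expresses the derivative of \<open>w\<close> by \<open>W\<close>. After
  composition with \<open>Phi\<close> the Gaussian energy of \<open>u'\<close> is
  \<open>energy w / energy_max^2\<close>, which equals \<open>norm2 w / energy_max\<close>.\<close>

lemma minimizer:
  obtains u u' where "H1_gauss (quantile s) (quantile (s + L)) u u'" "(LINT x:strip|gauss. u x) = 0"
    "0 < (LINT x:strip|gauss. (u x)\<^sup>2)"
    "(LINT x:strip|gauss. (u' x)\<^sup>2) = (LINT x:strip|gauss. (u x)\<^sup>2) / energy_max"
proof -
  obtain w where w: "L20 L w" "energy w = energy_max * norm2 w" "0 < norm2 w"
    and dp: "\<And>t. t \<in> {0<..<L} \<Longrightarrow> (prim w has_real_derivative w t) (at t)"
    and dw: "\<And>t. t \<in> {0<..<L} \<Longrightarrow> (w has_real_derivative - weight (s + t) * prim w t / energy_max) (at t)"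
    using eigenfunction_exists by blast
  define u where "u x = w (Phi x - s)" for x
  define u' where "u' x = - prim w (Phi x - s) / (energy_max * std_normal_density x)" for x
  have du: "(u has_real_derivative u' x) (at x)" if x: "x \<in> strip" for x
  proof -
    have t: "Phi x - s \<in> {0<..<L}" using x by (simp add: mem_strip)
    have "(u has_real_derivative (- weight (s + (Phi x - s)) * prim w (Phi x - s) / energy_max) * std_normal_density x) (at x)"
      unfolding u_def
      by (rule DERIV_chain2[of w _ "\<lambda>x. Phi x - s", OF dw[OF t]]) (auto intro!: derivative_eq_intros Phi_deriv)
    also have "(- weight (s + (Phi x - s)) * prim w (Phi x - s) / energy_max) * std_normal_density x = u' x"
      using Phi_range[of x] std_normal_density_pos[of x] energy_max_pos
      by (simp add: u'_def weight_eq profile_def Phi_inv_Phi power2_eq_square)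
    finally show ?thesis .
  qed
  have cu: "continuous_on strip u"
    by (intro continuous_at_imp_continuous_on ballI) (use du DERIV_isCont in blast)
  have cu': "continuous_on strip u'"
    unfolding u'_def using energy_max_pos std_normal_density_pos
    by (intro continuous_intros continuous_on_compose2[OF L20_prim_continuous[OF w(1)]] Phi_continuous std_normal_density_continuous)
       (auto simp: less_imp_neq[symmetric])
  have eu: "indicator {0<..<L} t * u (Phi_inv (s + t)) = w t" for t
    using L20_outside[OF w(1), of t] Phi_Phi_inv_strip[of t] by (cases "t \<in> {0<..<L}") (auto simp: u_def)
  have eu2: "indicator {0<..<L} t * (u (Phi_inv (s + t)))\<^sup>2 = (w t)\<^sup>2" for t
    using L20_outside[OF w(1), of t] Phi_Phi_inv_strip[of t] by (cases "t \<in> {0<..<L}") (auto simp: u_def)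
  have eu'2: "indicator {0<..<L} t * (u' (Phi_inv (s + t)))\<^sup>2 = (1 / energy_max\<^sup>2) * (weight (s + t) * (prim w t)\<^sup>2)" for t
  proof (cases "t \<in> {0<..<L}")
    case True
    then have "s + t \<in> {0<..<1}" using s by auto
    with True show ?thesis using Phi_Phi_inv_strip[OF True]
      by (simp add: u'_def profile_def[symmetric] weight_eq power_divide power_mult_distrib)
  next
    case False
    then show ?thesis using prim_outside[OF w(1) False] by simp
  qed
  note tu = strip_transform[OF continuous_on_strip_measurable[OF cu], unfolded eu]
  note tu2 = strip_transform[OF continuous_on_strip_measurable[OF continuous_on_power[OF cu]], of 2, unfolded eu2]
  note tu'2 = strip_transform[OF continuous_on_strip_measurable[OF continuous_on_power[OF cu']], of 2, unfolded eu'2]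
  have n: "(LINT x:strip|gauss. (u x)\<^sup>2) = norm2 w" using tu2(1) by (simp add: norm2_def)
  have "(LINT x:strip|gauss. (u' x)\<^sup>2) = (1 / energy_max\<^sup>2) * energy w"
    unfolding tu'2(1) energy_def by (rule Bochner_Integration.integral_mult_right_zero)
  also have "\<dots> = norm2 w / energy_max" using energy_max_pos by (simp add: w(2) power2_eq_square)
  finally have n': "(LINT x:strip|gauss. (u' x)\<^sup>2) = norm2 w / energy_max" .
  show ?thesis
  proof (rule that[of u u'])
    show "H1_gauss (quantile s) (quantile (s + L)) u u'"
      unfolding H1_gauss_def using tu2(2) tu'2(2) L20_square[OF w(1)] energy_integrable[OF w(1)]
      by (intro conjI W11_loc_of_derivative du cu') (auto intro: integrable_mult_right)
    show "(LINT x:strip|gauss. u x) = 0" using tu(1) L20_mean[OF w(1)] by simp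
  qed (use n n' w(3) in auto)
qed

text \<open>Nontriviality in \<open>mu1\<close> refers to Lebesgue null sets, while the denominator
  is a Gaussian integral; positivity of the density makes the two agree.\<close>

lemma square_integral_zero_iff:
  assumes H: "H1_gauss (quantile s) (quantile (s + L)) u u'"
  shows "(LINT x:strip|gauss. (u x)\<^sup>2) = 0 \<longleftrightarrow> (AE x\<in>strip in lborel. u x = 0)"
proof -
  have um: "(\<lambda>x. indicator strip x * u x) \<in> borel_measurable borel"
    using H by (intro locally_integrable_on_measurable quantile_less) (auto simp: H1_gauss_def W11_loc_def)
  have eq: "indicator strip x *\<^sub>R (u x)\<^sup>2 = (indicator strip x * u x)\<^sup>2" for x
    by (simp add: power_mult_distrib indicator_square)
  have m2: "(\<lambda>x. (indicator strip x * u x)\<^sup>2) \<in> borel_measurable borel" using um by measurable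
  have i: "integrable gauss (\<lambda>x. (indicator strip x * u x)\<^sup>2)"
    using H unfolding H1_gauss_def set_integrable_def eq by simp
  then have i': "integrable lborel (\<lambda>x. std_normal_density x * (indicator strip x * u x)\<^sup>2)"
    using LINT_gauss(2)[OF m2] by simp
  have "(LINT x:strip|gauss. (u x)\<^sup>2) = (LINT x|lborel. std_normal_density x * (indicator strip x * u x)\<^sup>2)"
    unfolding set_lebesgue_integral_def eq by (rule LINT_gauss(1)[OF m2])
  also have "\<dots> = 0 \<longleftrightarrow> (AE x in lborel. std_normal_density x * (indicator strip x * u x)\<^sup>2 = 0)"
    by (rule integral_nonneg_eq_0_iff_AE[OF i']) (auto simp: less_imp_le[OF std_normal_density_pos])
  also have "\<dots> \<longleftrightarrow> (AE x\<in>strip in lborel. u x = 0)"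
    using std_normal_density_pos by (intro eventually_cong refl always_eventually) (auto simp: indicator_def less_imp_neq[symmetric])
  finally show ?thesis .
qed

lemma square_integral_nonneg: "0 \<le> (LINT x:strip|gauss. (u x :: real)\<^sup>2)"
  unfolding set_lebesgue_integral_def by (intro Bochner_Integration.integral_nonneg) simp

lemma mu1_eq: "mu1 (quantile s) (quantile (s + L)) = 1 / energy_max"
  unfolding mu1_def
proof (rule Least_equality)
  obtain u u' where u: "H1_gauss (quantile s) (quantile (s + L)) u u'" "(LINT x:strip|gauss. u x) = 0"
    "0 < (LINT x:strip|gauss. (u x)\<^sup>2)"
    "(LINT x:strip|gauss. (u' x)\<^sup>2) = (LINT x:strip|gauss. (u x)\<^sup>2) / energy_max"
    by (rule minimizer)
  show "\<exists>u u'. H1_gauss (quantile s) (quantile (s + L)) u u' \<and>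
     \<not> (AE x\<in>strip in lborel. u x = 0) \<and> (LINT x:strip|gauss. u x) = 0 \<and>
     1 / energy_max = (LINT x:strip|gauss. (u' x)\<^sup>2) / (LINT x:strip|gauss. (u x)\<^sup>2)"
  proof (intro exI conjI)
    show "\<not> (AE x\<in>strip in lborel. u x = 0)" using square_integral_zero_iff[OF u(1)] u(3) by simp
    show "1 / energy_max = (LINT x:strip|gauss. (u' x)\<^sup>2) / (LINT x:strip|gauss. (u x)\<^sup>2)"
      using u(3) unfolding u(4) by simp
  qed (use u in auto)
next
  fix y
  assume "\<exists>u u'. H1_gauss (quantile s) (quantile (s + L)) u u' \<and>
     \<not> (AE x\<in>strip in lborel. u x = 0) \<and> (LINT x:strip|gauss. u x) = 0 \<and>
     y = (LINT x:strip|gauss. (u' x)\<^sup>2) / (LINT x:strip|gauss. (u x)\<^sup>2)"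
  then obtain u u' where u: "H1_gauss (quantile s) (quantile (s + L)) u u'"
    "\<not> (AE x\<in>strip in lborel. u x = 0)" "(LINT x:strip|gauss. u x) = 0"
    and y: "y = (LINT x:strip|gauss. (u' x)\<^sup>2) / (LINT x:strip|gauss. (u x)\<^sup>2)" by blast
  have "0 < (LINT x:strip|gauss. (u x)\<^sup>2)"
    using square_integral_zero_iff[OF u(1)] u(2) square_integral_nonneg[of u] by linarith
  with rayleigh_lower_bound[OF u(1,3)] show "1 / energy_max \<le> y"
    unfolding y using energy_max_pos by (simp add: field_simps)
qed

end

section \<open>Monotonicity of the eigenvalue\<close>

text \<open>This is \<open>M(s)\<close> detached from the locale, so that several shifts can be
  compared with one and the same \<open>w\<close>; the class \<open>L20 L\<close> does not depend on
  \<open>s\<close>.\<close>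

definition max_energy :: "real \<Rightarrow> real \<Rightarrow> real" where
  "max_energy L s = hardy_weight.energy_max L (\<lambda>t. weight (s + t))"

context gauss_strip
begin

lemma max_energy_bound: "L20 L w \<Longrightarrow> (LINT t|lborel. weight (s + t) * (prim w t)\<^sup>2) \<le> max_energy L s * norm2 w"
  using energy_le unfolding energy_def max_energy_def .

lemma max_energy_integrable: "L20 L w \<Longrightarrow> integrable lborel (\<lambda>t. weight (s + t) * (prim w t)\<^sup>2)"
  by (rule energy_integrable)

lemma max_energy_attained:
  obtains w where "L20 L w" "0 < norm2 w" "(LINT t|lborel. weight (s + t) * (prim w t)\<^sup>2) = max_energy L s * norm2 w"
proof -
  obtain w where "L20 L w" "energy w = energy_max * norm2 w" "0 < norm2 w"
    by (rule eigenfunction_exists)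
  then show ?thesis by (intro that[of w]) (simp_all only: energy_def max_energy_def)
qed

lemma max_energy_pos: "0 < max_energy L s"
  unfolding max_energy_def by (rule energy_max_pos)

lemma mu1_max_energy: "mu1 (quantile s) (quantile (s + L)) = 1 / max_energy L s"
  unfolding max_energy_def by (rule mu1_eq)

end

text \<open>The reflected maximizer for \<open>s\<close> competes at the shift
  \<open>1 - L - s\<close>, where the weight is the mirror image. Applying the inequality to both
  shifts gives equality.\<close>

lemma max_energy_reflect_le:
  assumes L: "0 < L" and s: "s \<in> {0..1 - L}"
  shows "max_energy L s \<le> max_energy L (1 - L - s)"
proof -
  interpret a: gauss_strip L s using L s by unfold_locales auto
  interpret b: gauss_strip L "1 - L - s" using L s by unfold_locales auto
  obtain w where w: "L20 L w" "0 < norm2 w" "(LINT t|lborel. weight (s + t) * (prim w t)\<^sup>2) = max_energy L s * norm2 w"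
    by (rule a.max_energy_attained)
  let ?v = "\<lambda>x. - w (L - x)"
  have p: "weight (1 - L - s + t) = weight (s + (L + (-1) * t))" for t
  proof -
    have "weight (1 - L - s + t) = weight (1 - (s + (L + (-1) * t)))" by (rule arg_cong[where f=weight]) simp
    then show ?thesis by (simp only: weight_symmetric)
  qed
  have "(LINT t|lborel. weight (1 - L - s + t) * (prim ?v t)\<^sup>2)
    = (LINT t|lborel. weight (s + (L + (-1) * t)) * (prim w (L + (-1) * t))\<^sup>2)"
    using L20_reflect(2)[OF w(1)] by (simp only: p) simp
  also have "\<dots> = (LINT t|lborel. weight (s + t) * (prim w t)\<^sup>2)"
    by (subst lborel_integral_real_affine[of "-1" "\<lambda>t. weight (s + t) * (prim w t)\<^sup>2" L]) auto
  finally have "max_energy L s * norm2 w \<le> max_energy L (1 - L - s) * norm2 ?v"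
    using b.max_energy_bound[OF L20_reflect(1)[OF w(1)]] w(3) by simp
  also have "norm2 ?v = norm2 w" unfolding norm2_def by (rule L20_reflect(3)[OF w(1)])
  finally show ?thesis using w(2) by simp
qed

lemma max_energy_reflect:
  assumes "0 < L" "s \<in> {0..1 - L}"
  shows "max_energy L (1 - L - s) = max_energy L s"
  using max_energy_reflect_le[OF assms] max_energy_reflect_le[OF assms(1), of "1 - L - s"] assms by simp

text \<open>The maximizer at the intermediate shift serves as competitor at \<open>x\<close> and at
  \<open>y\<close>. Strict convexity of the weight makes the energy inequality strict for this one
  function.\<close>

lemma max_energy_strictly_convex:
  assumes L: "0 < L" and x: "x \<in> {0..1 - L}" and y: "y \<in> {0..1 - L}" and "x \<noteq> y" and c: "0 < c" "c < 1"
  shows "max_energy L (c * x + (1 - c) * y) < c * max_energy L x + (1 - c) * max_energy L y"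
proof -
  let ?z = "c * x + (1 - c) * y"
  have z: "0 \<le> ?z" "?z \<le> 1 - L"
  proof -
    show "0 \<le> ?z" using x y c by simp
    have "?z \<le> c * (1 - L) + (1 - c) * (1 - L)" using x y c by (intro add_mono mult_left_mono) auto
    then show "?z \<le> 1 - L" by (simp add: algebra_simps)
  qed
  interpret a: gauss_strip L x using L x by unfold_locales auto
  interpret b: gauss_strip L y using L y by unfold_locales auto
  interpret m: gauss_strip L ?z using L z by unfold_locales auto
  obtain w where w: "L20 L w" "0 < norm2 w" "(LINT t|lborel. weight (?z + t) * (prim w t)\<^sup>2) = max_energy L ?z * norm2 w"
    by (rule m.max_energy_attained)
  let ?D = "\<lambda>t. c * (weight (x + t) * (prim w t)\<^sup>2) + (1 - c) * (weight (y + t) * (prim w t)\<^sup>2) - weight (?z + t) * (prim w t)\<^sup>2"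
  note i = a.max_energy_integrable[OF w(1)] b.max_energy_integrable[OF w(1)] m.max_energy_integrable[OF w(1)]
  have D: "?D t = (c * weight (x + t) + (1 - c) * weight (y + t) - weight (?z + t)) * (prim w t)\<^sup>2" for t
    by (simp add: algebra_simps)
  have pos: "0 < c * weight (x + t) + (1 - c) * weight (y + t) - weight (?z + t)" if t: "t \<in> {0<..<L}" for t
  proof -
    have "c * (x + t) + (1 - c) * (y + t) = ?z + t" by (simp add: algebra_simps)
    then show ?thesis
      using weight_strictly_convex[of "x + t" "y + t" c] x y c t \<open>x \<noteq> y\<close> by simp
  qed
  have Dn: "0 \<le> ?D t" for t
    unfolding D using pos[of t] prim_outside[OF w(1), of t] by (cases "t \<in> {0<..<L}") auto
  have iD: "integrable lborel ?D" using i by simp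
  have ID: "(LINT t|lborel. ?D t) = c * (LINT t|lborel. weight (x + t) * (prim w t)\<^sup>2)
      + (1 - c) * (LINT t|lborel. weight (y + t) * (prim w t)\<^sup>2) - (LINT t|lborel. weight (?z + t) * (prim w t)\<^sup>2)"
    using i by simp
  \<comment> \<open>The integrand is a positive factor times the square of \<open>prim w\<close> on
    \<open>{0<..<L}\<close>. If its integral vanished, so would the energy of the maximizer,
    contradicting that the maximum is positive.\<close>
  have "(LINT t|lborel. ?D t) \<noteq> 0"
  proof
    assume "(LINT t|lborel. ?D t) = 0"
    then have "AE t in lborel. ?D t = 0"
      using integral_nonneg_eq_0_iff_AE[OF iD] Dn by simp
    then have "AE t in lborel. weight (?z + t) * (prim w t)\<^sup>2 = 0"
    proof eventually_elim
      case (elim t)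
      then show ?case using pos[of t] prim_outside[OF w(1), of t] unfolding D by (cases "t \<in> {0<..<L}") auto
    qed
    then have "(LINT t|lborel. weight (?z + t) * (prim w t)\<^sup>2) = 0" by (rule integral_eq_zero_AE)
    with w(2,3) m.max_energy_pos show False by simp
  qed
  moreover have "0 \<le> (LINT t|lborel. ?D t)" by (rule Bochner_Integration.integral_nonneg) (rule Dn)
  ultimately have "max_energy L ?z * norm2 w < c * (LINT t|lborel. weight (x + t) * (prim w t)\<^sup>2)
      + (1 - c) * (LINT t|lborel. weight (y + t) * (prim w t)\<^sup>2)"
    unfolding ID w(3) by simp
  also have "\<dots> \<le> c * (max_energy L x * norm2 w) + (1 - c) * (max_energy L y * norm2 w)"
    using c by (intro add_mono mult_left_mono a.max_energy_bound b.max_energy_bound w(1)) auto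
  also have "\<dots> = (c * max_energy L x + (1 - c) * max_energy L y) * norm2 w" by (simp add: algebra_simps)
  finally show ?thesis using w(2) by simp
qed

lemma max_energy_strict_antimono:
  assumes L: "0 < L" and x: "0 \<le> x" and xy: "x < y" and y: "y \<le> (1 - L) / 2"
  shows "max_energy L y < max_energy L x"
proof -
  let ?x' = "1 - L - x"
  \<comment> \<open>The coefficient that writes \<open>y\<close> as a convex combination of
    \<open>x\<close> and its mirror point \<open>?x'\<close>, where the function takes the same
    value.\<close>
  define c where "c = (?x' - y) / (?x' - x)"
  have d: "0 < ?x' - x" "0 < ?x' - y" "?x' - y < ?x' - x" using assms by auto
  then have c: "0 < c" "c < 1" by (auto simp: c_def)
  have "c * (?x' - x) = ?x' - y" using d(1) unfolding c_def by simp
  then have "c * x + (1 - c) * ?x' = y" by (simp add: algebra_simps)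
  moreover have "max_energy L (c * x + (1 - c) * ?x') < c * max_energy L x + (1 - c) * max_energy L ?x'"
    by (rule max_energy_strictly_convex[OF L _ _ _ c]) (use assms d in auto)
  moreover have "max_energy L ?x' = max_energy L x" by (rule max_energy_reflect[OF L]) (use assms in auto)
  ultimately show ?thesis by (simp add: algebra_simps)
qed

lemma max_energy_extremes:
  assumes L: "0 < L" and s: "s \<in> {0..1 - L}"
  shows "max_energy L s \<le> max_energy L 0" "max_energy L ((1 - L) / 2) \<le> max_energy L s"
proof -
  have *: "max_energy L r \<le> max_energy L 0 \<and> max_energy L ((1 - L) / 2) \<le> max_energy L r"
    if r: "0 \<le> r" "r \<le> (1 - L) / 2" for r
  proof
    show "max_energy L r \<le> max_energy L 0"
    proof (cases "r = 0")
      case False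
      with r show ?thesis by (intro max_energy_strict_antimono[OF L, THEN less_imp_le]) auto
    qed simp
    show "max_energy L ((1 - L) / 2) \<le> max_energy L r"
    proof (cases "r = (1 - L) / 2")
      case True
      show ?thesis unfolding True by (rule order_refl)
    next
      case False
      then have "r < (1 - L) / 2" using r(2) by linarith
      with r show ?thesis by (intro max_energy_strict_antimono[OF L, THEN less_imp_le]) auto
    qed
  qed
  have "max_energy L s \<le> max_energy L 0 \<and> max_energy L ((1 - L) / 2) \<le> max_energy L s"
  proof (cases "s \<le> (1 - L) / 2")
    case True
    with *[of s] s show ?thesis by simp
  next
    case False
    with *[of "1 - L - s"] s show ?thesis by (simp add: max_energy_reflect[OF L s])
  qed
  then show "max_energy L s \<le> max_energy L 0" "max_energy L ((1 - L) / 2) \<le> max_energy L s" by auto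
qed

section \<open>Interval endpoints as quantiles and values of the error function\<close>

lemma quantile_less_iff:
  assumes "s \<in> {0..1}" "s' \<in> {0..1}"
  shows "quantile s < quantile s' \<longleftrightarrow> s < s'"
proof -
  have *: "quantile r < quantile r'" if "0 \<le> r" "r < r'" "r' \<le> 1" for r r'
  proof -
    interpret gauss_strip "r' - r" r using that by unfold_locales auto
    show ?thesis using quantile_less by simp
  qed
  show ?thesis
    using *[of s s'] *[of s' s] assms by (cases s s' rule: linorder_cases) auto
qed

lemma quantile_le_iff:
  "s \<in> {0..1} \<Longrightarrow> s' \<in> {0..1} \<Longrightarrow> quantile s \<le> quantile s' \<longleftrightarrow> s \<le> s'"
  using quantile_less_iff[of s' s] by (simp add: linorder_not_less[symmetric])

lemma quantile_surj: obtains s where "s \<in> {0..1}" "b = quantile s"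
proof (cases b)
  case (real x)
  have "Phi x \<in> {0..1}" "b = quantile (Phi x)"
    using Phi_range[of x] real by (auto simp: quantile_def Phi_inv_Phi)
  then show ?thesis by (rule that)
next
  case PInf
  then show ?thesis using that[of 1] by (simp add: quantile_def)
next
  case MInf
  then show ?thesis using that[of 0] by (simp add: quantile_def)
qed

lemma quantile_uminus: "s \<in> {0..1} \<Longrightarrow> - quantile s = quantile (1 - s)"
  using Phi_inv_minus[of s] by (auto simp: quantile_def)

lemma quantile_0: "quantile 0 = -\<infinity>" and quantile_1: "quantile 1 = \<infinity>"
  by (simp_all add: quantile_def)

lemma gamma1_quantile:
  assumes "0 \<le> s" "s \<le> s'" "s' \<le> 1"
  shows "gamma1 (quantile s) (quantile s') = s' - s"
proof -
  let ?S = "einterval (quantile s) (quantile s')"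
  have "gamma1 (quantile s) (quantile s') = (LINT x|gauss. indicator ?S x)"
    unfolding gamma1_def by (simp add: gauss_def)
  also have "\<dots> = (LINT t|lborel. indicator {0<..<1} t * indicator ?S (Phi_inv t))"
    by (rule gauss_quantile_transform) simp
  also have "\<dots> = (LINT t|lborel. indicator {s<..<s'} t)"
  proof (rule Bochner_Integration.integral_cong[OF refl])
    fix t :: real
    show "indicator {0<..<1} t * indicator ?S (Phi_inv t) = (indicator {s<..<s'} t :: real)"
      using Phi_Phi_inv[of t] assms unfolding einterval_quantile by (cases "t \<in> {0<..<1}") (auto simp: indicator_def)
  qed
  also have "\<dots> = s' - s" using assms by simp
  finally show ?thesis .
qed

text \<open>Every extended real is a quantile, so a competing endpoint has the form
  \<open>quantile s'\<close>, and its mass \<open>s' - s\<close> determines it.\<close>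

lemma right_end_quantile:
  assumes L: "0 < L" and s: "s \<in> {0..1 - L}"
  shows "right_end L (quantile s) = quantile (s + L)"
  unfolding right_end_def
proof (rule the_equality)
  show "quantile s < quantile (s + L) \<and> gamma1 (quantile s) (quantile (s + L)) = L"
    using L s by (simp add: quantile_less_iff gamma1_quantile)
next
  fix b assume b: "quantile s < b \<and> gamma1 (quantile s) b = L"
  obtain s' where s': "s' \<in> {0..1}" "b = quantile s'" by (rule quantile_surj)
  then have "s < s'" using b s L quantile_less_iff[of s s'] by simp
  then have "s' - s = L" using b s s' gamma1_quantile[of s s'] by simp
  then show "b = quantile (s + L)" using s' by (simp add: algebra_simps)
qed

text \<open>Both sides have the same derivative and agree at 0, where \<open>Phi\<close> is 1/2 by
  symmetry.\<close>

lemma erf_eq_Phi: "erf (ereal x) = 2 * Phi (sqrt 2 * x) - 1"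
proof -
  let ?E = "\<lambda>x. erf (ereal x)"
  have cont: "continuous_on S (\<lambda>t::real. exp (- t\<^sup>2))" for S by (intro continuous_intros)
  have dE: "(?E has_real_derivative 2 / sqrt pi * exp (- x\<^sup>2)) (at x)" for x
  proof -
    \<comment> \<open>The interval must contain the base point 0 of the integral and have
      \<open>x\<close> in its interior, to give a two-sided derivative.\<close>
    define a where "a = min x 0 - 1"
    define b where "b = max x 0 + 1"
    have ab: "a < x" "x < b" "a \<le> 0" "0 \<le> b" by (auto simp: a_def b_def)
    have "((\<lambda>u. LBINT t=ereal 0..ereal u. exp (- t\<^sup>2)) has_vector_derivative exp (- x\<^sup>2)) (at x within {a..b})"
      by (rule interval_integral_FTC2[OF ab(3,4) cont]) (use ab in auto)
    then have "((\<lambda>u. LBINT t=0..ereal u. exp (- t\<^sup>2)) has_real_derivative exp (- x\<^sup>2)) (at x)"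
      using ab by (simp add: at_within_Icc_at has_real_derivative_iff_has_vector_derivative zero_ereal_def)
    from DERIV_cmult[OF this, of "2 / sqrt pi"] show ?thesis unfolding erf.simps .
  qed
  have dP: "((\<lambda>x. 2 * Phi (sqrt 2 * x) - 1) has_real_derivative 2 / sqrt pi * exp (- x\<^sup>2)) (at x)" for x
  proof -
    have "((\<lambda>x. Phi (sqrt 2 * x)) has_real_derivative std_normal_density (sqrt 2 * x) * sqrt 2) (at x)"
      by (rule DERIV_chain2[of Phi _ "\<lambda>x. sqrt 2 * x", OF Phi_deriv]) (auto intro!: derivative_eq_intros)
    then have "((\<lambda>x. 2 * Phi (sqrt 2 * x) - 1) has_real_derivative 2 * (std_normal_density (sqrt 2 * x) * sqrt 2)) (at x)"
      by (auto intro!: derivative_eq_intros)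
    also have "2 * (std_normal_density (sqrt 2 * x) * sqrt 2) = 2 / sqrt pi * exp (- x\<^sup>2)"
      by (simp add: std_normal_density_def power_mult_distrib real_sqrt_mult)
    finally show ?thesis .
  qed
  have "\<exists>c. \<forall>x\<in>UNIV. ?E x - (2 * Phi (sqrt 2 * x) - 1) = c"
  proof (rule has_field_derivative_zero_constant)
    fix x :: real
    show "((\<lambda>x. ?E x - (2 * Phi (sqrt 2 * x) - 1)) has_real_derivative 0) (at x within UNIV)"
      using DERIV_diff[OF dE[of x] dP[of x]] by simp
  qed simp
  then obtain c where c: "\<And>x. ?E x - (2 * Phi (sqrt 2 * x) - 1) = c" by blast
  have "Phi 0 = 1 / 2" using Phi_minus[of 0] by simp
  moreover have "?E 0 = 0" unfolding erf.simps by (simp add: zero_ereal_def)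
  ultimately have "c = 0" using c[of 0] by simp
  with c[of x] show ?thesis by simp
qed

lemma erf_infinity: "erf \<infinity> = 1" "erf (- \<infinity>) = - 1"
  using erf.simps(2,3) by simp_all

lemma erf_inj: "inj erf"
proof (rule injI)
  fix a b :: ereal assume "erf a = erf b"
  have finite: "erf (ereal x) \<noteq> 1" "erf (ereal x) \<noteq> - 1" for x
    using Phi_range[of "sqrt 2 * x"] by (simp_all add: erf_eq_Phi del: erf.simps)
  from \<open>erf a = erf b\<close> show "a = b"
  proof (cases a; cases b)
    fix x y :: real assume "a = ereal x" "b = ereal y" "erf a = erf b"
    then show ?thesis using injD[OF Phi_inj, of "sqrt 2 * x" "sqrt 2 * y"] by (simp add: erf_eq_Phi del: erf.simps)
  qed (auto simp: erf_infinity finite finite[symmetric] simp del: erf.simps)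
qed

text \<open>The dictionary for the endpoints. The inverse is taken on the extended reals, and
  injectivity of \<open>erf\<close> there makes it return the intended, possibly infinite,
  argument.\<close>

lemma erf_inv_quantile:
  assumes "s \<in> {0..1}"
  shows "ereal (sqrt 2) * erf_inv (2 * s - 1) = quantile s"
proof -
  have inv: "erf_inv (erf e) = e" for e unfolding erf_inv_def by (rule inv_f_f[OF erf_inj])
  consider "s = 0" | "s = 1" | "s \<in> {0<..<1}" using assms by fastforce
  then show ?thesis
  proof cases
    case 1
    then show ?thesis using inv[of "- \<infinity>"] by (simp add: quantile_def erf_infinity)
  next
    case 2
    then show ?thesis using inv[of \<infinity>] by (simp add: quantile_def erf_infinity)
  next
    case 3
    have "erf (ereal (Phi_inv s / sqrt 2)) = 2 * s - 1" using Phi_Phi_inv[OF 3] by (simp add: erf_eq_Phi del: erf.simps)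
    then have "erf_inv (2 * s - 1) = ereal (Phi_inv s / sqrt 2)" using inv[of "ereal (Phi_inv s / sqrt 2)"] by simp
    with 3 show ?thesis by (simp add: quantile_def)
  qed
qed

theorem theorem3p1:
  fixes L :: real and A :: "ereal set" and f :: "ereal \<Rightarrow> real"
  assumes "0 < L" and "L < 1"
  defines "A \<equiv> {-\<infinity> .. ereal (sqrt 2) * erf_inv (1 - 2 * L)}"
    and "f \<equiv> (\<lambda>a. mu1 a (right_end L a))"
  shows "mu1 (-\<infinity>) (ereal (sqrt 2) * erf_inv (2 * L - 1)) \<in> f ` A \<and>
     (\<forall>a\<in>A. mu1 (-\<infinity>) (ereal (sqrt 2) * erf_inv (2 * L - 1)) \<le> f a) \<and>
     mu1 (-\<infinity>) (ereal (sqrt 2) * erf_inv (2 * L - 1)) =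
       mu1 (ereal (sqrt 2) * erf_inv (1 - 2 * L)) \<infinity> \<and>
     mu1 (- (ereal (sqrt 2) * erf_inv L)) (ereal (sqrt 2) * erf_inv L) \<in> f ` A \<and>
     (\<forall>a\<in>A. f a \<le> mu1 (- (ereal (sqrt 2) * erf_inv L)) (ereal (sqrt 2) * erf_inv L)) \<and>
     strict_mono_on {-\<infinity> .. - (ereal (sqrt 2) * erf_inv L)} f"
proof -
  note L = \<open>0 < L\<close> \<open>L < 1\<close>
  have strip: "gauss_strip L s" if "s \<in> {0..1 - L}" for s using that L by unfold_locales auto
  \<comment> \<open>The four endpoints become the quantiles of \<open>1 - L\<close>,
    \<open>L\<close>, \<open>(1 + L) / 2\<close> and \<open>(1 - L) / 2\<close>, so the interval
    claimed to be optimal for the maximum is the one with \<open>s\<close> at the midpoint of its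
    range.\<close>
  have e1: "ereal (sqrt 2) * erf_inv (1 - 2 * L) = quantile (1 - L)"
    using erf_inv_quantile[of "1 - L"] L by (simp add: algebra_simps)
  have e2: "ereal (sqrt 2) * erf_inv (2 * L - 1) = quantile L"
    using erf_inv_quantile[of L] L by simp
  have half: "2 * ((1 + L) / 2) - 1 = L" "(1 - L) / 2 + L = (1 + L) / 2" by (simp_all add: field_simps)
  have e3: "ereal (sqrt 2) * erf_inv L = quantile ((1 + L) / 2)"
    using erf_inv_quantile[of "(1 + L) / 2", unfolded half] L by simp
  have e4: "- quantile ((1 + L) / 2) = quantile ((1 - L) / 2)"
    using quantile_uminus[of "(1 + L) / 2"] L by (simp add: field_simps)
  \<comment> \<open>In the parameter \<open>s\<close> the function is a reciprocal, so minimum and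
    maximum are exchanged and the strict decrease of \<open>max_energy\<close> becomes strict
    increase.\<close>
  have f: "f (quantile s) = 1 / max_energy L s" if "s \<in> {0..1 - L}" for s
    unfolding f_def right_end_quantile[OF L(1) that] by (rule gauss_strip.mu1_max_energy[OF strip[OF that]])
  have pos: "0 < max_energy L s" if "s \<in> {0..1 - L}" for s
    by (rule gauss_strip.max_energy_pos[OF strip[OF that]])
  have below: "\<exists>s\<in>{0..r}. a = quantile s" if "a \<in> {-\<infinity>..quantile r}" "r \<in> {0..1}" for a r
  proof -
    obtain s where s: "s \<in> {0..1}" "a = quantile s" by (rule quantile_surj)
    then have "s \<le> r" using that quantile_le_iff[of s r] by simp
    with s show ?thesis by auto
  qed
  have A: "A = quantile ` {0..1 - L}"
  proof
    show "A \<subseteq> quantile ` {0..1 - L}"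
    proof
      fix a assume "a \<in> A"
      then show "a \<in> quantile ` {0..1 - L}" unfolding A_def e1 image_iff by (rule below) (use L in auto)
    qed
    show "quantile ` {0..1 - L} \<subseteq> A" unfolding A_def e1 using L by (auto simp: quantile_le_iff)
  qed
  have m1: "mu1 (-\<infinity>) (quantile L) = 1 / max_energy L 0"
    using gauss_strip.mu1_max_energy[OF strip, of 0] L by (simp add: quantile_0)
  have m2: "mu1 (quantile (1 - L)) \<infinity> = 1 / max_energy L (1 - L)"
    using gauss_strip.mu1_max_energy[OF strip, of "1 - L"] L by (simp add: quantile_1)
  have m3: "mu1 (quantile ((1 - L) / 2)) (quantile ((1 + L) / 2)) = 1 / max_energy L ((1 - L) / 2)"
    using gauss_strip.mu1_max_energy[OF strip, of "(1 - L) / 2", unfolded half] L by simp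
  have 0: "0 \<in> {0..1 - L}" and c: "(1 - L) / 2 \<in> {0..1 - L}" using L by auto
  show ?thesis
    unfolding e1 e2 e3 e4 m1 m2 m3 A
  proof (intro conjI ballI)
    show "1 / max_energy L 0 \<in> f ` quantile ` {0..1 - L}"
      unfolding f[OF 0, symmetric] using 0 by (intro imageI)
    show "1 / max_energy L ((1 - L) / 2) \<in> f ` quantile ` {0..1 - L}"
      unfolding f[OF c, symmetric] using c by (intro imageI)
    show "1 / max_energy L 0 = 1 / max_energy L (1 - L)"
      using max_energy_reflect[OF L(1) 0] by simp
    fix a assume "a \<in> quantile ` {0..1 - L}"
    then obtain s where s: "s \<in> {0..1 - L}" "a = quantile s" by blast
    show "1 / max_energy L 0 \<le> f a"
      unfolding s(2) f[OF s(1)] by (intro divide_left_mono max_energy_extremes(1)[OF L(1) s(1)] mult_pos_pos pos 0 s) simp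
    show "f a \<le> 1 / max_energy L ((1 - L) / 2)"
      unfolding s(2) f[OF s(1)] by (intro divide_left_mono max_energy_extremes(2)[OF L(1) s(1)] mult_pos_pos pos c s) simp
  next
    show "strict_mono_on {-\<infinity>..quantile ((1 - L) / 2)} f"
    proof (rule strict_mono_onI)
      fix a b :: ereal
      assume ab: "a \<in> {-\<infinity>..quantile ((1 - L) / 2)}" "b \<in> {-\<infinity>..quantile ((1 - L) / 2)}" "a < b"
      obtain s where s: "s \<in> {0..(1 - L) / 2}" "a = quantile s" using below[OF ab(1)] L by auto
      obtain s' where s': "s' \<in> {0..(1 - L) / 2}" "b = quantile s'" using below[OF ab(2)] L by auto
      have "s < s'" using ab(3) s s' L quantile_less_iff[of s s'] by simp
      then have "max_energy L s' < max_energy L s"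
        using s s' by (intro max_energy_strict_antimono L) auto
      moreover have "s \<in> {0..1 - L}" "s' \<in> {0..1 - L}" using s s' L by auto
      ultimately show "f a < f b"
        unfolding s(2) s'(2) by (simp add: f pos divide_strict_left_mono)
    qed
  qed
qed

end
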